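(* Let $\rho\in(0,\rho_0)$ with $\rho_0>0$ a sufficiently small absolute constant, $\sigma=\sqrt{1-\rho^2}$, $s\in(0,1)$ with $s/\rho\le 0.001$, and $\alpha\in(0,1)$. Suppose that $\alpha\gg d^{-\mathrm{polylog}(d)}$ and $\rho^2\ge s^2\log^C(d/\alpha)$ for a sufficiently large absolute constant $C>0$. Then for any measurable $f:\mathbb R^d\times\mathbb R\to[0,1]$, $$\mathbb P_{v\sim S^{d-1}}\Big[\big|\mathbb E_{Q_v}[f]-\mathbb E_{T_v}[f]\big|\gtrsim (\alpha/d)^{\log^2(d/\alpha)}\Big]\le d^{-\log^2 d}.$$
   Context: $\lesssim,\gtrsim,\gg$ hide absolute constants. $\mathrm{DG}(\mu,\sigma,\theta,s)$ is the discrete Gaussian on $\theta+s\mathbb Z$ with mass at $\theta+si$ ($i\in\mathbb Z$) proportional to the $\mathcal N(\mu,\sigma^2)$ density at $\theta+si$. Let $E=\mathrm{DG}(0,\sigma,0,s)$ and $R$ the law of $G+z$ with $G\sim\mathcal N(0,\rho^2)$, $z\sim E$ independent. For $y\in\mathbb R$ let $A_y=\mathrm{DG}(\rho y,\sigma,y/\rho,s/\rho)$ and $B_y=\mathcal N(\rho y,\sigma^2)$. For a unit vector $v$ and univariate distribution $\mathcal H$, $P^{\mathcal H}_v$ is the distribution of $X\in\mathbb R^d$ with $v^\top X\sim\mathcal H$ independent of the projection onto $v^\perp$, which is standard Gaussian on $v^\perp$. $Q_v$ is the distribution of $(x,y)$ with $y\sim R$ and conditionally on $y$, $x\sim P^{A_y}_v$;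 $T_v$ is the same with $B_y$ in place of $A_y$. $v$ is uniform on the unit sphere $S^{d-1}$. *)

theory Defs
  imports "HOL-Probability.Probability"
    "HOL-Library.Landau_Symbols"
begin

text \<open>
  The absolute constants in the theorem must not depend on the dimension, so the dimension cannot
  be a type: a point of d-dimensional space is a function in the extensional product over
  \<open>{..<d}\<close>, with Euclidean norm \<^const>\<open>L2_set\<close>.
\<close>

abbreviation Rd :: "nat \<Rightarrow> (nat \<Rightarrow> real) measure" where
  "Rd d \<equiv> Pi\<^sub>M {..<d} (\<lambda>_. borel)"

text \<open>The second parameter is the standard deviation, as in \<^const>\<open>normal_density\<close>.\<close>

definition normal_law :: "real \<Rightarrow> real \<Rightarrow> real measure" where
  "normal_law \<mu> \<sigma> = density lborel (normal_density \<mu> \<sigma>)"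

definition std_gaussian :: "nat \<Rightarrow> (nat \<Rightarrow> real) measure" where
  "std_gaussian d = Pi\<^sub>M {..<d} (\<lambda>_. normal_law 0 1)"

text \<open>
  For \<open>\<sigma> > 0\<close> and \<open>s > 0\<close> the normalising series converges to a positive number.
\<close>

definition DG :: "real \<Rightarrow> real \<Rightarrow> real \<Rightarrow> real \<Rightarrow> real measure" where
  "DG \<mu> \<sigma> \<theta> s =
     distr
       (density (count_space (UNIV :: int set))
          (\<lambda>i. ennreal (normal_density \<mu> \<sigma> (\<theta> + s * of_int i)
                 / (\<Sum>\<^sub>\<infinity>j::int. normal_density \<mu> \<sigma> (\<theta> + s * of_int j)))))
       borel (\<lambda>i. \<theta> + s * of_int i)"

text \<open>
  Normalised surface measure: the surface measure of a subset of the unit sphere is proportional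
  to the volume of the part of the unit ball lying on the rays through that subset.
  (The null point \<open>0\<close> of the ball is sent to \<open>0\<close>.)
\<close>

definition unif_sphere :: "nat \<Rightarrow> (nat \<Rightarrow> real) measure" where
  "unif_sphere d =
     distr
       (uniform_measure (Pi\<^sub>M {..<d} (\<lambda>_. lborel))
          {x \<in> space (Rd d). L2_set x {..<d} \<le> 1})
       (Rd d) (\<lambda>x. \<lambda>i\<in>{..<d}. x i / L2_set x {..<d})"

text \<open>
  For a unit vector \<open>v\<close>: the law of \<open>t v + (g - (v \<bullet> g) v)\<close> with \<open>t \<sim> H\<close> and \<open>g\<close> standard
  Gaussian, independent; the second summand is standard Gaussian on the orthogonal complement
  of \<open>v\<close>.
\<close>

definition hidden_dir :: "nat \<Rightarrow> (nat \<Rightarrow> real) \<Rightarrow> real measure \<Rightarrow> (nat \<Rightarrow> real) measure" where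
  "hidden_dir d v H =
     distr (H \<Otimes>\<^sub>M std_gaussian d) (Rd d)
       (\<lambda>(t, g). \<lambda>i\<in>{..<d}. t * v i + (g i - (\<Sum>j<d. v j * g j) * v i))"

definition label_law :: "real \<Rightarrow> real \<Rightarrow> real \<Rightarrow> real measure" where
  "label_law \<rho> \<sigma> s = convolution (normal_law 0 \<rho>) (DG 0 \<sigma> 0 s)"

text \<open>
  The law of \<open>(x, y)\<close> with \<open>y \<sim> R\<close> and, conditionally on \<open>y\<close>, \<open>x \<sim> hidden_dir d v (K y)\<close>.
\<close>

definition joint_law ::
  "nat \<Rightarrow> (nat \<Rightarrow> real) \<Rightarrow> real measure \<Rightarrow> (real \<Rightarrow> real measure) \<Rightarrow> ((nat \<Rightarrow> real) \<times> real) measure" where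
  "joint_law d v R K =
     R \<bind> (\<lambda>y. distr (hidden_dir d v (K y)) (Rd d \<Otimes>\<^sub>M borel) (\<lambda>x. (x, y)))"

definition Q_law ::
  "nat \<Rightarrow> real \<Rightarrow> real \<Rightarrow> real \<Rightarrow> (nat \<Rightarrow> real) \<Rightarrow> ((nat \<Rightarrow> real) \<times> real) measure" where
  "Q_law d \<rho> \<sigma> s v =
     joint_law d v (label_law \<rho> \<sigma> s) (\<lambda>y. DG (\<rho> * y) \<sigma> (y / \<rho>) (s / \<rho>))"

definition T_law ::
  "nat \<Rightarrow> real \<Rightarrow> real \<Rightarrow> real \<Rightarrow> (nat \<Rightarrow> real) \<Rightarrow> ((nat \<Rightarrow> real) \<times> real) measure" where
  "T_law d \<rho> \<sigma> s v =
     joint_law d v (label_law \<rho> \<sigma> s) (\<lambda>y. normal_law (\<rho> * y) \<sigma>)"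

definition polylog :: "(nat \<Rightarrow> real) \<Rightarrow> bool" where
  "polylog p \<longleftrightarrow> (\<exists>k::nat. p \<in> O(\<lambda>d. ln (real d) ^ k))"

end

theory Submission
  imports Defs "HOL-Real_Asymp.Real_Asymp"
begin

text \<open>
  Fix the label \<open>y\<close> and let \<open>\<lambda> = A\<^sub>y - B\<^sub>y\<close>. With \<open>\<phi>(v)\<close> the sign of the deviation in direction
  \<open>v\<close>, Cauchy--Schwarz in \<open>L\<^sup>2\<close> of the standard Gaussian bounds the square of the mean absolute
  deviation by the average over independent \<open>v, w\<close> of \<open>|\<integral>\<integral> M\<^sub>r d\<lambda> d\<lambda>|\<close>, where \<open>r = \<langle>v, w\<rangle>\<close> and \<open>M\<^sub>r\<close> is
  the Mehler kernel. (As \<open>A\<^sub>y\<close> has atoms, \<open>P\<^sub>v\<close> has no density; one first applies an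
  Ornstein--Uhlenbeck smoothing with parameter \<open>a < 1\<close>, which turns \<open>M\<^sub>r\<close> into the kernel with
  parameter \<open>a\<^sup>2 r\<close>, lets \<open>a\<close> tend to \<open>1\<close> for continuous test functions, and approximates
  measurable ones.)

  For \<open>|r| \<le> 1/2\<close> the kernel times a Gaussian density is again a Gaussian density of variance at least
  \<open>1/2\<close>, so the integral against \<open>\<lambda>\<close> compares a lattice sum of spacing \<open>s/\<rho>\<close> with an integral; the
  relative error is \<open>exp(-c (\<rho>/s)\<^sup>2)\<close>. For \<open>|r| > 1/2\<close> the kernel is at most of order
  \<open>(1 - r\<^sup>2)\<^bsup>-1/2\<^esup>\<close>, and the average of this over that event is exponentially small in \<open>d\<close>. Since
  \<open>log(d/\<alpha>)\<close> is polylogarithmic in \<open>d\<close>, both errors are far below \<open>exp(-4 log\<^sup>3(d/\<alpha>))\<close>, and Markov's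
  inequality concludes.
\<close>

text \<open>The lattice error is bounded without Poisson summation. Wrapping Gaussians onto the
  circle turns convolution into circular convolution, so a wrapped Gaussian of large standard
  deviation s is a convolution power of one whose standard deviation is at least 4. The elementary
  bound 1/s on the distance of a wrapped density from 1 is then below exp(-1), and these distances
  multiply; about s^2/16 factors give exp(-s^2/32). The case split in r is forced. As r tends to 1
  or -1 the kernel times a Gaussian concentrates below the lattice spacing, where sum and integral
  differ; only the rarity of such r helps, and the singularity in r must be integrable against the
  law of r. At a fixed label y all bounds carry a factor exp((\<rho> y)^2/2), coming from moments of
  exp(t^2/4); averaging over y is possible because \<rho> is at most 1/2. The 4 in the final
  exponent, with L = log(d/\<alpha>): the square root from Cauchy--Schwarz leaves 2 L^3, the
  threshold exp(-L^3) in Markov's inequality costs L^3, and the remaining L^3 is at least log^3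
  d.\<close>

section \<open>Gaussian densities and the Mehler kernel\<close>

text \<open>
  For jointly Gaussian standard \<open>X, Y\<close> of correlation \<open>b\<close>, \<open>mehler b\<close> is the density of their
  law with respect to the product of its marginals.
\<close>

definition mehler :: "real \<Rightarrow> real \<Rightarrow> real \<Rightarrow> real" where
  "mehler b t u = exp (- (b\<^sup>2 * t\<^sup>2 + b\<^sup>2 * u\<^sup>2 - 2 * b * t * u) / (2 * (1 - b\<^sup>2))) / sqrt (1 - b\<^sup>2)"

lemma borel_measurable_mehler [measurable (raw)]:
  assumes [measurable]: "f \<in> borel_measurable M" "g \<in> borel_measurable M" "h \<in> borel_measurable M"
  shows "(\<lambda>x. mehler (f x) (g x) (h x)) \<in> borel_measurable M"
  unfolding mehler_def by measurable

lemma mehler_nonneg: "b\<^sup>2 < 1 \<Longrightarrow> 0 \<le> mehler b t u"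
  unfolding mehler_def by simp

text \<open>By 2btu \<le> |b|(t^2 + u^2) the exponent is at most |b|/(2(1 + |b|)) times t^2 + u^2,
  and this coefficient is below 1/4 for every |b| < 1. Hence moments of exp(t^2/4) control the
  kernel uniformly in b, up to the singular factor.\<close>

lemma mehler_le:
  assumes "b\<^sup>2 < 1"
  shows "mehler b t u \<le> exp (t\<^sup>2 / 4) * exp (u\<^sup>2 / 4) / sqrt (1 - b\<^sup>2)"
proof -
  have b1: "\<bar>b\<bar> < 1" using assms by (simp add: abs_square_less_1)
  have "2 * b * t * u \<le> \<bar>b\<bar> * (t\<^sup>2 + u\<^sup>2)"
  proof -
    have "2 * b * t * u \<le> \<bar>b\<bar> * (2 * \<bar>t\<bar> * \<bar>u\<bar>)"
      using abs_ge_self[of "b * t * u"] by (simp add: abs_mult mult.assoc mult.left_commute)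
    also have "\<dots> \<le> \<bar>b\<bar> * (t\<^sup>2 + u\<^sup>2)"
      using sum_squares_bound[of "\<bar>t\<bar>" "\<bar>u\<bar>"] by (intro mult_left_mono) auto
    finally show ?thesis .
  qed
  hence "- (b\<^sup>2 * t\<^sup>2 + b\<^sup>2 * u\<^sup>2 - 2 * b * t * u) \<le> \<bar>b\<bar> * (1 - \<bar>b\<bar>) * (t\<^sup>2 + u\<^sup>2)"
    by (simp add: algebra_simps power2_eq_square)
  also have "\<dots> \<le> (1 + \<bar>b\<bar>) / 2 * (1 - \<bar>b\<bar>) * (t\<^sup>2 + u\<^sup>2)"
    using b1 by (intro mult_right_mono) auto
  also have "\<dots> = (t\<^sup>2 / 4 + u\<^sup>2 / 4) * (2 * (1 - b\<^sup>2))"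
  proof -
    have "b\<^sup>2 = \<bar>b\<bar>\<^sup>2" by simp
    thus ?thesis by (simp only: power2_eq_square) (simp add: field_simps)
  qed
  finally have "- (b\<^sup>2 * t\<^sup>2 + b\<^sup>2 * u\<^sup>2 - 2 * b * t * u) / (2 * (1 - b\<^sup>2)) \<le> t\<^sup>2 / 4 + u\<^sup>2 / 4"
    using assms by (subst pos_divide_le_eq) auto
  thus ?thesis unfolding mehler_def using assms
    by (intro divide_right_mono) (auto simp flip: exp_add)
qed

text \<open>Completing the square: precisions add, so w is the new precision. Negative p is allowed
  as long as w stays positive, which covers growing weights such as exp(t^2/4). The pointwise form
  serves integrals and lattice sums alike.\<close>

lemma tilt_normal_density:
  fixes p q \<mu> \<sigma> t :: real
  assumes \<sigma>: "\<sigma> > 0" and w: "w = 1 / \<sigma>\<^sup>2 + 2 * p" "w > 0"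
  shows "exp (- p * t\<^sup>2 + q * t) * normal_density \<mu> \<sigma> t =
    exp ((\<mu> / \<sigma>\<^sup>2 + q)\<^sup>2 / (2 * w) - \<mu>\<^sup>2 / (2 * \<sigma>\<^sup>2)) / (\<sigma> * sqrt w)
      * normal_density ((\<mu> / \<sigma>\<^sup>2 + q) / w) (1 / sqrt w) t"
proof -
  define r where "r = 1 / \<sigma>\<^sup>2"
  define n where "n = \<mu> * r + q"
  have "- p * t\<^sup>2 + q * t - (t - \<mu>)\<^sup>2 / (2 * \<sigma>\<^sup>2) = - p * t\<^sup>2 + q * t - (t - \<mu>)\<^sup>2 * r / 2"
    by (simp add: r_def)
  also have "\<dots> = n\<^sup>2 / (2 * w) - \<mu>\<^sup>2 * r / 2 - (t - n / w)\<^sup>2 * w / 2"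
  proof -
    have z: "n\<^sup>2 / (2 * w) - (t - n / w)\<^sup>2 * w / 2 = t * n - t\<^sup>2 * w / 2"
      using w(2) by (simp add: power2_eq_square field_simps)
    have weq: "w = r + 2 * p" using w by (simp add: r_def)
    have "- p * t\<^sup>2 + q * t - (t - \<mu>)\<^sup>2 * r / 2 = t * n - t\<^sup>2 * w / 2 - \<mu>\<^sup>2 * r / 2"
      unfolding n_def weq by (simp add: power2_eq_square field_simps)
    thus ?thesis using z by simp
  qed
  finally have e: "- p * t\<^sup>2 + q * t - (t - \<mu>)\<^sup>2 / (2 * \<sigma>\<^sup>2)
      = n\<^sup>2 / (2 * w) - \<mu>\<^sup>2 / (2 * \<sigma>\<^sup>2) - (t - n / w)\<^sup>2 * w / 2"
    by (simp add: r_def)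
  have "exp (- p * t\<^sup>2 + q * t) * normal_density \<mu> \<sigma> t =
    exp (- p * t\<^sup>2 + q * t - (t - \<mu>)\<^sup>2 / (2 * \<sigma>\<^sup>2)) / sqrt (2 * pi * \<sigma>\<^sup>2)"
    by (simp add: normal_density_def exp_add[symmetric])
  also have "\<dots> = exp (n\<^sup>2 / (2 * w) - \<mu>\<^sup>2 / (2 * \<sigma>\<^sup>2)) / (\<sigma> * sqrt w) * normal_density (n / w) (1 / sqrt w) t"
  proof -
    have "normal_density (n / w) (1 / sqrt w) t = sqrt w / sqrt (2 * pi) * exp (- ((t - n / w)\<^sup>2 * w / 2))"
      using w(2) by (simp add: normal_density_def power_divide real_sqrt_divide)
    thus ?thesis unfolding e exp_diff exp_minus using w(2) \<sigma>
      by (simp add: real_sqrt_mult field_simps)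
  qed
  finally show ?thesis by (simp add: n_def r_def)
qed

section \<open>Integrals against one-dimensional normal laws\<close>

lemma sets_normal_law [simp, measurable_cong]: "sets (normal_law \<mu> \<sigma>) = sets borel"
  and space_normal_law [simp]: "space (normal_law \<mu> \<sigma>) = UNIV"
  by (auto simp: normal_law_def)

lemma prob_space_normal_law: "\<sigma> > 0 \<Longrightarrow> prob_space (normal_law \<mu> \<sigma>)"
  unfolding normal_law_def by (rule prob_space_normal_density)

lemma nn_integral_normal_law:
  assumes [measurable]: "g \<in> borel_measurable borel"
  shows "(\<integral>\<^sup>+x. g x \<partial>normal_law \<mu> \<sigma>) = (\<integral>\<^sup>+x. ennreal (normal_density \<mu> \<sigma> x) * g x \<partial>lborel)"
  unfolding normal_law_def by (subst nn_integral_density) auto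

lemma nn_integral_normal_density:
  assumes "\<sigma> > 0" shows "(\<integral>\<^sup>+x. ennreal (normal_density \<mu> \<sigma> x) \<partial>lborel) = 1"
  using prob_space.emeasure_space_1[OF prob_space_normal_density[OF assms, of \<mu>]]
  by (simp add: emeasure_density)

lemma nn_integral_normal_law_tilt:
  assumes eq: "\<And>t. g t * normal_density \<mu> \<sigma> t = N * normal_density m \<kappa> t"
    and pos: "\<kappa> > 0" "N \<ge> 0" "\<And>t. g t \<ge> 0"
    and [measurable]: "g \<in> borel_measurable borel"
  shows "(\<integral>\<^sup>+t. ennreal (g t) \<partial>normal_law \<mu> \<sigma>) = ennreal N"
proof -
  have "(\<integral>\<^sup>+t. ennreal (g t) \<partial>normal_law \<mu> \<sigma>) = (\<integral>\<^sup>+t. ennreal (normal_density \<mu> \<sigma> t * g t) \<partial>lborel)"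
    using pos by (subst nn_integral_normal_law) (auto simp: ennreal_mult)
  also have "\<dots> = (\<integral>\<^sup>+t. ennreal N * ennreal (normal_density m \<kappa> t) \<partial>lborel)"
    using pos by (intro nn_integral_cong) (simp add: mult.commute eq ennreal_mult)
  also have "\<dots> = ennreal N"
    using pos by (subst nn_integral_cmult) (auto simp: nn_integral_normal_density)
  finally show ?thesis .
qed

text \<open>The semigroup property of the Ornstein--Uhlenbeck kernels: parameters multiply under
  composition, N(bt, 1 - b^2) being the kernel \<open>mehler b t\<close> times the standard normal
  law. The proof tilts the normal density by the kernel, which is Gaussian in u, and identifies the
  total mass.\<close>

lemma nn_integral_mehler_normal:
  assumes a: "a\<^sup>2 < 1" and b: "b\<^sup>2 < 1"
  shows "(\<integral>\<^sup>+u. ennreal (mehler a u t') \<partial>normal_law (b * t) (sqrt (1 - b\<^sup>2))) = ennreal (mehler (a * b) t t')"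
proof -
  define p q w where "p = a\<^sup>2 / (2 * (1 - a\<^sup>2))" and "q = a * t' / (1 - a\<^sup>2)"
    and "w = 1 / (sqrt (1 - b\<^sup>2))\<^sup>2 + 2 * p"
  define c where "c = exp (- (a\<^sup>2 * t'\<^sup>2) / (2 * (1 - a\<^sup>2))) / sqrt (1 - a\<^sup>2)"
  define A B where "A = 1 - a\<^sup>2" and "B = 1 - b\<^sup>2"
  have AB: "A > 0" "B > 0" "a\<^sup>2 = 1 - A" "b\<^sup>2 = 1 - B" using a b by (auto simp: A_def B_def)
  have ab: "1 - (a * b)\<^sup>2 > 0" using a b
    by (simp add: power_mult_distrib) (metis mult_strict_mono mult_1 zero_le_power2 zero_less_one)
  have w: "w = (1 - (a * b)\<^sup>2) / (A * B)"
  proof -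
    have "w = 1 / B + (1 - A) / A"
    proof -
      have "2 * p = (1 - A) / A" unfolding p_def A_def[symmetric] using AB(1) by (simp add: AB(3) field_simps)
      thus ?thesis unfolding w_def using b by (simp add: B_def)
    qed
    also have "\<dots> = (A + B - A * B) / (A * B)" using AB(1,2) by (simp add: field_simps)
    also have "A + B - A * B = 1 - (a * b)\<^sup>2" by (simp add: A_def B_def power_mult_distrib algebra_simps)
    finally show ?thesis .
  qed
  have wp: "w > 0" unfolding w using ab AB by simp
  have meh: "mehler a u t' = c * exp (- p * u\<^sup>2 + q * u)" for u
  proof -
    have "- (a\<^sup>2 * u\<^sup>2 + a\<^sup>2 * t'\<^sup>2 - 2 * a * u * t') / (2 * A)
      = - (a\<^sup>2 * t'\<^sup>2) / (2 * A) + (- (a\<^sup>2 / (2 * A)) * u\<^sup>2 + a * t' / A * u)"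
      using AB(1) by (simp add: field_simps)
    thus ?thesis unfolding mehler_def c_def p_def q_def A_def[symmetric] by (simp add: exp_add[symmetric])
  qed
  define N where "N = c * (exp ((b * t / (sqrt (1 - b\<^sup>2))\<^sup>2 + q)\<^sup>2 / (2 * w) - (b * t)\<^sup>2 / (2 * (sqrt (1 - b\<^sup>2))\<^sup>2)) / (sqrt (1 - b\<^sup>2) * sqrt w))"
  have eq: "mehler a u t' * normal_density (b * t) (sqrt (1 - b\<^sup>2)) u
    = N * normal_density ((b * t / (sqrt (1 - b\<^sup>2))\<^sup>2 + q) / w) (1 / sqrt w) u" for u
    unfolding meh N_def mult.assoc
    using tilt_normal_density[of "sqrt (1 - b\<^sup>2)" w p u q "b * t", OF _ w_def wp] b by simp
  have "N \<ge> 0" unfolding N_def c_def using a b wp by simp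
  hence "(\<integral>\<^sup>+u. ennreal (mehler a u t') \<partial>normal_law (b * t) (sqrt (1 - b\<^sup>2))) = ennreal N"
    using wp a by (intro nn_integral_normal_law_tilt[OF eq]) (auto simp: mehler_nonneg)
  also have "N = mehler (a * b) t t'"
  proof -
    have "sqrt (1 - a\<^sup>2) * (sqrt (1 - b\<^sup>2) * sqrt w) = sqrt (1 - (a * b)\<^sup>2)"
      unfolding w using AB by (simp flip: real_sqrt_mult A_def B_def)
    moreover have "- (a\<^sup>2 * t'\<^sup>2) / (2 * (1 - a\<^sup>2)) + ((b * t / (sqrt (1 - b\<^sup>2))\<^sup>2 + q)\<^sup>2 / (2 * w) - (b * t)\<^sup>2 / (2 * (sqrt (1 - b\<^sup>2))\<^sup>2))
      = - ((a * b)\<^sup>2 * t\<^sup>2 + (a * b)\<^sup>2 * t'\<^sup>2 - 2 * (a * b) * t * t') / (2 * (1 - (a * b)\<^sup>2))"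
    proof -
      define W where "W = 1 - (a * b)\<^sup>2"
      have W: "W > 0" "W = A + B - A * B"
        using ab by (simp_all add: W_def A_def B_def power_mult_distrib algebra_simps)
      have "- (a\<^sup>2 * t'\<^sup>2) / (2 * A) + ((b * t / B + a * t' / A)\<^sup>2 / (2 * (W / (A * B))) - (b * t)\<^sup>2 / (2 * B))
         = ((- a\<^sup>2 * t'\<^sup>2 * B * W) + (b * t * A + a * t' * B)\<^sup>2  - (b * t)\<^sup>2 * A * W) / (2 * A * B * W)"
        using AB(1,2) W(1) by (simp add: field_simps power2_eq_square)
      also have "(- a\<^sup>2 * t'\<^sup>2 * B * W) + (b * t * A + a * t' * B)\<^sup>2  - (b * t)\<^sup>2 * A * W
         = A * B * - ((a * b)\<^sup>2 * t\<^sup>2 + (a * b)\<^sup>2 * t'\<^sup>2 - 2 * (a * b) * t * t')"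
      proof -
        have *: "B - W = - (A * b\<^sup>2)" "A - W = - (B * a\<^sup>2)"
          unfolding W(2) AB(3,4) by (simp_all add: algebra_simps)
        have "(- a\<^sup>2 * t'\<^sup>2 * B * W) + (b * t * A + a * t' * B)\<^sup>2  - (b * t)\<^sup>2 * A * W =
            a\<^sup>2 * t'\<^sup>2 * B * (B - W) + b\<^sup>2 * t\<^sup>2 * A * (A - W) + 2 * A * B * (a * b) * t * t'"
          by (simp add: power2_eq_square algebra_simps)
        thus ?thesis unfolding * by (simp add: power_mult_distrib algebra_simps)
      qed
      also have "A * B * - ((a * b)\<^sup>2 * t\<^sup>2 + (a * b)\<^sup>2 * t'\<^sup>2 - 2 * (a * b) * t * t') / (2 * A * B * W)
         = - ((a * b)\<^sup>2 * t\<^sup>2 + (a * b)\<^sup>2 * t'\<^sup>2 - 2 * (a * b) * t * t') / (2 * W)"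
        using AB(1,2) by simp
      finally have fin: "- (a\<^sup>2 * t'\<^sup>2) / (2 * A) + ((b * t / B + a * t' / A)\<^sup>2 / (2 * (W / (A * B))) - (b * t)\<^sup>2 / (2 * B))
         = - ((a * b)\<^sup>2 * t\<^sup>2 + (a * b)\<^sup>2 * t'\<^sup>2 - 2 * (a * b) * t * t') / (2 * W)" .
      have sq: "(sqrt (1 - b\<^sup>2))\<^sup>2 = B" "1 - a\<^sup>2 = A" using a b by (auto simp: A_def B_def)
      show ?thesis unfolding sq q_def w W_def[symmetric] by (rule fin)
    qed
    ultimately show ?thesis unfolding N_def c_def mehler_def
      by (simp add: exp_add[symmetric])
  qed
  finally show ?thesis .
qed

text \<open>The conditional law of one coordinate given the other, for standard Gaussians of
  correlation a.\<close>

lemma mehler_std_normal: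
  assumes a: "a\<^sup>2 < 1"
  shows "mehler a u t * normal_density 0 1 u = normal_density (a * t) (sqrt (1 - a\<^sup>2)) u"
proof -
  have "- (a\<^sup>2 * u\<^sup>2 + a\<^sup>2 * t\<^sup>2 - 2 * a * u * t) / (2 * (1 - a\<^sup>2)) - u\<^sup>2 / 2 = - (u - a * t)\<^sup>2 / (2 * (1 - a\<^sup>2))"
    using a by (simp add: field_simps power2_eq_square)
  thus ?thesis using a unfolding mehler_def normal_density_def
    by (simp add: real_sqrt_mult exp_add[symmetric])
qed

text \<open>The tilt with p = -1/4 and q = 0. Its precision is smaller than that of the given
  density, so \<kappa> \<ge> \<sigma> and lattice sums of the tilted density are at least as
  regular. With w the new precision, \<sigma> * sqrt w = sqrt(1 - \<sigma>^2/2) lies between 1/2 and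
  1, which gives the factor 2, and the exponent becomes \<mu>^2/(2(2 - \<sigma>^2)).\<close>

lemma exp_square_tilt:
  assumes \<sigma>: "0 < \<sigma>" "\<sigma> \<le> 1"
  obtains N m \<kappa> where "\<And>t. exp (t\<^sup>2 / 4) * normal_density \<mu> \<sigma> t = N * normal_density m \<kappa> t"
    "\<kappa> \<ge> \<sigma>" "N \<ge> 0" "N \<le> 2 * exp (\<mu>\<^sup>2 / 2)"
proof -
  define w where "w = 1 / \<sigma>\<^sup>2 + 2 * (-1/4)"
  define N where "N = exp ((\<mu> / \<sigma>\<^sup>2)\<^sup>2 / (2 * w) - \<mu>\<^sup>2 / (2 * \<sigma>\<^sup>2)) / (\<sigma> * sqrt w)"
  have s2: "\<sigma>\<^sup>2 \<le> 1" "\<sigma>\<^sup>2 > 0" using \<sigma> by (auto simp: power_le_one)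
  have ws: "w * \<sigma>\<^sup>2 = 1 - \<sigma>\<^sup>2 / 2" using \<sigma> by (simp add: w_def field_simps)
  have wp: "w > 0" using s2 ws by (smt (verit) zero_less_mult_pos2 field_sum_of_halves)
  have sw: "\<sigma> * sqrt w = sqrt (1 - \<sigma>\<^sup>2 / 2)" using \<sigma> by (simp flip: ws add: real_sqrt_mult)
  have "\<sigma> * sqrt w \<le> 1" unfolding sw using s2 by simp
  hence 1: "1 / sqrt w \<ge> \<sigma>" using wp by (simp add: field_simps)
  have "sqrt (1/4) \<le> \<sigma> * sqrt w" unfolding sw using s2 by (intro real_sqrt_le_mono) auto
  hence 2: "1/2 \<le> \<sigma> * sqrt w" by (simp add: real_sqrt_divide)
  have "(\<mu> / \<sigma>\<^sup>2)\<^sup>2 / (2 * w) - \<mu>\<^sup>2 / (2 * \<sigma>\<^sup>2) = \<mu>\<^sup>2 / (2 * \<sigma>\<^sup>2) * (1 / (w * \<sigma>\<^sup>2) - 1)"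
    using wp \<sigma> by (simp add: field_simps power2_eq_square)
  also have "1 / (w * \<sigma>\<^sup>2) - 1 = \<sigma>\<^sup>2 / (2 - \<sigma>\<^sup>2)"
    unfolding ws using s2 by (simp add: field_simps)
  also have "\<mu>\<^sup>2 / (2 * \<sigma>\<^sup>2) * (\<sigma>\<^sup>2 / (2 - \<sigma>\<^sup>2)) = \<mu>\<^sup>2 / (2 * (2 - \<sigma>\<^sup>2))"
    using s2 by (simp add: field_simps)
  also have "\<dots> \<le> \<mu>\<^sup>2 / 2" using s2 by (intro divide_left_mono) auto
  finally have 3: "exp ((\<mu> / \<sigma>\<^sup>2)\<^sup>2 / (2 * w) - \<mu>\<^sup>2 / (2 * \<sigma>\<^sup>2)) \<le> exp (\<mu>\<^sup>2 / 2)" by simp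
  have "N \<le> exp (\<mu>\<^sup>2 / 2) / (1/2)" unfolding N_def
    using 2 3 by (intro frac_le) auto
  moreover have "exp (t\<^sup>2 / 4) * normal_density \<mu> \<sigma> t = N * normal_density ((\<mu> / \<sigma>\<^sup>2) / w) (1 / sqrt w) t" for t
    using tilt_normal_density[OF \<sigma>(1) w_def wp, of t 0 \<mu>] by (simp add: N_def)
  moreover have "N \<ge> 0" unfolding N_def using \<sigma> wp by simp
  ultimately show ?thesis using 1 by (intro that) auto
qed

section \<open>Lattice sums of Gaussian densities\<close>

abbreviation sum_int :: "(int \<Rightarrow> ennreal) \<Rightarrow> ennreal" where
  "sum_int f \<equiv> (\<integral>\<^sup>+i. f i \<partial>count_space UNIV)"

lemma sum_int_shift: "sum_int (\<lambda>i. f (i + k)) = sum_int f"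
  by (rule nn_integral_bij_count_space) (auto intro!: bij_betw_byWitness[where f' = "\<lambda>i. i - k"])

lemma sum_int_reflect: "sum_int (\<lambda>i. f (- i)) = sum_int f"
  by (rule nn_integral_bij_count_space) (auto intro!: bij_betw_byWitness[where f' = "\<lambda>i. - i"])

lemma sigma_finite_count_int: "sigma_finite_measure (count_space (UNIV :: int set))"
  by (intro sigma_finite_measure_count_space_countable) auto

lemma nn_integral_sum_int_swap:
  assumes "sigma_finite_measure M" "\<And>i. f i \<in> borel_measurable M"
  shows "(\<integral>\<^sup>+x. sum_int (\<lambda>i. f i x) \<partial>M) = sum_int (\<lambda>i. \<integral>\<^sup>+x. f i x \<partial>M)"
proof -
  interpret M: sigma_finite_measure M by fact
  interpret C: sigma_finite_measure "count_space (UNIV :: int set)" by (rule sigma_finite_count_int)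
  interpret pair_sigma_finite "count_space (UNIV :: int set)" M ..
  show ?thesis
    by (rule Fubini') (use assms(2) in \<open>auto intro!: measurable_pair_measure_countable1\<close>)
qed

lemma nn_integral_unfold_circle:
  assumes [measurable]: "f \<in> borel_measurable borel"
  shows "(\<integral>\<^sup>+x. f x \<partial>lborel) = sum_int (\<lambda>i. \<integral>\<^sup>+x. f (x + of_int i) * indicator {0..<1::real} x \<partial>lborel)"
proof -
  have one: "sum_int (\<lambda>i. indicator {of_int i..<of_int i + 1} x) = 1" for x :: real
  proof -
    have "(indicator {of_int i..<of_int i + 1} x :: ennreal) = indicator {\<lfloor>x\<rfloor>} i" for i :: int
      by (auto simp: indicator_def intro: floor_unique[symmetric])
    thus ?thesis by simp
  qed
  have "(\<integral>\<^sup>+x. f x \<partial>lborel) = (\<integral>\<^sup>+x. sum_int (\<lambda>i. f x * indicator {of_int i..<of_int i + 1} x) \<partial>lborel)"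
    by (simp add: nn_integral_cmult one)
  also have "\<dots> = sum_int (\<lambda>i. \<integral>\<^sup>+x. f x * indicator {of_int i..<of_int i + 1} x \<partial>lborel)"
    by (rule nn_integral_sum_int_swap) (auto intro: lborel.sigma_finite_measure_axioms)
  also have "\<dots> = sum_int (\<lambda>i. \<integral>\<^sup>+x. f (x + of_int i) * indicator {0..<1::real} x \<partial>lborel)"
  proof (rule nn_integral_cong)
    fix i :: int
    have "(\<integral>\<^sup>+x. f x * indicator {of_int i..<of_int i + 1} x \<partial>lborel)
      = ennreal \<bar>1\<bar> * (\<integral>\<^sup>+x. f (of_int i + 1 * x) * indicator {of_int i..<of_int i + 1} (of_int i + 1 * x) \<partial>lborel)"
      by (rule nn_integral_real_affine) auto
    also have "\<dots> = (\<integral>\<^sup>+x. f (x + of_int i) * indicator {0..<1::real} x \<partial>lborel)"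
      by (auto intro!: nn_integral_cong simp: indicator_def add.commute)
    finally show "(\<integral>\<^sup>+x. f x * indicator {of_int i..<of_int i + 1} x \<partial>lborel)
      = (\<integral>\<^sup>+x. f (x + of_int i) * indicator {0..<1::real} x \<partial>lborel)" .
  qed
  finally show ?thesis .
qed

text \<open>The density of a centred normal law wrapped onto the circle of length 1, a Jacobi theta
  function. Values in \<open>ennreal\<close> allow sums and integrals to be exchanged before any
  convergence is established.\<close>

definition theta :: "real \<Rightarrow> real \<Rightarrow> ennreal" where
  "theta s x = sum_int (\<lambda>i. ennreal (normal_density 0 s (x + of_int i)))"

lemma borel_measurable_sum_int [measurable (raw)]:
  assumes "\<And>i. f i \<in> borel_measurable M"
  shows "(\<lambda>x. sum_int (\<lambda>i. f i x)) \<in> borel_measurable M"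
proof -
  interpret C: sigma_finite_measure "count_space (UNIV :: int set)" by (rule sigma_finite_count_int)
  have "(\<lambda>(i, x). f i x) \<in> borel_measurable (count_space UNIV \<Otimes>\<^sub>M M)"
    using assms by (auto intro!: measurable_pair_measure_countable1)
  from measurable_pair_swap[OF this]
  have "(\<lambda>(x, i). f i x) \<in> borel_measurable (M \<Otimes>\<^sub>M count_space UNIV)"
    by (simp add: split_beta')
  thus ?thesis by (rule C.borel_measurable_nn_integral)
qed

lemma borel_measurable_theta [measurable]: "theta s \<in> borel_measurable borel"
  unfolding theta_def by measurable

lemma theta_periodic: "theta s (x + of_int k) = theta s x"
  using sum_int_shift[of "\<lambda>i. ennreal (normal_density 0 s (x + of_int i))" k]
  unfolding theta_def by (simp add: add_ac)

lemma theta_minus: "sum_int (\<lambda>i. ennreal (normal_density 0 s (x - of_int i))) = theta s x"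
  using sum_int_reflect[of "\<lambda>i. ennreal (normal_density 0 s (x + of_int i))"]
  unfolding theta_def by simp

text \<open>Cut the line into unit cells; g is the same on each of them, and the shifted densities
  add up to \<open>theta\<close>.\<close>

lemma nn_integral_theta_unfold:
  assumes [measurable]: "g \<in> borel_measurable borel" and per: "\<And>x i. g (x + of_int i) = g x" and "s > 0"
  shows "(\<integral>\<^sup>+y. ennreal (normal_density 0 s (x - y)) * g y \<partial>lborel)
    = (\<integral>\<^sup>+y. theta s (x - y) * g y * indicator {0..<1} y \<partial>lborel)"
proof -
  have "(\<integral>\<^sup>+y. ennreal (normal_density 0 s (x - y)) * g y \<partial>lborel)
    = sum_int (\<lambda>i. \<integral>\<^sup>+y. ennreal (normal_density 0 s (x - y - of_int i)) * g y * indicator {0..<1} y \<partial>lborel)"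
    by (subst nn_integral_unfold_circle) (auto simp: per diff_diff_eq)
  also have "\<dots> = (\<integral>\<^sup>+y. sum_int (\<lambda>i. ennreal (normal_density 0 s (x - y - of_int i)) * g y * indicator {0..<1} y) \<partial>lborel)"
    by (rule nn_integral_sum_int_swap[symmetric]) (auto intro: lborel.sigma_finite_measure_axioms)
  also have "\<dots> = (\<integral>\<^sup>+y. theta s (x - y) * g y * indicator {0..<1} y \<partial>lborel)"
    by (simp add: nn_integral_multc theta_minus)
  finally show ?thesis .
qed

lemma nn_integral_normal_density_minus:
  assumes "s > 0" shows "(\<integral>\<^sup>+y. ennreal (normal_density 0 s (x - y)) \<partial>lborel) = 1"
proof -
  have "(\<integral>\<^sup>+y. ennreal (normal_density 0 s y) \<partial>lborel) = ennreal \<bar>-1\<bar> * (\<integral>\<^sup>+y. ennreal (normal_density 0 s (x + (-1) * y)) \<partial>lborel)"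
    by (rule nn_integral_real_affine) auto
  thus ?thesis using nn_integral_normal_density[OF assms] by simp
qed

lemma nn_integral_theta_minus:
  assumes "s > 0" shows "(\<integral>\<^sup>+y. theta s (x - y) * indicator {0..<1} y \<partial>lborel) = 1"
  using nn_integral_theta_unfold[of "\<lambda>_. 1" s x] nn_integral_normal_density_minus[OF assms] assms by simp

lemma normal_density_0_uminus: "normal_density 0 s (- x) = normal_density 0 s x"
  by (simp add: normal_density_def)

lemma theta_uminus: "theta s (- x) = theta s x"
proof -
  have "theta s (- x) = sum_int (\<lambda>i. ennreal (normal_density 0 s (- (x - of_int i))))"
    by (simp add: theta_def algebra_simps)
  thus ?thesis unfolding normal_density_0_uminus by (simp add: theta_minus)
qed

lemma nn_integral_theta:
  assumes "s > 0" shows "(\<integral>\<^sup>+y. theta s y * indicator {0..<1} y \<partial>lborel) = 1"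
  using nn_integral_theta_minus[OF assms, of 0] by (simp add: theta_uminus)

text \<open>Wrapping commutes with convolution: the integral over one period unfolds to the line
  because \<open>theta t\<close> is periodic, and for each summand of \<open>theta t\<close> the
  variances of the two normal densities add.\<close>

lemma theta_convolution:
  assumes s: "s > 0" and t: "t > 0"
  shows "theta (sqrt (s\<^sup>2 + t\<^sup>2)) x = (\<integral>\<^sup>+y. theta s (x - y) * theta t y * indicator {0..<1} y \<partial>lborel)"
proof -
  have conv: "(\<integral>\<^sup>+y. ennreal (normal_density 0 s (z - y)) * ennreal (normal_density 0 t y) \<partial>lborel)
     = ennreal (normal_density 0 (sqrt (s\<^sup>2 + t\<^sup>2)) z)" for z
    using fun_cong[OF conv_normal_density_zero_mean[OF s t], of z] by (simp add: ennreal_mult)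
  have "(\<integral>\<^sup>+y. theta s (x - y) * theta t y * indicator {0..<1} y \<partial>lborel)
    = (\<integral>\<^sup>+y. ennreal (normal_density 0 s (x - y)) * theta t y \<partial>lborel)"
    using s by (intro nn_integral_theta_unfold[symmetric]) (auto simp: theta_periodic)
  also have "\<dots> = (\<integral>\<^sup>+y. sum_int (\<lambda>i. ennreal (normal_density 0 s (x - y)) * ennreal (normal_density 0 t (y + of_int i))) \<partial>lborel)"
    by (simp add: theta_def nn_integral_cmult)
  also have "\<dots> = sum_int (\<lambda>i. \<integral>\<^sup>+y. ennreal (normal_density 0 s (x - y)) * ennreal (normal_density 0 t (y + of_int i)) \<partial>lborel)"
    by (rule nn_integral_sum_int_swap) (auto intro: lborel.sigma_finite_measure_axioms)
  also have "\<dots> = sum_int (\<lambda>i. ennreal (normal_density 0 (sqrt (s\<^sup>2 + t\<^sup>2)) (x + of_int i)))"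
  proof (rule nn_integral_cong)
    fix i :: int
    have "(\<integral>\<^sup>+y. ennreal (normal_density 0 s (x - y)) * ennreal (normal_density 0 t (y + of_int i)) \<partial>lborel)
      = ennreal \<bar>1\<bar> * (\<integral>\<^sup>+y. ennreal (normal_density 0 s (x - (- of_int i + 1 * y))) * ennreal (normal_density 0 t (- of_int i + 1 * y + of_int i)) \<partial>lborel)"
      by (rule nn_integral_real_affine) auto
    also have "\<dots> = (\<integral>\<^sup>+y. ennreal (normal_density 0 s ((x + of_int i) - y)) * ennreal (normal_density 0 t y) \<partial>lborel)"
      by (simp add: algebra_simps)
    finally show "(\<integral>\<^sup>+y. ennreal (normal_density 0 s (x - y)) * ennreal (normal_density 0 t (y + of_int i)) \<partial>lborel)
      = ennreal (normal_density 0 (sqrt (s\<^sup>2 + t\<^sup>2)) (x + of_int i))" by (simp add: conv)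
  qed
  finally show ?thesis by (simp add: theta_def)
qed

lemma normal_density_antimono_abs:
  assumes "\<bar>x\<bar> \<le> \<bar>y\<bar>" shows "normal_density 0 s y \<le> normal_density 0 s x"
proof -
  have "x\<^sup>2 \<le> y\<^sup>2" using assms by (simp add: abs_le_square_iff)
  thus ?thesis unfolding normal_density_def
    by (intro mult_left_mono) (auto intro!: divide_right_mono)
qed

text \<open>
  On either side of its mode the density is monotone, so the sum and the integral interlace up to
  the terms next to the mode.
\<close>

lemma theta_bounds_unit:
  assumes s: "s > 0" and x: "0 \<le> x" "x < 1"
  shows "theta s x \<le> 1 + ennreal (2 * normal_density 0 s 0)" "1 \<le> theta s x + ennreal (2 * normal_density 0 s 0)"
proof -
  define \<phi> where "\<phi> y = normal_density 0 s y" for y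
  have [measurable]: "\<phi> \<in> borel_measurable borel" unfolding \<phi>_def by measurable
  have nn: "\<phi> y \<ge> 0" for y by (simp add: \<phi>_def)
  have mono: "\<phi> y \<le> \<phi> z" if "\<bar>z\<bar> \<le> \<bar>y\<bar>" for y z
    unfolding \<phi>_def by (rule normal_density_antimono_abs[OF that])
  define J where "J i = (\<integral>\<^sup>+w. ennreal (\<phi> (x + (w + of_int i))) * indicator {0..<1::real} w \<partial>lborel)" for i :: int
  have "1 = (\<integral>\<^sup>+y. ennreal (\<phi> (x - y)) \<partial>lborel)" unfolding \<phi>_def using nn_integral_normal_density_minus[OF s] by simp
  also have "\<dots> = ennreal \<bar>-1\<bar> * (\<integral>\<^sup>+y. ennreal (\<phi> (x - (0 + (-1) * y))) \<partial>lborel)"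
    by (rule nn_integral_real_affine) auto
  also have "\<dots> = (\<integral>\<^sup>+y. ennreal (\<phi> (x + y)) \<partial>lborel)" by simp
  also have "\<dots> = sum_int J" unfolding J_def by (rule nn_integral_unfold_circle) measurable
  finally have J1: "sum_int J = 1" by simp
  have Jle: "J i \<le> ennreal c" if "\<And>w. 0 \<le> w \<Longrightarrow> w < 1 \<Longrightarrow> \<phi> (x + (w + of_int i)) \<le> c" for i c
  proof -
    have "J i \<le> (\<integral>\<^sup>+w. ennreal c * indicator {0..<1::real} w \<partial>lborel)"
      unfolding J_def by (intro nn_integral_mono) (auto simp: indicator_def intro!: ennreal_leI that)
    thus ?thesis by (simp add: nn_integral_cmult_indicator)
  qed
  have Jge: "ennreal c \<le> J i" if "\<And>w. 0 \<le> w \<Longrightarrow> w < 1 \<Longrightarrow> c \<le> \<phi> (x + (w + of_int i))" for i c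
  proof -
    have "(\<integral>\<^sup>+w. ennreal c * indicator {0..<1::real} w \<partial>lborel) \<le> J i"
      unfolding J_def by (intro nn_integral_mono) (auto simp: indicator_def intro!: ennreal_leI that)
    thus ?thesis by (simp add: nn_integral_cmult_indicator)
  qed
  have split_add: "sum_int (\<lambda>i. f i + g i) = sum_int f + sum_int g" for f g :: "int \<Rightarrow> ennreal"
    by (rule nn_integral_add) auto
  have rtheta: "theta s x = sum_int (\<lambda>i. ennreal (\<phi> (x + of_int i)))" by (simp add: theta_def \<phi>_def)
  have single: "sum_int (\<lambda>i. if i = k then c else 0) = c" for k c
  proof -
    have "sum_int (\<lambda>i. if i = k then c else 0) = sum_int (\<lambda>i. c * indicator {k} i)"
      by (intro nn_integral_cong) auto
    thus ?thesis by simp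
  qed
  let ?p = "\<lambda>i. ennreal (\<phi> (x + of_int i))"
  show "1 \<le> theta s x + ennreal (2 * normal_density 0 s 0)"
  proof -
    \<comment> \<open>As 0 \<le> x < 1, the closed cell [x - 1, x] of index -1 contains the mode and
      is bounded by the value there; every other cell is bounded by the density at its endpoint
      nearer to 0.\<close>
    have "sum_int J \<le> sum_int (\<lambda>i. ((if i \<ge> 0 then ?p i else 0) + (if i + 1 < 0 then ?p (i + 1) else 0)) + (if i = -1 then ennreal (\<phi> 0) else 0))"
    proof (rule nn_integral_mono)
      fix i :: int
      consider "i \<ge> 0" | "i = -1" | "i + 1 < 0" by linarith
      thus "J i \<le> ((if i \<ge> 0 then ?p i else 0) + (if i + 1 < 0 then ?p (i + 1) else 0)) + (if i = -1 then ennreal (\<phi> 0) else 0)"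
      proof cases
        case 1
        hence "J i \<le> ?p i" using x by (intro Jle mono) auto
        thus ?thesis using 1 by simp
      next
        case 2
        have "J i \<le> ennreal (\<phi> 0)" by (intro Jle mono) auto
        thus ?thesis using 2 by simp
      next
        case 3
        have "of_int (i + 2) \<le> (0::real)" using 3 by (subst of_int_le_0_iff) linarith
        hence "J i \<le> ?p (i + 1)" using x by (intro Jle mono) auto
        thus ?thesis using 3 by simp
      qed
    qed
    also have "\<dots> = sum_int (\<lambda>i. if i \<ge> 0 then ?p i else 0) + sum_int (\<lambda>i. if i < 0 then ?p i else 0) + ennreal (\<phi> 0)"
      unfolding split_add single sum_int_shift[of "\<lambda>i. if i < 0 then ?p i else 0" 1] ..
    also have "\<dots> = theta s x + ennreal (\<phi> 0)"
      unfolding split_add[symmetric] rtheta by (intro arg_cong2[where f = "(+)"] nn_integral_cong) auto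
    also have "\<dots> \<le> theta s x + ennreal (2 * \<phi> 0)" using nn[of 0] by (intro add_left_mono ennreal_leI) auto
    finally show ?thesis by (simp add: J1 \<phi>_def)
  qed
  show "theta s x \<le> 1 + ennreal (2 * normal_density 0 s 0)"
  proof -
    \<comment> \<open>Conversely each lattice value is at most the integral over the adjacent cell
      on the side of the mode. The exceptions are x and x - 1, the two points around the mode, which
      account for the factor 2 in the claim.\<close>
    have "theta s x \<le> sum_int (\<lambda>i. ((if i - 1 \<ge> 0 then J (i - 1) else 0) + (if i < -1 then J i else 0)) + ((if i = 0 then ennreal (\<phi> 0) else 0) + (if i = -1 then ennreal (\<phi> 0) else 0)))"
      unfolding rtheta
    proof (rule nn_integral_mono)
      fix i :: int
      consider "i \<ge> 1" | "i = 0" | "i = -1" | "i < -1" by linarith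
      thus "?p i \<le> ((if i - 1 \<ge> 0 then J (i - 1) else 0) + (if i < -1 then J i else 0)) + ((if i = 0 then ennreal (\<phi> 0) else 0) + (if i = -1 then ennreal (\<phi> 0) else 0))"
      proof cases
        case 1
        hence "?p i \<le> J (i - 1)" using x by (intro Jge mono) auto
        thus ?thesis using 1 by simp
      next
        case 4
        have "of_int (i + 2) \<le> (0::real)" using 4 by (subst of_int_le_0_iff) linarith
        hence "?p i \<le> J i" using x by (intro Jge mono) auto
        thus ?thesis using 4 by simp
      qed (auto intro!: ennreal_leI mono)
    qed
    also have "\<dots> = sum_int (\<lambda>i. if i \<ge> 0 then J i else 0) + sum_int (\<lambda>i. if i < -1 then J i else 0) + (ennreal (\<phi> 0) + ennreal (\<phi> 0))"
      unfolding split_add single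
      using sum_int_shift[of "\<lambda>i. if i \<ge> 0 then J i else 0" "-1"] by (simp only: diff_conv_add_uminus)
    also have "\<dots> \<le> sum_int J + (ennreal (\<phi> 0) + ennreal (\<phi> 0))"
      unfolding split_add[symmetric] by (intro add_right_mono nn_integral_mono) auto
    also have "\<dots> = 1 + ennreal (2 * \<phi> 0)"
      unfolding J1 using nn[of 0] by (simp flip: ennreal_plus)
    finally show ?thesis by (simp add: \<phi>_def)
  qed
qed

lemma theta_bounds:
  assumes s: "s > 0"
  shows "theta s x \<le> 1 + ennreal (1 / s)" "1 \<le> theta s x + ennreal (1 / s)"
proof -
  have eq: "theta s x = theta s (frac x)"
    using theta_periodic[of s "frac x" "\<lfloor>x\<rfloor>"] by (simp add: frac_def)
  \<comment> \<open>The value at the mode is 1/(sqrt(2 pi) s), so twice that value is at most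
    1/s.\<close>
  have "2 \<le> sqrt (2 * pi)" using pi_ge_two by (intro real_le_rsqrt) auto
  hence "2 * normal_density 0 s 0 \<le> 1 / s"
    using s by (simp add: normal_density_def real_sqrt_mult field_simps)
  hence "ennreal (2 * normal_density 0 s 0) \<le> ennreal (1 / s)" by (rule ennreal_leI)
  with theta_bounds_unit[OF s frac_ge_0[of x] frac_lt_1[of x]]
  show "theta s x \<le> 1 + ennreal (1 / s)" "1 \<le> theta s x + ennreal (1 / s)"
    unfolding eq by (meson add_left_mono order_trans)+
qed

section \<open>Exponential convergence of the wrapped density to 1\<close>

definition rtheta :: "real \<Rightarrow> real \<Rightarrow> real" where "rtheta s x = enn2real (theta s x)"

lemma theta_eq_rtheta: "s > 0 \<Longrightarrow> theta s x = ennreal (rtheta s x)"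
  using theta_bounds(1)[of s x] unfolding rtheta_def
  by (intro ennreal_enn2real[symmetric]) (auto intro!: le_less_trans[OF _ ennreal_less_top[of "1 + 1/s"]])

lemma rtheta_nonneg: "rtheta s x \<ge> 0" by (simp add: rtheta_def)

lemma borel_measurable_rtheta [measurable]: "rtheta s \<in> borel_measurable borel"
  unfolding rtheta_def by measurable

lemma rtheta_bound:
  assumes s: "s > 0" shows "\<bar>rtheta s x - 1\<bar> \<le> 1 / s"
proof -
  have "ennreal (rtheta s x) \<le> ennreal (1 + 1 / s)" "ennreal 1 \<le> ennreal (rtheta s x + 1 / s)"
    using theta_bounds[OF s, of x] s rtheta_nonneg[of s x] by (simp_all add: theta_eq_rtheta)
  moreover have "0 \<le> 1 + 1 / s" "0 \<le> rtheta s x + 1 / s" using s rtheta_nonneg[of s x] by simp_all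
  ultimately have "rtheta s x \<le> 1 + 1 / s" "1 \<le> rtheta s x + 1 / s" by (simp_all only: ennreal_le_iff)
  thus ?thesis by (simp add: abs_le_iff)
qed

text \<open>
  Both periodisations have mean \<open>1\<close>, so subtracting \<open>1\<close> commutes with convolution on the circle
  and deviations from \<open>1\<close> multiply.
\<close>

lemma rtheta_convolution_bound:
  assumes s: "s > 0" and t: "t > 0" and a: "\<And>y. \<bar>rtheta s y - 1\<bar> \<le> a" and b: "\<And>y. \<bar>rtheta t y - 1\<bar> \<le> b"
  shows "\<bar>rtheta (sqrt (s\<^sup>2 + t\<^sup>2)) x - 1\<bar> \<le> a * b"
proof -
  let ?M = "restrict_space lborel {0..<1::real}"
  have fin: "finite_measure ?M" by (rule finite_measureI) (simp add: emeasure_restrict_space)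
  interpret finite_measure ?M by fact
  have a0: "a \<ge> 0" "b \<ge> 0" using a[of 0] b[of 0] by linarith+
  have bs: "\<bar>rtheta s y\<bar> \<le> 1 + a" "\<bar>rtheta t y\<bar> \<le> 1 + b" for y using a[of y] b[of y] by linarith+
  have int[simp]: "integrable ?M f" if "f \<in> borel_measurable borel" "\<And>y. \<bar>f y\<bar> \<le> c" for f :: "real \<Rightarrow> real" and c
    using that by (intro integrable_const_bound[where B = c]) (auto intro: measurable_restrict_space1)
  have i1: "integrable ?M (\<lambda>y. rtheta s (x - y))" using bs by (intro int[where c = "1 + a"]) auto
  have i2: "integrable ?M (\<lambda>y. rtheta t y)" using bs by (intro int[where c = "1 + b"]) auto
  have i3: "integrable ?M (\<lambda>y. rtheta s (x - y) * rtheta t y)"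
    using bs a0 by (intro int[where c = "(1 + a) * (1 + b)"]) (auto simp: abs_mult intro!: mult_mono)
  have nn: "(\<integral>\<^sup>+y. f y \<partial>?M) = (\<integral>\<^sup>+y. f y * indicator {0..<1} y \<partial>lborel)" for f
    by (rule nn_integral_restrict_space) auto
  have m: "f \<in> borel_measurable ?M" if "f \<in> borel_measurable borel" for f :: "real \<Rightarrow> real"
    using that by (intro measurable_restrict_space1) auto
  have "(\<integral>y. rtheta s (x - y) \<partial>?M) = 1"
    using nn_integral_theta_minus[OF s, of x] s rtheta_nonneg
    by (subst integral_eq_nn_integral) (auto simp: nn theta_eq_rtheta intro!: m)
  moreover have "(\<integral>y. rtheta t y \<partial>?M) = 1"
    using nn_integral_theta[OF t] t rtheta_nonneg
    by (subst integral_eq_nn_integral) (auto simp: nn theta_eq_rtheta intro!: m)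
  moreover have "(\<integral>y. rtheta s (x - y) * rtheta t y \<partial>?M) = rtheta (sqrt (s\<^sup>2 + t\<^sup>2)) x"
    using theta_convolution[OF s t, of x] s t rtheta_nonneg
    by (subst integral_eq_nn_integral) (auto simp: nn theta_eq_rtheta ennreal_mult rtheta_def[of "sqrt _"] intro!: m)
  moreover have m1: "measure ?M (space ?M) = 1" by (simp add: measure_restrict_space space_restrict_space)
  ultimately have "rtheta (sqrt (s\<^sup>2 + t\<^sup>2)) x - 1 = (\<integral>y. rtheta s (x - y) * rtheta t y - rtheta s (x - y) - rtheta t y + 1 \<partial>?M)"
    using i1 i2 i3 by simp
  also have "\<dots> = (\<integral>y. (rtheta s (x - y) - 1) * (rtheta t y - 1) \<partial>?M)"
    by (intro Bochner_Integration.integral_cong) (auto simp: algebra_simps)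
  also have "\<bar>\<dots>\<bar> \<le> (\<integral>y. \<bar>(rtheta s (x - y) - 1) * (rtheta t y - 1)\<bar> \<partial>?M)" by (rule integral_abs_bound)
  also have "\<dots> \<le> (\<integral>y. a * b \<partial>?M)"
  proof (rule integral_mono)
    have "\<bar>(rtheta s (x - y) - 1) * (rtheta t y - 1)\<bar> \<le> a * b" for y
      using a[of "x - y"] b[of y] a0 by (auto simp: abs_mult intro!: mult_mono)
    thus "integrable ?M (\<lambda>y. \<bar>(rtheta s (x - y) - 1) * (rtheta t y - 1)\<bar>)"
      by (intro int[where c = "a * b"]) auto
    show "\<bar>(rtheta s (x - y) - 1) * (rtheta t y - 1)\<bar> \<le> a * b" for y by fact
  qed auto
  also have "\<dots> = a * b" using m1 by simp
  finally show ?thesis .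
qed

lemma rtheta_power_bound:
  assumes s: "s > 0" and a: "\<And>y. \<bar>rtheta s y - 1\<bar> \<le> a" and n: "n \<ge> 1"
  shows "\<bar>rtheta (sqrt (real n) * s) x - 1\<bar> \<le> a ^ n"
  using n
proof (induction n arbitrary: x rule: nat_induct_at_least)
  case base
  show ?case using a[of x] by simp
next
  case (Suc n)
  have "sqrt (real (Suc n)) * s = sqrt ((sqrt (real n) * s)\<^sup>2 + s\<^sup>2)"
    using s by (simp add: power_mult_distrib real_sqrt_mult distrib_right[symmetric] add.commute[of 1] flip: mult_Suc)
      (metis abs_of_pos add.commute distrib_right mult_1 real_sqrt_abs real_sqrt_mult)
  thus ?case
    using rtheta_convolution_bound[of "sqrt (real n) * s" s "a ^ n" a x] Suc a s by (simp add: mult.commute)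
qed

text \<open>Write s = sqrt n * r with n the integer part of s^2/16. Then r \<ge> 4 > e, so the crude
  bound 1/r is at most exp(-1) and the n-fold convolution deviates by at most exp(-n). Since n \<ge>
  1, one has 2n \<ge> n + 1 > s^2/16, hence n > s^2/32.\<close>

lemma rtheta_exp_bound:
  assumes s: "s \<ge> 4" shows "\<bar>rtheta s x - 1\<bar> \<le> exp (- (s\<^sup>2 / 32))"
proof -
  define n where "n = nat \<lfloor>s\<^sup>2 / 16\<rfloor>"
  have s2: "s\<^sup>2 \<ge> 16" using power_mono[of 4 s 2] s by simp
  hence n1: "n \<ge> 1" and n2: "real n \<le> s\<^sup>2 / 16" and n3: "s\<^sup>2 / 16 < real n + 1"
    unfolding n_def by linarith+
  define r where "r = s / sqrt (real n)"
  have r: "r \<ge> 4"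
  proof -
    have "sqrt (real n) \<le> sqrt ((s / 4)\<^sup>2)" using n2 by (intro real_sqrt_le_mono) (simp add: power_divide)
    hence "sqrt (real n) \<le> s / 4" using s by simp
    thus ?thesis unfolding r_def using n1 by (simp add: field_simps)
  qed
  have "\<bar>rtheta r y - 1\<bar> \<le> exp (-1)" for y
  proof -
    have "\<bar>rtheta r y - 1\<bar> \<le> 1 / r" using r by (intro rtheta_bound) auto
    also have "\<dots> \<le> 1 / exp 1" using r exp_le by (intro divide_left_mono) auto
    finally show ?thesis by (simp add: exp_minus inverse_eq_divide)
  qed
  hence "\<bar>rtheta (sqrt (real n) * r) x - 1\<bar> \<le> exp (-1) ^ n"
    using r n1 by (intro rtheta_power_bound) auto
  also have "sqrt (real n) * r = s" unfolding r_def using n1 by simp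
  also have "exp (-1) ^ n = exp (- real n)" by (simp flip: exp_of_nat_mult)
  also have "\<dots> \<le> exp (- (s\<^sup>2 / 32))" using n1 n3 by simp
  finally show ?thesis .
qed

section \<open>The standard Gaussian measure in dimension d\<close>

abbreviation Ld :: "nat \<Rightarrow> (nat \<Rightarrow> real) measure" where
  "Ld d \<equiv> Pi\<^sub>M {..<d} (\<lambda>_. lborel)"

abbreviation dot :: "nat \<Rightarrow> (nat \<Rightarrow> real) \<Rightarrow> (nat \<Rightarrow> real) \<Rightarrow> real" where
  "dot d v x \<equiv> (\<Sum>j<d. v j * x j)"

text \<open>The sampling map of \<open>hidden_dir\<close>: for a unit vector v it replaces the
  component of g along v by t.\<close>

definition place :: "nat \<Rightarrow> (nat \<Rightarrow> real) \<Rightarrow> real \<Rightarrow> (nat \<Rightarrow> real) \<Rightarrow> nat \<Rightarrow> real" where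
  "place d v t g = (\<lambda>i\<in>{..<d}. t * v i + (g i - dot d v g * v i))"

lemma sets_Ld [measurable_cong]: "sets (Ld d) = sets (Rd d)"
  by (intro sets_PiM_cong) auto

lemma space_Rd: "space (Rd d) = {..<d} \<rightarrow>\<^sub>E UNIV"
  by (simp add: space_PiM)

lemma space_Ld [simp]: "space (Ld d) = space (Rd d)"
  by (simp add: space_PiM)

lemma sets_std_gaussian [simp, measurable_cong]: "sets (std_gaussian d) = sets (Rd d)"
  unfolding std_gaussian_def by (intro sets_PiM_cong) auto

lemma space_std_gaussian [simp]: "space (std_gaussian d) = space (Rd d)"
  by (simp add: std_gaussian_def space_PiM)

lemma prob_space_std_gaussian: "prob_space (std_gaussian d)"
  unfolding std_gaussian_def by (intro prob_space_PiM prob_space_normal_law) auto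

lemma sigma_finite_Ld: "sigma_finite_measure (Ld d)"
proof -
  interpret product_sigma_finite "\<lambda>_::nat. lborel :: real measure" ..
  show ?thesis by (rule sigma_finite) auto
qed

lemma measurable_place [measurable (raw)]:
  assumes [measurable]: "v \<in> M \<rightarrow>\<^sub>M Rd d" "t \<in> borel_measurable M" "g \<in> M \<rightarrow>\<^sub>M Rd d"
  shows "(\<lambda>x. place d (v x) (t x) (g x)) \<in> M \<rightarrow>\<^sub>M Rd d"
  unfolding place_def by measurable

lemma place_in_space [simp, intro]: "place d v t g \<in> space (Rd d)"
  by (auto simp: place_def space_Rd)

lemma place_apply: "i < d \<Longrightarrow> place d v t g i = t * v i + (g i - dot d v g * v i)"
  by (simp add: place_def)

text \<open>Both sides define measures that agree on boxes, one coordinate at a time. The case r = 1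
  provides the translations along v, the case c = 0 the scaling of balls.\<close>

lemma nn_integral_Ld_affine:
  assumes r: "r > 0" and [measurable]: "f \<in> borel_measurable (Rd d)"
  shows "(\<integral>\<^sup>+x. f x \<partial>Ld d) = ennreal (r ^ d) * (\<integral>\<^sup>+x. f (\<lambda>i\<in>{..<d}. c i + r * x i) \<partial>Ld d)"
proof -
  interpret product_sigma_finite "\<lambda>_::nat. lborel :: real measure" ..
  let ?T = "\<lambda>x. \<lambda>i\<in>{..<d}. c i + r * x i"
  define P where "P = scale_measure (ennreal (r ^ d)) (distr (Ld d) (Ld d) ?T)"
  have [measurable]: "?T \<in> Ld d \<rightarrow>\<^sub>M Ld d" by measurable
  have "P = Ld d"
  proof (rule PiM_eqI)
    fix A :: "nat \<Rightarrow> real set" assume A: "\<And>i. i \<in> {..<d} \<Longrightarrow> A i \<in> sets lborel"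
    let ?B = "\<lambda>i. (\<lambda>x. c i + r * x) -` A i \<inter> space lborel"
    have B: "?B i \<in> sets lborel" if "i < d" for i
      using A[of i] that by (intro measurable_sets[of _ lborel lborel]) auto
    have "emeasure P (Pi\<^sub>E {..<d} A) = ennreal (r ^ d) * emeasure (Ld d) (?T -` Pi\<^sub>E {..<d} A \<inter> space (Ld d))"
      using A unfolding P_def by (simp add: emeasure_distr)
    also have "?T -` Pi\<^sub>E {..<d} A \<inter> space (Ld d) = Pi\<^sub>E {..<d} ?B"
      by (auto simp: space_Rd PiE_iff extensional_def)
    also have "emeasure (Ld d) \<dots> = (\<Prod>i<d. emeasure lborel (?B i))"
      using B by (intro emeasure_PiM) auto
    also have "ennreal (r ^ d) * \<dots> = (\<Prod>i<d. ennreal r * emeasure lborel (?B i))"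
      using r by (simp add: prod.distrib ennreal_power)
    also have "\<dots> = (\<Prod>i<d. emeasure lborel (A i))"
    proof (intro prod.cong refl)
      fix i assume "i \<in> {..<d}"
      hence [measurable]: "A i \<in> sets lborel" using A by auto
      have "emeasure lborel (A i) = (\<integral>\<^sup>+x. indicator (A i) x \<partial>lborel)"
        using A[of i] \<open>i \<in> {..<d}\<close> by (subst nn_integral_indicator) auto
      also have "\<dots> = \<bar>r\<bar> * (\<integral>\<^sup>+x. indicator (A i) (c i + r * x) \<partial>lborel)"
        using r by (intro nn_integral_real_affine) auto
      also have "(\<integral>\<^sup>+x. indicator (A i) (c i + r * x) \<partial>lborel) = (\<integral>\<^sup>+x. indicator (?B i) x \<partial>lborel)"
        by (intro nn_integral_cong) (auto simp: indicator_def)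
      also have "\<dots> = emeasure lborel (?B i)"
        using \<open>i \<in> {..<d}\<close> B by (subst nn_integral_indicator) auto
      finally show "ennreal r * emeasure lborel (?B i) = emeasure lborel (A i)" using r by simp
    qed
    finally show "emeasure P (Pi\<^sub>E {..<d} A) = (\<Prod>i<d. emeasure lborel (A i))" .
  qed (auto simp: P_def)
  hence "(\<integral>\<^sup>+x. f x \<partial>Ld d) = (\<integral>\<^sup>+x. f x \<partial>P)" by simp
  also have "\<dots> = ennreal (r ^ d) * (\<integral>\<^sup>+x. f (?T x) \<partial>Ld d)"
    unfolding P_def by (subst nn_integral_scale_measure) (auto simp: nn_integral_distr)
  finally show ?thesis .
qed

lemma nn_integral_Ld_translate:
  assumes [measurable]: "f \<in> borel_measurable (Rd d)"
  shows "(\<integral>\<^sup>+x. f (\<lambda>i\<in>{..<d}. x i + c i) \<partial>Ld d) = (\<integral>\<^sup>+x. f x \<partial>Ld d)"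
  using nn_integral_Ld_affine[of 1 f d c] by (simp add: add.commute)

definition gauss_dens :: "nat \<Rightarrow> (nat \<Rightarrow> real) \<Rightarrow> real" where
  "gauss_dens d x = exp (- (\<Sum>i<d. (x i)\<^sup>2) / 2) / sqrt (2 * pi) ^ d"

lemma gauss_dens_pos: "gauss_dens d x > 0" "gauss_dens d x \<ge> 0"
  unfolding gauss_dens_def by auto

lemma gauss_dens_measurable [measurable]: "gauss_dens d \<in> borel_measurable (Rd d)"
  unfolding gauss_dens_def by measurable

lemma std_gaussian_eq_density: "std_gaussian d = density (Ld d) (\<lambda>x. ennreal (gauss_dens d x))"
proof -
  interpret product_sigma_finite "\<lambda>_::nat. lborel :: real measure" ..
  interpret N: product_prob_space "\<lambda>_::nat. normal_law 0 1"
    by (intro product_prob_spaceI prob_space_normal_law) auto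
  let ?D = "density (Ld d) (\<lambda>x. ennreal (gauss_dens d x))"
  have "?D = Pi\<^sub>M {..<d} (\<lambda>_. normal_law 0 1)"
  proof (rule N.PiM_eqI)
    fix A :: "nat \<Rightarrow> real set" assume A: "\<And>i. i \<in> {..<d} \<Longrightarrow> A i \<in> sets (normal_law 0 1)"
    hence [measurable]: "i \<in> {..<d} \<Longrightarrow> A i \<in> sets borel" for i by auto
    have dens: "ennreal (gauss_dens d x) = (\<Prod>i<d. ennreal (std_normal_density (x i)))" for x
    proof -
      have "gauss_dens d x = (\<Prod>i<d. std_normal_density (x i))"
        unfolding gauss_dens_def std_normal_density_def prod.distrib exp_sum[OF finite_lessThan, symmetric]
        by (simp only: sum_divide_distrib[symmetric] sum_negf prod_constant card_lessThan power_one_over times_divide_eq_left mult_1)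
      thus ?thesis by (simp add: prod_ennreal)
    qed
    have ind: "indicator (Pi\<^sub>E {..<d} A) x = (\<Prod>i<d. indicator (A i) (x i) :: ennreal)" if "x \<in> space (Ld d)" for x
      using that by (auto simp: indicator_def space_Rd PiE_iff)
    have "emeasure ?D (Pi\<^sub>E {..<d} A) = (\<integral>\<^sup>+x. (\<Prod>i<d. ennreal (std_normal_density (x i)) * indicator (A i) (x i)) \<partial>Ld d)"
      by (subst emeasure_density) (auto simp: dens ind prod.distrib intro!: nn_integral_cong sets_PiM_I_finite)
    also have "\<dots> = (\<Prod>i<d. \<integral>\<^sup>+x. ennreal (std_normal_density x) * indicator (A i) x \<partial>lborel)"
      by (intro product_nn_integral_prod) auto
    also have "\<dots> = (\<Prod>i<d. emeasure (normal_law 0 1) (A i))"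
      by (intro prod.cong refl) (simp add: normal_law_def emeasure_density)
    finally show "emeasure ?D (Pi\<^sub>E {..<d} A) = (\<Prod>i<d. emeasure (normal_law 0 1) (A i))" .
  qed (auto simp: sets_std_gaussian[unfolded std_gaussian_def] sets_Ld)
  thus ?thesis by (simp add: std_gaussian_def)
qed

lemma nn_integral_std_gaussian:
  assumes [measurable]: "f \<in> borel_measurable (Rd d)"
  shows "(\<integral>\<^sup>+x. f x \<partial>std_gaussian d) = (\<integral>\<^sup>+x. ennreal (gauss_dens d x) * f x \<partial>Ld d)"
  unfolding std_gaussian_eq_density by (subst nn_integral_density) auto

section \<open>Splitting the standard Gaussian along a unit vector\<close>

lemma dot_place:
  assumes "dot d v v = 1" shows "dot d v (place d v u g) = u"
proof -
  have "dot d v (place d v u g) = (\<Sum>j<d. u * (v j * v j) + (v j * g j - dot d v g * (v j * v j)))"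
    by (intro sum.cong) (auto simp: place_apply algebra_simps)
  also have "\<dots> = u" using assms
    by (simp add: sum.distrib sum_subtractf flip: sum_distrib_left)
  finally show ?thesis .
qed

lemma sum_squares_place:
  assumes "dot d v v = 1"
  shows "(\<Sum>i<d. (place d v u g i)\<^sup>2) = (\<Sum>i<d. (g i)\<^sup>2) + u\<^sup>2 - (dot d v g)\<^sup>2"
proof -
  define c where "c = u - dot d v g"
  have "(\<Sum>i<d. (place d v u g i)\<^sup>2) = (\<Sum>i<d. (g i)\<^sup>2 + (2 * c * (v i * g i) + c\<^sup>2 * (v i * v i)))"
    by (intro sum.cong) (auto simp: place_apply c_def power2_eq_square algebra_simps)
  also have "\<dots> = (\<Sum>i<d. (g i)\<^sup>2) + (2 * c * dot d v g + c\<^sup>2 * 1)"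
    using assms by (simp add: sum.distrib flip: sum_distrib_left)
  also have "\<dots> = (\<Sum>i<d. (g i)\<^sup>2) + u\<^sup>2 - (dot d v g)\<^sup>2"
    by (simp add: c_def power2_eq_square algebra_simps)
  finally show ?thesis .
qed

text \<open>
  \<open>(u, g) \<mapsto> (\<langle>v, g\<rangle>, place v u g)\<close> is the reflection of \<open>\<real> \<times> \<real>\<^sup>d\<close> along \<open>(1, -v)\<close>; it is the composition
  of \<open>u \<mapsto> u - \<langle>v, g\<rangle>\<close>, \<open>g \<mapsto> g + u v\<close> and \<open>u \<mapsto> \<langle>v, g\<rangle> - u\<close>, each of which preserves Lebesgue measure.
\<close>

lemma nn_integral_gaussian_exchange:
  assumes v: "v \<in> space (Rd d)" "dot d v v = 1"
    and [measurable]: "\<Phi> \<in> borel_measurable (borel \<Otimes>\<^sub>M Rd d)"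
  shows "(\<integral>\<^sup>+u. \<integral>\<^sup>+g. \<Phi> (dot d v g, place d v u g) \<partial>std_gaussian d \<partial>normal_law 0 1)
    = (\<integral>\<^sup>+u. \<integral>\<^sup>+g. \<Phi> (u, g) \<partial>std_gaussian d \<partial>normal_law 0 1)"
proof -
  interpret L: sigma_finite_measure "Ld d" by (rule sigma_finite_Ld)
  interpret P: pair_sigma_finite lborel "Ld d" ..
  define \<Psi> where "\<Psi> = (\<lambda>(u, g). ennreal (std_normal_density u) * (ennreal (gauss_dens d g) * \<Phi> (u, g)))"
  have [measurable]: "\<Psi> \<in> borel_measurable (borel \<Otimes>\<^sub>M Rd d)" unfolding \<Psi>_def by measurable
  have [measurable]: "v \<in> space (Rd d)" by fact
  define G where "G u g = (\<lambda>i\<in>{..<d}. g i + u * v i)" for u g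
  have [measurable]: "(\<lambda>x. G (a x) (b x)) \<in> M \<rightarrow>\<^sub>M Rd d"
    if [measurable]: "a \<in> borel_measurable M" "b \<in> M \<rightarrow>\<^sub>M Rd d" for a b M
    unfolding G_def by measurable
  have int: "(\<integral>\<^sup>+u. \<integral>\<^sup>+g. F (u, g) \<partial>std_gaussian d \<partial>normal_law 0 1)
    = (\<integral>\<^sup>+u. \<integral>\<^sup>+g. ennreal (std_normal_density u) * (ennreal (gauss_dens d g) * F (u, g)) \<partial>Ld d \<partial>lborel)"
    if [measurable]: "F \<in> borel_measurable (borel \<Otimes>\<^sub>M Rd d)" for F
    by (simp add: nn_integral_normal_law nn_integral_std_gaussian nn_integral_cmult)
  have dG: "dot d v (G u g) = dot d v g + u" for u g
  proof -
    have "dot d v (G u g) = (\<Sum>j<d. v j * g j + u * (v j * v j))"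
      by (intro sum.cong) (auto simp: G_def algebra_simps)
    thus ?thesis using v by (simp add: sum.distrib flip: sum_distrib_left)
  qed
  have "(\<integral>\<^sup>+u. \<integral>\<^sup>+g. \<Phi> (dot d v g, place d v u g) \<partial>std_gaussian d \<partial>normal_law 0 1)
     = (\<integral>\<^sup>+u. \<integral>\<^sup>+g. \<Psi> (dot d v g, place d v u g) \<partial>Ld d \<partial>lborel)"
  proof -
    \<comment> \<open>A reflection preserves u^2 + |g|^2 and therefore the joint Gaussian density,
      so only the invariance of Lebesgue measure remains.\<close>
    have *: "std_normal_density u * gauss_dens d g = std_normal_density (dot d v g) * gauss_dens d (place d v u g)" for u g
      unfolding std_normal_density_def gauss_dens_def sum_squares_place[OF v(2)]
      by (simp add: exp_add[symmetric] add_divide_distrib[symmetric] diff_divide_distrib[symmetric])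
    have "ennreal (std_normal_density u) * (ennreal (gauss_dens d g) * z) =
        ennreal (std_normal_density (dot d v g)) * (ennreal (gauss_dens d (place d v u g)) * z)" for u g z
      using *[of u g] gauss_dens_pos by (simp add: mult.assoc[symmetric] ennreal_mult[symmetric])
    thus ?thesis
      using int[of "\<lambda>(u, g). \<Phi> (dot d v g, place d v u g)"] by (simp add: \<Psi>_def)
  qed
  also have "\<dots> = (\<integral>\<^sup>+g. \<integral>\<^sup>+u. \<Psi> (dot d v g, place d v u g) \<partial>lborel \<partial>Ld d)"
    by (intro P.Fubini'[symmetric]) measurable
  also have "\<dots> = (\<integral>\<^sup>+g. \<integral>\<^sup>+u. \<Psi> (dot d v g, G u g) \<partial>lborel \<partial>Ld d)"
  proof (rule nn_integral_cong)
    fix g assume [measurable]: "g \<in> space (Ld d)"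
    have *: "(\<integral>\<^sup>+u. \<Psi> (dot d v g, place d v u g) \<partial>lborel) = (\<integral>\<^sup>+u. \<Psi> (dot d v g, place d v (dot d v g + 1 * u) g) \<partial>lborel)"
      using \<open>g \<in> space (Ld d)\<close> by (subst nn_integral_real_affine[where c=1 and t="dot d v g"]) auto
    have "place d v (dot d v g + 1 * u) g = G u g" for u
      by (auto simp: place_def G_def algebra_simps fun_eq_iff)
    hence "(\<integral>\<^sup>+u. \<Psi> (dot d v g, place d v (dot d v g + 1 * u) g) \<partial>lborel) = (\<integral>\<^sup>+u. \<Psi> (dot d v g, G u g) \<partial>lborel)"
      by simp
    with * show "(\<integral>\<^sup>+u. \<Psi> (dot d v g, place d v u g) \<partial>lborel) = (\<integral>\<^sup>+u. \<Psi> (dot d v g, G u g) \<partial>lborel)"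
      by simp
  qed
  also have "\<dots> = (\<integral>\<^sup>+u. \<integral>\<^sup>+g. \<Psi> (dot d v g, G u g) \<partial>Ld d \<partial>lborel)"
    by (intro P.Fubini') measurable
  also have "\<dots> = (\<integral>\<^sup>+u. \<integral>\<^sup>+g. \<Psi> (dot d v (G u g) - u, G u g) \<partial>Ld d \<partial>lborel)"
    by (simp add: dG)
  also have "\<dots> = (\<integral>\<^sup>+u. \<integral>\<^sup>+g. \<Psi> (dot d v g - u, g) \<partial>Ld d \<partial>lborel)"
  proof (rule nn_integral_cong)
    fix u :: real
    show "(\<integral>\<^sup>+g. \<Psi> (dot d v (G u g) - u, G u g) \<partial>Ld d) = (\<integral>\<^sup>+g. \<Psi> (dot d v g - u, g) \<partial>Ld d)"
      unfolding G_def by (rule nn_integral_Ld_translate) measurable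
  qed
  also have "\<dots> = (\<integral>\<^sup>+g. \<integral>\<^sup>+u. \<Psi> (dot d v g - u, g) \<partial>lborel \<partial>Ld d)"
    by (intro P.Fubini'[symmetric]) measurable
  also have "\<dots> = (\<integral>\<^sup>+g. \<integral>\<^sup>+u. \<Psi> (u, g) \<partial>lborel \<partial>Ld d)"
  proof (rule nn_integral_cong)
    fix g assume g: "g \<in> space (Ld d)"
    show "(\<integral>\<^sup>+u. \<Psi> (dot d v g - u, g) \<partial>lborel) = (\<integral>\<^sup>+u. \<Psi> (u, g) \<partial>lborel)"
      using g by (subst (2) nn_integral_real_affine[where c="-1" and t="dot d v g"]) auto
  qed
  also have "\<dots> = (\<integral>\<^sup>+u. \<integral>\<^sup>+g. \<Psi> (u, g) \<partial>Ld d \<partial>lborel)"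
    by (intro P.Fubini') measurable
  also have "\<dots> = (\<integral>\<^sup>+u. \<integral>\<^sup>+g. \<Phi> (u, g) \<partial>std_gaussian d \<partial>normal_law 0 1)"
    using int[of \<Phi>] by (simp add: \<Psi>_def)
  finally show ?thesis .
qed

lemma emeasure_std_gaussian_space [simp]: "emeasure (std_gaussian d) (space (Rd d)) = 1"
  using prob_space.emeasure_space_1[OF prob_space_std_gaussian[of d]] by simp

lemma emeasure_normal_law_UNIV [simp]: "\<sigma> > 0 \<Longrightarrow> emeasure (normal_law \<mu> \<sigma>) UNIV = 1"
  using prob_space.emeasure_space_1[OF prob_space_normal_law[of \<sigma> \<mu>]] by simp

text \<open>The component along v is standard normal and independent of the rest: under the
  exchange, x = \<open>place d v u g\<close> with u and g independent, and the component of x along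
  v is u.\<close>

lemma nn_integral_std_gaussian_split:
  assumes v: "v \<in> space (Rd d)" "dot d v v = 1"
    and [measurable]: "f \<in> borel_measurable (Rd d)" "k \<in> borel_measurable borel"
  shows "(\<integral>\<^sup>+x. k (dot d v x) * f x \<partial>std_gaussian d)
    = (\<integral>\<^sup>+u. k u * (\<integral>\<^sup>+g. f (place d v u g) \<partial>std_gaussian d) \<partial>normal_law 0 1)"
proof -
  have [measurable]: "v \<in> space (Rd d)" by fact
  have "(\<integral>\<^sup>+x. k (dot d v x) * f x \<partial>std_gaussian d)
    = (\<integral>\<^sup>+u. \<integral>\<^sup>+g. k (dot d v g) * f g \<partial>std_gaussian d \<partial>normal_law 0 1)"
    by simp
  also have "\<dots> = (\<integral>\<^sup>+u. \<integral>\<^sup>+g. k (dot d v (place d v u g)) * f (place d v u g) \<partial>std_gaussian d \<partial>normal_law 0 1)"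
    using nn_integral_gaussian_exchange[OF v, of "\<lambda>(u, g). k (dot d v g) * f g"] by simp
  also have "\<dots> = (\<integral>\<^sup>+u. k u * (\<integral>\<^sup>+g. f (place d v u g) \<partial>std_gaussian d) \<partial>normal_law 0 1)"
    by (simp add: dot_place[OF v(2)] nn_integral_cmult)
  finally show ?thesis .
qed

text \<open>Reweighting the standard Gaussian by the kernel in direction v changes the law of the
  hidden coordinate from N(0, 1) to N(at, 1 - a^2). The weight is thus the density of the
  hidden-direction law obtained by smoothing an atom at t.\<close>

lemma nn_integral_std_gaussian_mehler:
  assumes v: "v \<in> space (Rd d)" "dot d v v = 1" and a: "a\<^sup>2 < 1"
    and [measurable]: "f \<in> borel_measurable (Rd d)"
  shows "(\<integral>\<^sup>+x. ennreal (mehler a (dot d v x) t) * f x \<partial>std_gaussian d)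
    = (\<integral>\<^sup>+u. \<integral>\<^sup>+g. f (place d v u g) \<partial>std_gaussian d \<partial>normal_law (a * t) (sqrt (1 - a\<^sup>2)))"
proof -
  have [measurable]: "v \<in> space (Rd d)" by fact
  interpret sigma_finite_measure "std_gaussian d"
    by (intro prob_space_imp_sigma_finite prob_space_std_gaussian)
  have "(\<integral>\<^sup>+x. ennreal (mehler a (dot d v x) t) * f x \<partial>std_gaussian d)
    = (\<integral>\<^sup>+u. ennreal (mehler a u t) * (\<integral>\<^sup>+g. f (place d v u g) \<partial>std_gaussian d) \<partial>normal_law 0 1)"
    by (rule nn_integral_std_gaussian_split[OF v]) measurable
  also have "\<dots> = (\<integral>\<^sup>+u. ennreal (normal_density 0 1 u) * (ennreal (mehler a u t) * (\<integral>\<^sup>+g. f (place d v u g) \<partial>std_gaussian d)) \<partial>lborel)"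
    by (rule nn_integral_normal_law) measurable
  also have "\<dots> = (\<integral>\<^sup>+u. ennreal (normal_density (a * t) (sqrt (1 - a\<^sup>2)) u) * (\<integral>\<^sup>+g. f (place d v u g) \<partial>std_gaussian d) \<partial>lborel)"
    using mehler_nonneg[OF a]
    by (intro nn_integral_cong) (simp add: mehler_std_normal[OF a, symmetric] ennreal_mult mult_ac)
  also have "\<dots> = (\<integral>\<^sup>+u. \<integral>\<^sup>+g. f (place d v u g) \<partial>std_gaussian d \<partial>normal_law (a * t) (sqrt (1 - a\<^sup>2)))"
    by (rule nn_integral_normal_law[symmetric]) measurable
  finally show ?thesis .
qed

lemma nn_integral_dot_std_gaussian:
  assumes q: "q \<in> space (Rd d)" and [measurable]: "k \<in> borel_measurable borel"
  shows "(\<integral>\<^sup>+g. k (dot d q g) \<partial>std_gaussian d) = (\<integral>\<^sup>+z. k (sqrt (dot d q q) * z) \<partial>normal_law 0 1)"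
\<comment> \<open>The degenerate case does occur: q will be the residual of w along v, which
  vanishes for w = v and w = -v.\<close>
proof (cases "dot d q q = 0")
  case True
  hence "\<forall>j\<in>{..<d}. q j * q j = 0" by (subst (asm) sum_nonneg_eq_0_iff) auto
  hence "dot d q g = 0" for g by (intro sum.neutral) auto
  thus ?thesis using True by simp
next
  case False
  have pos: "dot d q q > 0" using False by (simp add: less_le sum_nonneg)
  define c where "c = sqrt (dot d q q)"
  have c: "c > 0" "c * c = dot d q q" using pos by (auto simp: c_def)
  define v where "v = (\<lambda>i\<in>{..<d}. q i / c)"
  have v: "v \<in> space (Rd d)" by (auto simp: v_def space_Rd)
  have vd: "c * dot d v g = dot d q g" for g
    unfolding v_def sum_distrib_left using c by (intro sum.cong) auto
  have "dot d v v = (\<Sum>j<d. q j * q j) / (c * c)"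
    unfolding sum_divide_distrib by (intro sum.cong) (auto simp: v_def)
  hence v1: "dot d v v = 1" using c pos by simp
  have "(\<integral>\<^sup>+g. k (c * dot d v g) * 1 \<partial>std_gaussian d) = (\<integral>\<^sup>+z. k (c * z) * (\<integral>\<^sup>+g. 1 \<partial>std_gaussian d) \<partial>normal_law 0 1)"
    by (rule nn_integral_std_gaussian_split[OF v v1]) auto
  thus ?thesis unfolding vd by (simp add: c_def)
qed

lemma nn_integral_normal_law_affine:
  assumes s: "s > 0" "r \<noteq> 0" and [measurable]: "k \<in> borel_measurable borel"
  shows "(\<integral>\<^sup>+u. k (r * u + e) \<partial>normal_law m s) = (\<integral>\<^sup>+x. k x \<partial>normal_law (r * m + e) (\<bar>r\<bar> * s))"
proof -
  have *: "normal_density m s u = \<bar>r\<bar> * normal_density (r * m + e) (\<bar>r\<bar> * s) (e + r * u)" for u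
  proof -
    have "(e + r * u - (r * m + e))\<^sup>2 = r\<^sup>2 * (u - m)\<^sup>2" by (simp add: power2_eq_square algebra_simps)
    moreover have "(r\<^sup>2 * (u - m)\<^sup>2) / (2 * (\<bar>r\<bar> * s)\<^sup>2) = (u - m)\<^sup>2 / (2 * s\<^sup>2)"
      using s by (simp add: power_mult_distrib)
    moreover have "sqrt (2 * pi * (\<bar>r\<bar> * s)\<^sup>2) = \<bar>r\<bar> * sqrt (2 * pi * s\<^sup>2)"
      by (simp add: real_sqrt_mult power_mult_distrib)
    ultimately show ?thesis unfolding normal_density_def using s by simp
  qed
  have "(\<integral>\<^sup>+x. k x \<partial>normal_law (r * m + e) (\<bar>r\<bar> * s))
      = (\<integral>\<^sup>+x. ennreal (normal_density (r * m + e) (\<bar>r\<bar> * s) x) * k x \<partial>lborel)"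
    by (rule nn_integral_normal_law) measurable
  also have "\<dots> = \<bar>r\<bar> * (\<integral>\<^sup>+x. ennreal (normal_density (r * m + e) (\<bar>r\<bar> * s) (e + r * x)) * k (e + r * x) \<partial>lborel)"
    using s by (intro nn_integral_real_affine) auto
  also have "\<dots> = (\<integral>\<^sup>+x. ennreal (normal_density m s x) * k (e + r * x) \<partial>lborel)"
    unfolding * by (subst nn_integral_cmult[symmetric]) (auto simp: ennreal_mult mult.assoc)
  also have "\<dots> = (\<integral>\<^sup>+u. k (r * u + e) \<partial>normal_law m s)"
    by (simp add: nn_integral_normal_law add.commute)
  finally show ?thesis by simp
qed

text \<open>Variances of independent Gaussians add. Either coefficient may vanish: r = 0 corresponds
  to orthogonal directions and c = 0 to parallel ones.\<close>

lemma nn_integral_normal_law_add: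
  assumes s: "s > 0" and c: "r\<^sup>2 * s\<^sup>2 + c\<^sup>2 > 0" and [measurable]: "k \<in> borel_measurable borel"
  shows "(\<integral>\<^sup>+u. \<integral>\<^sup>+z. k (r * u + c * z) \<partial>normal_law 0 1 \<partial>normal_law m s)
    = (\<integral>\<^sup>+x. k x \<partial>normal_law (r * m) (sqrt (r\<^sup>2 * s\<^sup>2 + c\<^sup>2)))"
proof -
  consider "r = 0" "c \<noteq> 0" | "c = 0" "r \<noteq> 0" | "r \<noteq> 0" "c \<noteq> 0" using c by force
  thus ?thesis
  proof cases
    case 1
    thus ?thesis using nn_integral_normal_law_affine[of 1 c k 0 0] s by simp
  next
    case 2
    thus ?thesis using nn_integral_normal_law_affine[of s r k m 0] s by (simp add: real_sqrt_mult)
  next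
    case 3
    let ?d1 = "normal_density (r * m) (\<bar>r\<bar> * s)" and ?d2 = "normal_density 0 \<bar>c\<bar>"
    have "(\<integral>\<^sup>+u. \<integral>\<^sup>+z. k (r * u + c * z) \<partial>normal_law 0 1 \<partial>normal_law m s)
       = (\<integral>\<^sup>+u. \<integral>\<^sup>+y. k (r * u + y) \<partial>normal_law 0 \<bar>c\<bar> \<partial>normal_law m s)"
    proof (rule nn_integral_cong)
      fix u
      show "(\<integral>\<^sup>+z. k (r * u + c * z) \<partial>normal_law 0 1) = (\<integral>\<^sup>+y. k (r * u + y) \<partial>normal_law 0 \<bar>c\<bar>)"
        using nn_integral_normal_law_affine[of 1 c "\<lambda>y. k (r * u + y)" 0 0] 3 by simp
    qed
    also have "\<dots> = (\<integral>\<^sup>+w. \<integral>\<^sup>+y. k (w + y) \<partial>normal_law 0 \<bar>c\<bar> \<partial>normal_law (r * m) (\<bar>r\<bar> * s))"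
    proof -
      interpret sigma_finite_measure "normal_law 0 \<bar>c\<bar>"
        using 3 by (intro prob_space_imp_sigma_finite prob_space_normal_law) auto
      show ?thesis
        using nn_integral_normal_law_affine[of s r "\<lambda>w. \<integral>\<^sup>+y. k (w + y) \<partial>normal_law 0 \<bar>c\<bar>" m 0] 3 s by simp
    qed
    also have "\<dots> = (\<integral>\<^sup>+w. \<integral>\<^sup>+y. ennreal (?d1 w) * (ennreal (?d2 y) * k (w + y)) \<partial>lborel \<partial>lborel)"
      by (simp add: nn_integral_normal_law nn_integral_cmult)
    also have "\<dots> = (\<integral>\<^sup>+y. \<integral>\<^sup>+w. ennreal (?d1 w) * (ennreal (?d2 y) * k (w + y)) \<partial>lborel \<partial>lborel)"
      by (intro lborel_pair.Fubini'[symmetric]) measurable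
    also have "\<dots> = (\<integral>\<^sup>+y. \<integral>\<^sup>+x. ennreal (?d1 (x - y)) * (ennreal (?d2 y) * k x) \<partial>lborel \<partial>lborel)"
    proof (rule nn_integral_cong)
      fix y :: real
      show "(\<integral>\<^sup>+w. ennreal (?d1 w) * (ennreal (?d2 y) * k (w + y)) \<partial>lborel) = (\<integral>\<^sup>+x. ennreal (?d1 (x - y)) * (ennreal (?d2 y) * k x) \<partial>lborel)"
        by (subst nn_integral_real_affine[where c=1 and t="-y"]) auto
    qed
    also have "\<dots> = (\<integral>\<^sup>+x. \<integral>\<^sup>+y. ennreal (?d1 (x - y)) * (ennreal (?d2 y) * k x) \<partial>lborel \<partial>lborel)"
      by (intro lborel_pair.Fubini') measurable
    also have "\<dots> = (\<integral>\<^sup>+x. ennreal (normal_density (r * m) (sqrt (r\<^sup>2 * s\<^sup>2 + c\<^sup>2)) x) * k x \<partial>lborel)"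
    proof (rule nn_integral_cong)
      fix x
      have "(\<integral>\<^sup>+y. ennreal (?d1 (x - y)) * (ennreal (?d2 y) * k x) \<partial>lborel)
          = (\<integral>\<^sup>+y. ennreal (normal_density 0 (\<bar>r\<bar> * s) ((x - r * m) - y) * ?d2 y) * k x \<partial>lborel)"
      proof (rule nn_integral_cong)
        fix y
        have "?d1 (x - y) = normal_density 0 (\<bar>r\<bar> * s) ((x - r * m) - y)"
          by (simp add: normal_density_def algebra_simps)
        thus "ennreal (?d1 (x - y)) * (ennreal (?d2 y) * k x)
            = ennreal (normal_density 0 (\<bar>r\<bar> * s) ((x - r * m) - y) * ?d2 y) * k x"
          by (simp add: ennreal_mult mult.assoc)
      qed
      also have "\<dots> = (\<integral>\<^sup>+y. ennreal (normal_density 0 (\<bar>r\<bar> * s) ((x - r * m) - y) * ?d2 y) \<partial>lborel) * k x"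
        by (rule nn_integral_multc) measurable
      also have "(\<integral>\<^sup>+y. ennreal (normal_density 0 (\<bar>r\<bar> * s) ((x - r * m) - y) * ?d2 y) \<partial>lborel)
          = ennreal (normal_density 0 (sqrt ((\<bar>r\<bar> * s)\<^sup>2 + \<bar>c\<bar>\<^sup>2)) (x - r * m))"
        using conv_normal_density_zero_mean[of "\<bar>r\<bar> * s" "\<bar>c\<bar>"] 3 s by (simp add: fun_eq_iff)
      also have "normal_density 0 (sqrt ((\<bar>r\<bar> * s)\<^sup>2 + \<bar>c\<bar>\<^sup>2)) (x - r * m) = normal_density (r * m) (sqrt (r\<^sup>2 * s\<^sup>2 + c\<^sup>2)) x"
        by (simp add: normal_density_def power_mult_distrib)
      finally show "(\<integral>\<^sup>+y. ennreal (?d1 (x - y)) * (ennreal (?d2 y) * k x) \<partial>lborel)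
        = ennreal (normal_density (r * m) (sqrt (r\<^sup>2 * s\<^sup>2 + c\<^sup>2)) x) * k x" .
    qed
    also have "\<dots> = (\<integral>\<^sup>+x. k x \<partial>normal_law (r * m) (sqrt (r\<^sup>2 * s\<^sup>2 + c\<^sup>2)))"
      by (simp add: nn_integral_normal_law)
    finally show ?thesis .
  qed
qed

text \<open>Cauchy--Schwarz read off from the squared length of the residual of w along v, a length
  that is needed itself as a variance.\<close>

lemma dot_unit_le:
  assumes v: "dot d v v = 1" and w: "dot d w w = 1"
  shows "(dot d v w)\<^sup>2 \<le> 1"
    "dot d (\<lambda>i\<in>{..<d}. w i - dot d v w * v i) (\<lambda>i\<in>{..<d}. w i - dot d v w * v i) = 1 - (dot d v w)\<^sup>2"
proof -
  define r where "r = dot d v w"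
  have "dot d (\<lambda>i\<in>{..<d}. w i - r * v i) (\<lambda>i\<in>{..<d}. w i - r * v i)
    = (\<Sum>i<d. w i * w i + (r\<^sup>2 * (v i * v i) - 2 * r * (v i * w i)))"
    by (intro sum.cong) (auto simp: power2_eq_square algebra_simps)
  also have "\<dots> = 1 + (r\<^sup>2 * 1 - 2 * r * r)"
    using v w by (simp add: sum.distrib sum_subtractf r_def flip: sum_distrib_left)
  finally have *: "dot d (\<lambda>i\<in>{..<d}. w i - r * v i) (\<lambda>i\<in>{..<d}. w i - r * v i) = 1 - r\<^sup>2"
    by (simp add: power2_eq_square)
  thus "dot d (\<lambda>i\<in>{..<d}. w i - dot d v w * v i) (\<lambda>i\<in>{..<d}. w i - dot d v w * v i) = 1 - (dot d v w)\<^sup>2"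
    by (simp add: r_def)
  have "dot d (\<lambda>i\<in>{..<d}. w i - r * v i) (\<lambda>i\<in>{..<d}. w i - r * v i) \<ge> 0" by (intro sum_nonneg) auto
  thus "(dot d v w)\<^sup>2 \<le> 1" using * by (simp add: r_def)
qed

lemma scaled_dot_square_less_1:
  assumes "dot d v v = 1" "dot d w w = 1" "a\<^sup>2 < 1"
  shows "(a\<^sup>2 * dot d v w)\<^sup>2 < 1"
proof -
  have "(a\<^sup>2 * dot d v w)\<^sup>2 \<le> (a\<^sup>2)\<^sup>2 * 1"
    unfolding power_mult_distrib using dot_unit_le(1)[OF assms(1,2)] by (intro mult_left_mono) auto
  also have "\<dots> < 1" using assms(3) power_strict_mono[of "a\<^sup>2" 1 2] by simp
  finally show ?thesis .
qed

text \<open>A chain of three correlations: a from t to the component along v, then r from there to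
  the component along w, then a to t'. The first kernel makes the component along v normal with mean
  at; the component along w is then r times it plus an independent Gaussian of variance 1 - r^2, so
  it is N(art, 1 - (ar)^2), and the semigroup property handles the second kernel.\<close>

lemma nn_integral_mehler_mehler:
  assumes v: "v \<in> space (Rd d)" "dot d v v = 1" and w: "w \<in> space (Rd d)" "dot d w w = 1"
    and a: "a\<^sup>2 < 1"
  shows "(\<integral>\<^sup>+x. ennreal (mehler a (dot d v x) t) * ennreal (mehler a (dot d w x) t') \<partial>std_gaussian d)
    = ennreal (mehler (a\<^sup>2 * dot d v w) t t')"
proof -
  have [measurable]: "v \<in> space (Rd d)" "w \<in> space (Rd d)" by fact+
  define r where "r = dot d v w"
  define q where "q = (\<lambda>i\<in>{..<d}. w i - dot d v w * v i)"
  have q: "q \<in> space (Rd d)" by (auto simp: q_def space_Rd)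
  have r1: "r\<^sup>2 \<le> 1" and qq: "dot d q q = 1 - r\<^sup>2"
    using dot_unit_le[OF v(2) w(2)] by (simp_all add: r_def q_def)
  have wp: "dot d w (place d v u g) = r * u + dot d q g" for u g
  proof -
    have "dot d w (place d v u g) = (\<Sum>j<d. u * (v j * w j) + (w j * g j - dot d v g * (v j * w j)))"
      by (intro sum.cong) (auto simp: place_apply algebra_simps)
    also have "\<dots> = u * r + (dot d w g - dot d v g * r)"
      by (simp add: sum.distrib sum_subtractf r_def flip: sum_distrib_left)
    also have "dot d q g = (\<Sum>j<d. w j * g j - r * (v j * g j))"
      unfolding q_def r_def by (intro sum.cong) (auto simp: algebra_simps)
    hence "dot d q g = dot d w g - r * dot d v g"
      by (simp add: sum_subtractf sum_distrib_left)
    hence "u * r + (dot d w g - dot d v g * r) = r * u + dot d q g" by (simp add: mult.commute)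
    finally show ?thesis .
  qed
  have ra: "(a * r)\<^sup>2 < 1"
  proof -
    have "a\<^sup>2 * r\<^sup>2 \<le> a\<^sup>2 * 1" using r1 by (intro mult_left_mono) auto
    thus ?thesis using a by (simp add: power_mult_distrib)
  qed
  have "r\<^sup>2 * (sqrt (1 - a\<^sup>2))\<^sup>2 + (sqrt (1 - r\<^sup>2))\<^sup>2 = 1 - (a * r)\<^sup>2"
    using a r1 by (simp add: power_mult_distrib algebra_simps)
  note s = this
  have "(\<integral>\<^sup>+x. ennreal (mehler a (dot d v x) t) * ennreal (mehler a (dot d w x) t') \<partial>std_gaussian d)
    = (\<integral>\<^sup>+u. \<integral>\<^sup>+g. ennreal (mehler a (r * u + dot d q g) t') \<partial>std_gaussian d \<partial>normal_law (a * t) (sqrt (1 - a\<^sup>2)))"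
    by (subst nn_integral_std_gaussian_mehler[OF v a]) (auto simp: wp)
  also have "\<dots> = (\<integral>\<^sup>+u. \<integral>\<^sup>+z. ennreal (mehler a (r * u + sqrt (1 - r\<^sup>2) * z) t') \<partial>normal_law 0 1 \<partial>normal_law (a * t) (sqrt (1 - a\<^sup>2)))"
  proof (rule nn_integral_cong)
    fix u :: real
    show "(\<integral>\<^sup>+g. ennreal (mehler a (r * u + dot d q g) t') \<partial>std_gaussian d)
      = (\<integral>\<^sup>+z. ennreal (mehler a (r * u + sqrt (1 - r\<^sup>2) * z) t') \<partial>normal_law 0 1)"
      using nn_integral_dot_std_gaussian[OF q, of "\<lambda>z. ennreal (mehler a (r * u + z) t')"] by (simp add: qq)
  qed
  also have "\<dots> = (\<integral>\<^sup>+x. ennreal (mehler a x t') \<partial>normal_law (r * (a * t)) (sqrt (r\<^sup>2 * (sqrt (1 - a\<^sup>2))\<^sup>2 + (sqrt (1 - r\<^sup>2))\<^sup>2)))"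
    using a ra by (intro nn_integral_normal_law_add) (auto simp: s simp del: real_sqrt_pow2 real_sqrt_pow2_iff)
  also have "\<dots> = (\<integral>\<^sup>+x. ennreal (mehler a x t') \<partial>normal_law ((a * r) * t) (sqrt (1 - (a * r)\<^sup>2)))"
    unfolding s by (simp add: mult_ac)
  also have "\<dots> = ennreal (mehler (a * (a * r)) t t')"
    by (rule nn_integral_mehler_normal[OF a ra])
  finally show ?thesis by (simp add: r_def power2_eq_square mult.assoc)
qed

section \<open>The uniform law on the sphere\<close>

abbreviation nrm :: "nat \<Rightarrow> (nat \<Rightarrow> real) \<Rightarrow> nat \<Rightarrow> real" where
  "nrm d x \<equiv> (\<lambda>i\<in>{..<d}. x i / L2_set x {..<d})"

lemma measurable_L2_set [measurable (raw)]:
  assumes [measurable]: "f \<in> M \<rightarrow>\<^sub>M Rd d"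
  shows "(\<lambda>x. L2_set (f x) {..<d}) \<in> borel_measurable M"
  unfolding L2_set_def by measurable

lemma nn_integral_exp_neg_square_tail:
  assumes "r \<ge> (0::real)"
  shows "(\<integral>\<^sup>+\<rho>. ennreal (\<rho> * exp (- \<rho>\<^sup>2 / 2)) * (if r \<le> \<rho> then 1 else 0) \<partial>lborel) = ennreal (exp (- r\<^sup>2 / 2))"
proof -
  have "((\<lambda>\<rho>::real. - exp (- \<rho>\<^sup>2 / 2)) \<longlongrightarrow> 0) at_top" by real_asymp
  moreover have "((\<lambda>\<rho>::real. - exp (- \<rho>\<^sup>2 / 2)) has_real_derivative x * exp (- x\<^sup>2 / 2)) (at x)" for x
    by (auto intro!: derivative_eq_intros)
  ultimately show ?thesis
    using nn_integral_FTC_atLeast[of "\<lambda>\<rho>. \<rho> * exp (- \<rho>\<^sup>2 / 2)" r "\<lambda>\<rho>. - exp (- \<rho>\<^sup>2 / 2)" 0] assms by (auto simp: indicator_def of_bool_def)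
qed

lemma L2_set_scale: "r > 0 \<Longrightarrow> L2_set (\<lambda>i\<in>{..<d}. r * x i) {..<d} = r * L2_set x {..<d}"
  by (subst L2_set_right_distrib) (auto intro!: L2_set_cong)

lemma nrm_scale: "r > 0 \<Longrightarrow> nrm d (\<lambda>i\<in>{..<d}. r * x i) = nrm d x"
  by (auto simp: L2_set_scale fun_eq_iff)

text \<open>
  Writes the Gaussian density as a mixture of indicators of balls; the last factor does not depend
  on \<open>h\<close>.
\<close>

lemma nn_integral_radial:
  assumes [measurable]: "h \<in> borel_measurable (Rd d)"
    and hom: "\<And>r x. r > 0 \<Longrightarrow> h (\<lambda>i\<in>{..<d}. r * x i) = h x"
  shows "(\<integral>\<^sup>+x. h x \<partial>std_gaussian d)
    = (\<integral>\<^sup>+x. h x * indicator {x \<in> space (Rd d). L2_set x {..<d} \<le> 1} x \<partial>Ld d)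
      * (ennreal (1 / sqrt (2 * pi) ^ d) * (\<integral>\<^sup>+\<rho>. ennreal (\<rho> * exp (- \<rho>\<^sup>2 / 2)) * ennreal (\<rho> ^ d) * indicator {0<..} \<rho> \<partial>lborel))"
proof -
  interpret L: sigma_finite_measure "Ld d" by (rule sigma_finite_Ld)
  interpret P: pair_sigma_finite lborel "Ld d" ..
  let ?K = "ennreal (1 / sqrt (2 * pi) ^ d)"
  let ?I = "\<integral>\<^sup>+x. h x * indicator {x \<in> space (Rd d). L2_set x {..<d} \<le> 1} x \<partial>Ld d"
  let ?w = "\<lambda>\<rho>::real. ennreal (\<rho> * exp (- \<rho>\<^sup>2 / 2))"
  have dens: "ennreal (gauss_dens d x) = ?K * (\<integral>\<^sup>+\<rho>. ?w \<rho> * (if L2_set x {..<d} \<le> \<rho> then 1 else 0) \<partial>lborel)" for x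
  proof -
    have "(L2_set x {..<d})\<^sup>2 = (\<Sum>i<d. (x i)\<^sup>2)" by (simp add: L2_set_def sum_nonneg)
    hence "gauss_dens d x = 1 / sqrt (2 * pi) ^ d * exp (- (L2_set x {..<d})\<^sup>2 / 2)" by (simp add: gauss_dens_def)
    thus ?thesis
      by (subst nn_integral_exp_neg_square_tail) (auto simp: ennreal_mult'[symmetric] L2_set_nonneg)
  qed
  have "(\<integral>\<^sup>+x. h x \<partial>std_gaussian d) = (\<integral>\<^sup>+x. ennreal (gauss_dens d x) * h x \<partial>Ld d)"
    by (rule nn_integral_std_gaussian) measurable
  also have "\<dots> = (\<integral>\<^sup>+x. \<integral>\<^sup>+\<rho>. ?K * (?w \<rho> * (h x * (if L2_set x {..<d} \<le> \<rho> then 1 else 0))) \<partial>lborel \<partial>Ld d)"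
  proof (rule nn_integral_cong)
    fix x assume "x \<in> space (Ld d)"
    have "(\<integral>\<^sup>+\<rho>. ?K * (?w \<rho> * (h x * (if L2_set x {..<d} \<le> \<rho> then 1 else 0))) \<partial>lborel)
      = (\<integral>\<^sup>+\<rho>. (?K * h x) * (?w \<rho> * (if L2_set x {..<d} \<le> \<rho> then 1 else 0)) \<partial>lborel)"
      by (simp add: mult_ac)
    also have "\<dots> = ?K * h x * (\<integral>\<^sup>+\<rho>. ?w \<rho> * (if L2_set x {..<d} \<le> \<rho> then 1 else 0) \<partial>lborel)"
      by (rule nn_integral_cmult) measurable
    finally show "ennreal (gauss_dens d x) * h x = (\<integral>\<^sup>+\<rho>. ?K * (?w \<rho> * (h x * (if L2_set x {..<d} \<le> \<rho> then 1 else 0))) \<partial>lborel)"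
      unfolding dens by (simp add: mult_ac)
  qed
  also have "\<dots> = (\<integral>\<^sup>+\<rho>. \<integral>\<^sup>+x. ?K * (?w \<rho> * (h x * (if L2_set x {..<d} \<le> \<rho> then 1 else 0))) \<partial>Ld d \<partial>lborel)"
  proof (intro P.Fubini')
    have 1: "{z \<in> space (borel \<Otimes>\<^sub>M Rd d). L2_set (snd z) {..<d} \<le> fst z} \<in> sets (borel \<Otimes>\<^sub>M Rd d)"
      by (intro borel_measurable_le measurable_L2_set measurable_snd measurable_fst)
    have 2: "(\<lambda>z. if L2_set (snd z) {..<d} \<le> fst z then 1 else 0 :: ennreal) \<in> borel_measurable (borel \<Otimes>\<^sub>M Rd d)"
      using 1 by (intro measurable_If) simp_all
    show "(\<lambda>(\<rho>, x). ?K * (?w \<rho> * (h x * (if L2_set x {..<d} \<le> \<rho> then 1 else 0)))) \<in> borel_measurable (lborel \<Otimes>\<^sub>M Ld d)"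
      unfolding case_prod_beta
      by (intro borel_measurable_times_ennreal measurable_const) (use 2 in measurable)
  qed
  also have "\<dots> = (\<integral>\<^sup>+\<rho>. ?I * (?K * (?w \<rho> * ennreal (\<rho> ^ d) * indicator {0<..} \<rho>)) \<partial>lborel)"
  proof (rule nn_integral_cong_AE)
    have "AE \<rho> in lborel. \<rho> \<noteq> (0::real)" by (rule AE_lborel_singleton)
    thus "AE \<rho> in lborel. (\<integral>\<^sup>+x. ?K * (?w \<rho> * (h x * (if L2_set x {..<d} \<le> \<rho> then 1 else 0))) \<partial>Ld d)
        = ?I * (?K * (?w \<rho> * ennreal (\<rho> ^ d) * indicator {0<..} \<rho>))"
    proof eventually_elim
      case (elim \<rho>)
      show ?case
      proof (cases "\<rho> > 0")
        case False
        hence "(if L2_set x {..<d} \<le> \<rho> then 1 else 0) = (0::ennreal)" for x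
          using elim order_trans[OF L2_set_nonneg[of x "{..<d}"], of \<rho>] by auto
        thus ?thesis using False by simp
      next
        case True
        have "(\<integral>\<^sup>+x. ?K * (?w \<rho> * (h x * (if L2_set x {..<d} \<le> \<rho> then 1 else 0))) \<partial>Ld d)
            = (?K * ?w \<rho>) * (\<integral>\<^sup>+x. h x * (if L2_set x {..<d} \<le> \<rho> then 1 else 0) \<partial>Ld d)"
          by (subst nn_integral_cmult[symmetric]) (auto simp: mult.assoc)
        also have "(\<integral>\<^sup>+x. h x * (if L2_set x {..<d} \<le> \<rho> then 1 else 0) \<partial>Ld d)
           = ennreal (\<rho> ^ d) * (\<integral>\<^sup>+x. h (\<lambda>i\<in>{..<d}. 0 + \<rho> * x i) * (if L2_set (\<lambda>i\<in>{..<d}. 0 + \<rho> * x i) {..<d} \<le> \<rho> then 1 else 0) \<partial>Ld d)"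
          using True by (intro nn_integral_Ld_affine) auto
        also have "(\<integral>\<^sup>+x. h (\<lambda>i\<in>{..<d}. 0 + \<rho> * x i) * (if L2_set (\<lambda>i\<in>{..<d}. 0 + \<rho> * x i) {..<d} \<le> \<rho> then 1 else 0) \<partial>Ld d) = ?I"
          unfolding add_0 hom[OF True] L2_set_scale[OF True]
          using True by (intro nn_integral_cong) (auto simp: indicator_def)
        finally show ?thesis using True by (simp add: mult_ac)
      qed
    qed
  qed
  also have "\<dots> = ?I * (?K * (\<integral>\<^sup>+\<rho>. ?w \<rho> * ennreal (\<rho> ^ d) * indicator {0<..} \<rho> \<partial>lborel))"
    by (simp add: nn_integral_cmult)
  finally show ?thesis .
qed

text \<open>The radial formula for h = 1 shows that its last factor is the reciprocal of the volume
  of the ball. Applied to \<psi> composed with normalisation, which is invariant under scaling, it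
  then compares the ball with the Gaussian.\<close>

lemma nn_integral_unif_sphere:
  assumes [measurable]: "\<psi> \<in> borel_measurable (Rd d)"
  shows "(\<integral>\<^sup>+v. \<psi> v \<partial>unif_sphere d) = (\<integral>\<^sup>+x. \<psi> (nrm d x) \<partial>std_gaussian d)"
proof -
  let ?B = "{x \<in> space (Rd d). L2_set x {..<d} \<le> 1}"
  define \<kappa> where "\<kappa> = (ennreal (1 / sqrt (2 * pi) ^ d) * (\<integral>\<^sup>+\<rho>. ennreal (\<rho> * exp (- \<rho>\<^sup>2 / 2)) * ennreal (\<rho> ^ d) * indicator {0<..} \<rho> \<partial>lborel))"
  define V where "V = emeasure (Ld d) ?B"
  have [measurable]: "?B \<in> sets (Rd d)" by measurable
  have "(\<integral>\<^sup>+x. 1 \<partial>std_gaussian d) = (\<integral>\<^sup>+x. 1 * indicator ?B x \<partial>Ld d) * \<kappa>"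
    unfolding \<kappa>_def by (rule nn_integral_radial) auto
  hence V: "V * \<kappa> = 1" by (simp add: V_def sets_Ld)
  hence "V \<noteq> 0" by auto
  moreover have "V \<noteq> \<infinity>" using V by (auto simp: ennreal_top_mult split: if_splits)
  ultimately have inv: "inverse V = \<kappa>"
    using V by (metis ennreal_divide_self divide_ennreal_def infinity_ennreal_def mult.assoc mult.commute mult_1 top.not_eq_extremum)
  have "(\<integral>\<^sup>+v. \<psi> v \<partial>unif_sphere d) = (\<integral>\<^sup>+x. \<psi> (nrm d x) * indicator ?B x \<partial>Ld d) / V"
    unfolding unif_sphere_def V_def
    by (subst nn_integral_distr) (auto simp: nn_integral_uniform_measure sets_Ld)
  also have "\<dots> = (\<integral>\<^sup>+x. \<psi> (nrm d x) \<partial>std_gaussian d)"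
    unfolding divide_ennreal_def inv \<kappa>_def
    by (rule nn_integral_radial[symmetric]) (measurable, simp only: nrm_scale)
  finally show ?thesis .
qed

lemma sets_unif_sphere [simp, measurable_cong]: "sets (unif_sphere d) = sets (Rd d)"
  by (simp add: unif_sphere_def)

lemma space_unif_sphere [simp]: "space (unif_sphere d) = space (Rd d)"
  by (simp add: unif_sphere_def)

lemma prob_space_unif_sphere: "prob_space (unif_sphere d)"
proof
  have "emeasure (unif_sphere d) (space (unif_sphere d)) = (\<integral>\<^sup>+v. 1 \<partial>unif_sphere d)" by simp
  also have "\<dots> = 1" by (subst nn_integral_unif_sphere) auto
  finally show "emeasure (unif_sphere d) (space (unif_sphere d)) = 1" .
qed

lemma dot_nrm:
  assumes "L2_set x {..<d} \<noteq> 0" shows "dot d (nrm d x) (nrm d x) = 1"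
proof -
  have *: "L2_set x {..<d} * L2_set x {..<d} = dot d x x" by (simp add: L2_set_def sum_nonneg power2_eq_square)
  hence nz: "dot d x x \<noteq> 0" using assms by (metis mult_eq_0_iff)
  have "dot d (nrm d x) (nrm d x) = (\<Sum>j<d. x j * x j / (L2_set x {..<d} * L2_set x {..<d}))"
    by (intro sum.cong) auto
  also have "\<dots> = dot d x x / dot d x x" unfolding * by (rule sum_divide_distrib[symmetric])
  also have "\<dots> = 1" using nz by (rule divide_self)
  finally show ?thesis .
qed

lemma AE_std_gaussian_nonzero:
  assumes "d \<ge> 1"
  shows "AE x in std_gaussian d. L2_set x {..<d} \<noteq> 0"
proof -
  define e where "e = (\<lambda>i\<in>{..<d}. if i = 0 then 1 else 0 :: real)"
  have e: "e \<in> space (Rd d)" by (auto simp: e_def space_Rd)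
  have de: "dot d e x = x 0" for x
  proof -
    have "dot d e x = (\<Sum>j<d. if j = 0 then x j else 0)" by (intro sum.cong) (auto simp: e_def)
    thus ?thesis using assms by simp
  qed
  have 1: "dot d e e = 1" using assms by (simp add: de) (simp add: e_def)
  have z: "emeasure (normal_law 0 1) {0} = 0"
    unfolding normal_law_def by (subst emeasure_density) auto
  have "(\<integral>\<^sup>+x. indicator {0} (dot d e x) * 1 \<partial>std_gaussian d) = (\<integral>\<^sup>+u. indicator {0::real} u * (\<integral>\<^sup>+g. 1 \<partial>std_gaussian d) \<partial>normal_law 0 1)"
    by (rule nn_integral_std_gaussian_split[OF e 1]) auto
  also have "\<dots> = 0" by (simp add: z)
  finally have "AE x in std_gaussian d. indicator {0::real} (x 0) = (0::ennreal)"
    unfolding de using assms by (subst (asm) nn_integral_0_iff_AE) auto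
  thus ?thesis
  proof eventually_elim
    case (elim x)
    hence "x 0 \<noteq> 0" by (auto simp: indicator_def)
    thus ?case using assms by (subst L2_set_eq_0_iff) auto
  qed
qed

text \<open>Only almost everywhere, since the centre of the ball is sent to 0.\<close>

lemma AE_unif_sphere_unit:
  assumes "d \<ge> 1"
  shows "AE v in unif_sphere d. dot d v v = 1"
proof -
  define N where "N = {v \<in> space (Rd d). dot d v v < 1} \<union> {v \<in> space (Rd d). dot d v v > 1}"
  have N: "v \<in> N \<longleftrightarrow> v \<in> space (Rd d) \<and> dot d v v \<noteq> 1" for v by (auto simp: N_def)
  have [measurable]: "N \<in> sets (Rd d)" unfolding N_def by measurable
  have "(\<integral>\<^sup>+v. indicator N v \<partial>unif_sphere d) = (\<integral>\<^sup>+x. indicator N (nrm d x) \<partial>std_gaussian d)"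
    by (rule nn_integral_unif_sphere) measurable
  also have "\<dots> = 0"
  proof (subst nn_integral_0_iff_AE)
    show "AE x in std_gaussian d. indicator N (nrm d x) = (0::ennreal)"
      using AE_std_gaussian_nonzero[OF assms]
      by eventually_elim (simp add: N dot_nrm del: restrict_apply)
  qed measurable
  finally have "AE v in unif_sphere d. indicator N v = (0::ennreal)"
    by (subst (asm) nn_integral_0_iff_AE) auto
  with AE_space show ?thesis
    by eventually_elim (auto simp: indicator_def N split: if_splits)
qed

section \<open>Laplace transforms and the tail of the correlation of two directions\<close>

lemma nn_integral_exp_neg_square_normal:
  assumes "\<kappa> > (-1::real)"
  shows "(\<integral>\<^sup>+u. ennreal (exp (- (\<kappa> * u\<^sup>2 / 2))) \<partial>normal_law 0 1) = ennreal (1 / sqrt (1 + \<kappa>))"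
proof (rule nn_integral_normal_law_tilt)
  fix t
  show "exp (- (\<kappa> * t\<^sup>2 / 2)) * normal_density 0 1 t = 1 / sqrt (1 + \<kappa>) * normal_density 0 (1 / sqrt (1 + \<kappa>)) t"
    using tilt_normal_density[of 1 "1 + \<kappa>" "\<kappa> / 2" t 0 0] assms by simp
qed (use assms in auto)

lemma nn_integral_exp_neg_sum_squares:
  assumes "\<kappa> > (-1::real)"
  shows "(\<integral>\<^sup>+x. ennreal (exp (- (\<kappa> * (\<Sum>i<d. (x i)\<^sup>2) / 2))) \<partial>std_gaussian d) = ennreal ((1 / sqrt (1 + \<kappa>)) ^ d)"
proof -
  interpret product_prob_space "\<lambda>_::nat. normal_law 0 1"
    by (intro product_prob_spaceI prob_space_normal_law) auto
  have "ennreal (exp (- (\<kappa> * (\<Sum>i<d. (x i)\<^sup>2) / 2))) = (\<Prod>i<d. ennreal (exp (- (\<kappa> * (x i)\<^sup>2 / 2))))" for x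
    by (simp add: prod_ennreal exp_sum[symmetric] sum_negf sum_distrib_left sum_divide_distrib)
  hence "(\<integral>\<^sup>+x. ennreal (exp (- (\<kappa> * (\<Sum>i<d. (x i)\<^sup>2) / 2))) \<partial>std_gaussian d)
    = (\<Prod>i<d. \<integral>\<^sup>+u. ennreal (exp (- (\<kappa> * u\<^sup>2 / 2))) \<partial>normal_law 0 1)"
    unfolding std_gaussian_def by (simp only:) (rule product_nn_integral_prod, auto)
  thus ?thesis using assms by (simp add: nn_integral_exp_neg_square_normal ennreal_power)
qed

text \<open>For a unit vector w, the squared length of the part of g orthogonal to w; under the
  standard Gaussian it is chi-squared with d - 1 degrees of freedom.\<close>

definition proj_sq :: "nat \<Rightarrow> (nat \<Rightarrow> real) \<Rightarrow> (nat \<Rightarrow> real) \<Rightarrow> real" where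
  "proj_sq d w g = (\<Sum>i<d. (place d w 0 g i)\<^sup>2)"

lemma proj_sq_nonneg: "proj_sq d w g \<ge> 0"
  unfolding proj_sq_def by (intro sum_nonneg) auto

lemma measurable_proj_sq [measurable]:
  assumes w: "w \<in> space (Rd d)" shows "proj_sq d w \<in> borel_measurable (Rd d)"
proof -
  have [measurable]: "w \<in> space (Rd d)" by fact
  have [measurable]: "(\<lambda>g. place d w 0 g) \<in> Rd d \<rightarrow>\<^sub>M Rd d" by measurable
  show ?thesis unfolding proj_sq_def by measurable
qed

lemma sum_squares_place_proj:
  "dot d w w = 1 \<Longrightarrow> (\<Sum>i<d. (place d w u g i)\<^sup>2) = u\<^sup>2 + proj_sq d w g"
  unfolding proj_sq_def by (simp add: sum_squares_place)

text \<open>The squared norm is the sum of the independent parts along w and orthogonal to w, so the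
  transform in dimension d is the product of a one-dimensional factor and the one sought; the former
  is cancelled.\<close>

lemma nn_integral_exp_neg_proj_sq:
  assumes w: "w \<in> space (Rd d)" "dot d w w = 1" and \<kappa>: "\<kappa> > -1" and d: "d \<ge> 1"
  shows "(\<integral>\<^sup>+g. ennreal (exp (- (\<kappa> * proj_sq d w g / 2))) \<partial>std_gaussian d) = ennreal ((1 / sqrt (1 + \<kappa>)) ^ (d - 1))"
proof -
  have [measurable]: "w \<in> space (Rd d)" "proj_sq d w \<in> borel_measurable (Rd d)"
    using w by auto
  let ?E = "\<integral>\<^sup>+g. ennreal (exp (- (\<kappa> * proj_sq d w g / 2))) \<partial>std_gaussian d"
  let ?b = "1 / sqrt (1 + \<kappa>)"
  have "ennreal (?b ^ d) = (\<integral>\<^sup>+x. 1 * ennreal (exp (- (\<kappa> * (\<Sum>i<d. (x i)\<^sup>2) / 2))) \<partial>std_gaussian d)"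
    using nn_integral_exp_neg_sum_squares[OF \<kappa>] by simp
  also have "\<dots> = (\<integral>\<^sup>+u. 1 * (\<integral>\<^sup>+g. ennreal (exp (- (\<kappa> * (\<Sum>i<d. (place d w u g i)\<^sup>2) / 2))) \<partial>std_gaussian d) \<partial>normal_law 0 1)"
    by (rule nn_integral_std_gaussian_split[OF w]) auto
  also have "\<dots> = (\<integral>\<^sup>+u. ennreal (exp (- (\<kappa> * u\<^sup>2 / 2))) * ?E \<partial>normal_law 0 1)"
  proof (rule nn_integral_cong)
    fix u
    have "(\<integral>\<^sup>+g. ennreal (exp (- (\<kappa> * (\<Sum>i<d. (place d w u g i)\<^sup>2) / 2))) \<partial>std_gaussian d)
      = (\<integral>\<^sup>+g. ennreal (exp (- (\<kappa> * u\<^sup>2 / 2))) * ennreal (exp (- (\<kappa> * proj_sq d w g / 2))) \<partial>std_gaussian d)"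
      by (intro nn_integral_cong)
        (simp add: sum_squares_place_proj[OF w(2)] ennreal_mult[symmetric] exp_add[symmetric] field_simps)
    also have "\<dots> = ennreal (exp (- (\<kappa> * u\<^sup>2 / 2))) * ?E" by (rule nn_integral_cmult) measurable
    finally show "1 * (\<integral>\<^sup>+g. ennreal (exp (- (\<kappa> * (\<Sum>i<d. (place d w u g i)\<^sup>2) / 2))) \<partial>std_gaussian d)
      = ennreal (exp (- (\<kappa> * u\<^sup>2 / 2))) * ?E" by simp
  qed
  also have "\<dots> = ennreal ?b * ?E"
    using \<kappa> by (subst nn_integral_multc) (auto simp: nn_integral_exp_neg_square_normal)
  finally have 1: "ennreal (?b ^ d) = ennreal ?b * ?E" .
  have b: "?b > 0" using \<kappa> by simp
  have "ennreal (1 / ?b) * (ennreal ?b * ?E) = ?E"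
    using b by (simp add: mult.assoc[symmetric] ennreal_mult[symmetric])
  hence "?E = ennreal (1 / ?b * ?b ^ d)"
    using b unfolding 1[symmetric] by (simp add: ennreal_mult[symmetric])
  also have "1 / ?b * ?b ^ d = ?b ^ (d - 1)"
    using b d by (cases d) auto
  finally show ?thesis .
qed

text \<open>
  Equal to \<open>1/W\<close> for \<open>W > 0\<close> and to \<open>\<infinity>\<close> at \<open>0\<close>, unlike \<open>1/W\<close> on the reals; as a Laplace transform it
  has a computable mean.
\<close>

definition inv_laplace :: "real \<Rightarrow> ennreal" where
  "inv_laplace W = (\<integral>\<^sup>+\<kappa>. ennreal (exp (- (\<kappa> * W / 2)) / 2) * indicator {0..} \<kappa> \<partial>lborel)"

lemma inv_laplace_pos:
  assumes "W > 0" shows "inv_laplace W = ennreal (1 / W)"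
proof -
  have "((\<lambda>\<kappa>. - exp (- (\<kappa> * W / 2)) / W) \<longlongrightarrow> 0) at_top" using assms by real_asymp
  moreover have "((\<lambda>\<kappa>. - exp (- (\<kappa> * W / 2)) / W) has_real_derivative exp (- (x * W / 2)) / 2) (at x)" for x
    using assms by (auto intro!: derivative_eq_intros)
  ultimately show ?thesis unfolding inv_laplace_def
    using nn_integral_FTC_atLeast[of "\<lambda>\<kappa>. exp (- (\<kappa> * W / 2)) / 2" 0 "\<lambda>\<kappa>. - exp (- (\<kappa> * W / 2)) / W" 0] by auto
qed

lemma inv_laplace_0: "inv_laplace 0 = \<infinity>"
proof -
  have "inv_laplace 0 = ennreal (1/2) * emeasure lborel {0::real..}"
    unfolding inv_laplace_def by (simp add: nn_integral_cmult del: ennreal_half)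
  moreover have "emeasure lborel {0::real..} = \<infinity>"
  proof -
    have "ennreal (real n) \<le> emeasure lborel {0::real..}" for n
      using emeasure_mono[of "{0..real n}" "{0..}" lborel] by auto
    note le = this
    show ?thesis
    proof (rule ccontr)
      assume "emeasure lborel {0::real..} \<noteq> \<infinity>"
      then obtain r where r: "emeasure lborel {0::real..} = ennreal r" "r \<ge> 0"
        by (cases "emeasure lborel {0::real..}") auto
      obtain n where "r < real n" using reals_Archimedean2 by blast
      thus False using le[of n] r by simp
    qed
  qed
  ultimately show ?thesis by (simp add: ennreal_mult_top)
qed

text \<open>Here u and W are the component along w and the squared orthogonal part, so u/sqrt(u^2 +
  W) is the correlation. A correlation above 1/2 forces W < 3 u^2, so that exp((3 u^2 - W)/8)
  dominates the indicator of this event as in a Chernoff bound. The singularity is at most sqrt(1 +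
  u^2/W) \<le> 1 + u^2/W; at W = 0 the right-hand side is infinite by the choice of
  \<open>inv_laplace\<close>. The resulting bound is a sum of products of a function of u and a
  function of W.\<close>

lemma inverse_sqrt_correlation_le:
  assumes W: "W \<ge> 0" and b: "0 \<le> b" "b < 1" and r: "\<bar>u / sqrt (u\<^sup>2 + W)\<bar> > 1/2"
  shows "ennreal (1 / sqrt (1 - (b * (u / sqrt (u\<^sup>2 + W)))\<^sup>2))
    \<le> ennreal (exp (3 * u\<^sup>2 / 8)) * ennreal (exp (- (W / 8))) * (1 + ennreal (u\<^sup>2) * inv_laplace W)"
proof -
  have u: "u \<noteq> 0" using r by auto
  hence u2: "u\<^sup>2 > 0" by simp
  define r where "r = u / sqrt (u\<^sup>2 + W)"
  have r2: "r\<^sup>2 = u\<^sup>2 / (u\<^sup>2 + W)" using W u2 by (simp add: r_def power_divide)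
  have "r\<^sup>2 > 1/4"
  proof -
    have "(1/2)\<^sup>2 < \<bar>r\<bar>\<^sup>2" using r by (intro power_strict_mono) (auto simp: r_def)
    thus ?thesis by (simp add: power2_eq_square)
  qed
  hence "W < 3 * u\<^sup>2" unfolding r2 using u2 W by (simp add: field_simps)
  hence "1 \<le> exp (3 * u\<^sup>2 / 8) * exp (- (W / 8))" by (simp flip: exp_add)
  hence e: "1 \<le> ennreal (exp (3 * u\<^sup>2 / 8)) * ennreal (exp (- (W / 8)))"
    by (simp flip: ennreal_mult)
  have "ennreal (1 / sqrt (1 - (b * r)\<^sup>2)) \<le> 1 + ennreal (u\<^sup>2) * inv_laplace W"
  proof (cases "W = 0")
    case True
    thus ?thesis using u2 by (simp add: inv_laplace_0 ennreal_mult_top)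
  next
    case False
    hence W: "W > 0" using W by simp
    have "(b * r)\<^sup>2 \<le> 1 * r\<^sup>2" unfolding power_mult_distrib using b by (intro mult_right_mono) (auto simp: power_le_one)
    moreover have "1 - r\<^sup>2 = W / (u\<^sup>2 + W)"
    proof -
      have "u\<^sup>2 + W \<noteq> 0" using add_pos_pos[OF u2 W] by linarith
      hence "W / (u\<^sup>2 + W) + u\<^sup>2 / (u\<^sup>2 + W) = 1" by (simp add: add_divide_distrib[symmetric] add.commute)
      thus ?thesis by (simp add: r2)
    qed
    ultimately have "W / (u\<^sup>2 + W) \<le> 1 - (b * r)\<^sup>2" by simp
    moreover have "W / (u\<^sup>2 + W) > 0" using W add_pos_pos[OF u2 W] by (rule divide_pos_pos)
    ultimately have "1 / sqrt (1 - (b * r)\<^sup>2) \<le> 1 / sqrt (W / (u\<^sup>2 + W))"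
      by (intro divide_left_mono real_sqrt_le_mono) auto
    also have "\<dots> = sqrt (1 + u\<^sup>2 / W)"
    proof -
      have "1 / sqrt (W / (u\<^sup>2 + W)) = sqrt ((u\<^sup>2 + W) / W)" by (simp add: real_sqrt_divide)
      also have "(u\<^sup>2 + W) / W = 1 + u\<^sup>2 / W" using W by (simp add: add_divide_distrib add.commute)
      finally show ?thesis .
    qed
    also have "\<dots> \<le> sqrt ((1 + u\<^sup>2 / W)\<^sup>2)"
      using W by (intro real_sqrt_le_mono self_le_power) auto
    also have "\<dots> = 1 + u\<^sup>2 * (1 / W)" using W by simp
    finally have "ennreal (1 / sqrt (1 - (b * r)\<^sup>2)) \<le> ennreal (1 + u\<^sup>2 * (1 / W))" by (rule ennreal_leI)
    also have "\<dots> = 1 + ennreal (u\<^sup>2) * inv_laplace W"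
      using W by (subst ennreal_plus) (auto simp: inv_laplace_pos ennreal_mult[symmetric])
    finally show ?thesis .
  qed
  also have "\<dots> \<le> ennreal (exp (3 * u\<^sup>2 / 8)) * ennreal (exp (- (W / 8))) * (1 + ennreal (u\<^sup>2) * inv_laplace W)"
    using mult_right_mono[OF e, of "1 + ennreal (u\<^sup>2) * inv_laplace W"] by simp
  finally show ?thesis by (simp add: r_def)
qed

lemma borel_measurable_inv_laplace [measurable]: "inv_laplace \<in> borel_measurable borel"
  unfolding inv_laplace_def by measurable

lemma powr_neg_half: "x > 0 \<Longrightarrow> (1 / sqrt x) ^ n = x powr (- (real n / 2))"
  by (simp add: powr_half_sqrt[symmetric] powr_minus_divide[symmetric] powr_powr flip: powr_realpow)

text \<open>Exchanging the integrals leaves half the integral of (\<kappa> + 5/4)^(-(d-1)/2) over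
  \<kappa> \<ge> 0. Two powers are kept to make this converge, with value 4/5; the others have
  exponent (d - 5)/2, nonnegative because d \<ge> 5, and are estimated at \<kappa> = 0.\<close>

lemma nn_integral_proj_sq_inv_laplace:
  assumes w: "w \<in> space (Rd d)" "dot d w w = 1" and d: "d \<ge> 5"
  shows "(\<integral>\<^sup>+g. ennreal (exp (- (proj_sq d w g / 8))) * inv_laplace (proj_sq d w g) \<partial>std_gaussian d)
    \<le> ennreal (2/5 * (4/5) powr ((real d - 5) / 2))"
proof -
  have [measurable]: "w \<in> space (Rd d)" "proj_sq d w \<in> borel_measurable (Rd d)" using w by auto
  interpret G: prob_space "std_gaussian d" by (rule prob_space_std_gaussian)
  interpret P: pair_sigma_finite lborel "std_gaussian d" ..
  have "(\<integral>\<^sup>+g. ennreal (exp (- (proj_sq d w g / 8))) * inv_laplace (proj_sq d w g) \<partial>std_gaussian d)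
     = (\<integral>\<^sup>+g. \<integral>\<^sup>+\<kappa>. ennreal (exp (- ((\<kappa> + 1/4) * proj_sq d w g / 2)) / 2) * indicator {0..} \<kappa> \<partial>lborel \<partial>std_gaussian d)"
  proof (rule nn_integral_cong)
    fix g
    let ?W = "proj_sq d w g"
    have "ennreal (exp (- (?W / 8))) * inv_laplace ?W =
      (\<integral>\<^sup>+\<kappa>. ennreal (exp (- (?W / 8))) * (ennreal (exp (- (\<kappa> * ?W / 2)) / 2) * indicator {0..} \<kappa>) \<partial>lborel)"
      unfolding inv_laplace_def by (rule nn_integral_cmult[symmetric]) measurable
    also have "\<dots> = (\<integral>\<^sup>+\<kappa>. ennreal (exp (- ((\<kappa> + 1/4) * ?W / 2)) / 2) * indicator {0..} \<kappa> \<partial>lborel)"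
    proof (rule nn_integral_cong)
      fix \<kappa> :: real
      have "exp (- (?W / 8)) * (exp (- (\<kappa> * ?W / 2)) / 2) = exp (- ((\<kappa> + 1/4) * ?W / 2)) / 2"
        by (simp add: exp_add[symmetric] field_simps)
      hence "ennreal (exp (- (?W / 8))) * ennreal (exp (- (\<kappa> * ?W / 2)) / 2) = ennreal (exp (- ((\<kappa> + 1/4) * ?W / 2)) / 2)"
        by (subst ennreal_mult[symmetric]) auto
      thus "ennreal (exp (- (?W / 8))) * (ennreal (exp (- (\<kappa> * ?W / 2)) / 2) * indicator {0..} \<kappa>)
          = ennreal (exp (- ((\<kappa> + 1/4) * ?W / 2)) / 2) * indicator {0..} \<kappa>"
        by (metis mult.assoc)
    qed
    finally show "ennreal (exp (- (?W / 8))) * inv_laplace ?W = \<dots>" .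
  qed
  also have "\<dots> = (\<integral>\<^sup>+\<kappa>. \<integral>\<^sup>+g. ennreal (exp (- ((\<kappa> + 1/4) * proj_sq d w g / 2)) / 2) * indicator {0..} \<kappa> \<partial>std_gaussian d \<partial>lborel)"
    by (intro P.Fubini') measurable
  also have "\<dots> \<le> (\<integral>\<^sup>+\<kappa>. ennreal (1/2 * (4/5) powr ((real d - 5) / 2)) * (ennreal (1 / (\<kappa> + 5/4)\<^sup>2) * indicator {0..} \<kappa>) \<partial>lborel)"
  proof (rule nn_integral_mono)
    fix \<kappa> :: real
    show "(\<integral>\<^sup>+g. ennreal (exp (- ((\<kappa> + 1/4) * proj_sq d w g / 2)) / 2) * indicator {0..} \<kappa> \<partial>std_gaussian d)
      \<le> ennreal (1/2 * (4/5) powr ((real d - 5) / 2)) * (ennreal (1 / (\<kappa> + 5/4)\<^sup>2) * indicator {0..} \<kappa>)"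
    proof (cases "\<kappa> \<ge> 0")
      case True
      have "(\<integral>\<^sup>+g. ennreal (exp (- ((\<kappa> + 1/4) * proj_sq d w g / 2)) / 2) * indicator {0..} \<kappa> \<partial>std_gaussian d)
         = (\<integral>\<^sup>+g. ennreal (1/2) * ennreal (exp (- ((\<kappa> + 1/4) * proj_sq d w g / 2))) \<partial>std_gaussian d)"
        using True by (intro nn_integral_cong, subst ennreal_mult[symmetric]) auto
      also have "\<dots> = ennreal (1/2) * ennreal ((1 / sqrt (1 + (\<kappa> + 1/4))) ^ (d - 1))"
        using w d True by (subst nn_integral_cmult) (auto simp: nn_integral_exp_neg_proj_sq)
      also have "\<dots> = ennreal (1/2 * (\<kappa> + 5/4) powr (- (real (d - 1) / 2)))"
        using True by (subst ennreal_mult[symmetric], simp, simp, subst powr_neg_half) (auto simp: add.commute)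
      also have "\<dots> \<le> ennreal (1/2 * (4/5) powr ((real d - 5) / 2) * (1 / (\<kappa> + 5/4)\<^sup>2))"
      proof (rule ennreal_leI)
        have "(\<kappa> + 5/4) powr (- (real (d - 1) / 2)) = (\<kappa> + 5/4) powr (- ((real d - 5) / 2) + - 2)"
          by (rule arg_cong[where f = "(powr) (\<kappa> + 5/4)"]) (use d in \<open>simp add: of_nat_diff field_simps\<close>)
        also have "\<dots> = (\<kappa> + 5/4) powr (- ((real d - 5) / 2)) * (1 / (\<kappa> + 5/4)\<^sup>2)"
          using True unfolding powr_add by (simp add: powr_minus_divide)
        also have "(\<kappa> + 5/4) powr (- ((real d - 5) / 2)) \<le> (5/4) powr (- ((real d - 5) / 2))"
          using True d by (intro powr_mono2') auto
        also have "(5/4::real) powr (- ((real d - 5) / 2)) = (4/5) powr ((real d - 5) / 2)"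
          by (simp add: powr_minus_divide powr_divide)
        finally show "1/2 * (\<kappa> + 5/4) powr (- (real (d - 1) / 2)) \<le> 1/2 * (4/5) powr ((real d - 5) / 2) * (1 / (\<kappa> + 5/4)\<^sup>2)"
          by (simp add: mult_right_mono divide_right_mono)
      qed
      also have "\<dots> = ennreal (1/2 * (4/5) powr ((real d - 5) / 2)) * (ennreal (1 / (\<kappa> + 5/4)\<^sup>2) * indicator {0..} \<kappa>)"
        using True by (subst ennreal_mult) auto
      finally show ?thesis .
    qed simp
  qed
  also have "\<dots> = ennreal (1/2 * (4/5) powr ((real d - 5) / 2)) * (\<integral>\<^sup>+\<kappa>. ennreal (1 / (\<kappa> + 5/4)\<^sup>2) * indicator {0..} \<kappa> \<partial>lborel)"
    by (rule nn_integral_cmult) measurable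
  also have "(\<integral>\<^sup>+\<kappa>. ennreal (1 / (\<kappa> + 5/4)\<^sup>2) * indicator {0::real..} \<kappa> \<partial>lborel) = ennreal (0 - (- (1 / (0 + 5/4))))"
  proof (rule nn_integral_FTC_atLeast)
    show "((\<lambda>\<kappa>::real. - (1 / (\<kappa> + 5/4))) \<longlongrightarrow> 0) at_top" by real_asymp
    fix x :: real assume "0 \<le> x"
    thus "((\<lambda>\<kappa>::real. - (1 / (\<kappa> + 5/4))) has_real_derivative 1 / (x + 5/4)\<^sup>2) (at x)"
      by (auto intro!: derivative_eq_intros simp: power2_eq_square)
  qed auto
  also have "ennreal (1/2 * (4/5) powr ((real d - 5) / 2)) * ennreal (0 - (- (1 / (0 + 5/4)))) = ennreal (2/5 * (4/5) powr ((real d - 5) / 2))"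
    by (simp flip: ennreal_mult)
  finally show ?thesis .
qed

text \<open>The correlation does not change under scaling, so the uniform vector may be replaced by
  a standard Gaussian one, whose parts along w and orthogonal to it are independent. The constants
  add up to 2 + 48 * 2/5 \<le> 25.\<close>

lemma nn_integral_correlation_tail:
  assumes w: "w \<in> space (Rd d)" "dot d w w = 1" and d: "d \<ge> 5" and b: "0 \<le> b" "b < 1"
  shows "(\<integral>\<^sup>+v. (if \<bar>dot d w v\<bar> > 1/2 then ennreal (1 / sqrt (1 - (b * dot d w v)\<^sup>2)) else 0) \<partial>unif_sphere d)
    \<le> ennreal (25 * (4/5) powr ((real d - 5) / 2))"
proof -
  have [measurable]: "w \<in> space (Rd d)" by fact
  have [measurable]: "proj_sq d w \<in> borel_measurable (Rd d)" using w by auto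
  interpret G: prob_space "std_gaussian d" by (rule prob_space_std_gaussian)
  define H where "H r = (if \<bar>r\<bar> > 1/2 then ennreal (1 / sqrt (1 - (b * r)\<^sup>2)) else 0)" for r :: real
  have [measurable]: "H \<in> borel_measurable borel" unfolding H_def by measurable
  have dn: "dot d w (nrm d x) = dot d w x / L2_set x {..<d}" for x
    unfolding sum_divide_distrib by (intro sum.cong) auto
  let ?e1 = "\<lambda>u::real. ennreal (exp (3 * u\<^sup>2 / 8))"
  let ?e2 = "\<lambda>g. ennreal (exp (- (proj_sq d w g / 8)))"
  have "(\<integral>\<^sup>+v. H (dot d w v) \<partial>unif_sphere d) = (\<integral>\<^sup>+x. 1 * H (dot d w x / L2_set x {..<d}) \<partial>std_gaussian d)"
    by (subst nn_integral_unif_sphere) (simp_all add: dn del: restrict_apply)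
  also have "\<dots> = (\<integral>\<^sup>+u. 1 * (\<integral>\<^sup>+g. H (dot d w (place d w u g) / L2_set (place d w u g) {..<d}) \<partial>std_gaussian d) \<partial>normal_law 0 1)"
    by (rule nn_integral_std_gaussian_split[OF w]) measurable
  also have "\<dots> = (\<integral>\<^sup>+u. \<integral>\<^sup>+g. H (u / sqrt (u\<^sup>2 + proj_sq d w g)) \<partial>std_gaussian d \<partial>normal_law 0 1)"
    by (simp add: dot_place[OF w(2)] L2_set_def sum_squares_place_proj[OF w(2)])
  also have "\<dots> \<le> (\<integral>\<^sup>+u. \<integral>\<^sup>+g. ?e1 u * ?e2 g + (?e1 u * ennreal (u\<^sup>2)) * (?e2 g * inv_laplace (proj_sq d w g)) \<partial>std_gaussian d \<partial>normal_law 0 1)"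
  proof (intro nn_integral_mono)
    fix u g
    show "H (u / sqrt (u\<^sup>2 + proj_sq d w g)) \<le> ?e1 u * ?e2 g + (?e1 u * ennreal (u\<^sup>2)) * (?e2 g * inv_laplace (proj_sq d w g))"
    proof (cases "\<bar>u / sqrt (u\<^sup>2 + proj_sq d w g)\<bar> > 1/2")
      case True
      have "H (u / sqrt (u\<^sup>2 + proj_sq d w g)) \<le> ?e1 u * ?e2 g * (1 + ennreal (u\<^sup>2) * inv_laplace (proj_sq d w g))"
        using inverse_sqrt_correlation_le[OF proj_sq_nonneg[of d w g] b True] True unfolding H_def by simp
      also have "\<dots> = ?e1 u * ?e2 g + (?e1 u * ennreal (u\<^sup>2)) * (?e2 g * inv_laplace (proj_sq d w g))"
        by (simp only: distrib_left distrib_right mult_ac mult_1_right mult_1_left)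
      finally show ?thesis .
    qed (simp add: H_def)
  qed
  also have "\<dots> = (\<integral>\<^sup>+u. ?e1 u \<partial>normal_law 0 1) * (\<integral>\<^sup>+g. ?e2 g \<partial>std_gaussian d)
      + (\<integral>\<^sup>+u. ?e1 u * ennreal (u\<^sup>2) \<partial>normal_law 0 1) * (\<integral>\<^sup>+g. ?e2 g * inv_laplace (proj_sq d w g) \<partial>std_gaussian d)"
    by (simp add: nn_integral_add nn_integral_cmult nn_integral_multc)
  also have "\<dots> \<le> ennreal 2 * ennreal ((4/5) powr ((real d - 5) / 2)) + ennreal 48 * ennreal (2/5 * (4/5) powr ((real d - 5) / 2))"
  proof (intro add_mono mult_mono)
    have "(\<integral>\<^sup>+u. ?e1 u \<partial>normal_law 0 1) = ennreal (1 / sqrt (1 + (-3/4)))"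
      using nn_integral_exp_neg_square_normal[of "-3/4"] by simp
    also have "sqrt (1 + (-3/4)) = sqrt ((1/2)\<^sup>2)" by (simp add: power2_eq_square)
    also have "\<dots> = 1/2" by (subst real_sqrt_abs) simp
    finally show "(\<integral>\<^sup>+u. ?e1 u \<partial>normal_law 0 1) \<le> ennreal 2" by simp
    have "(\<integral>\<^sup>+g. ?e2 g \<partial>std_gaussian d) = ennreal ((1 / sqrt (1 + 1/4)) ^ (d - 1))"
      using nn_integral_exp_neg_proj_sq[OF w, of "1/4"] d by simp
    also have "(1 / sqrt (1 + 1/4)) ^ (d - 1) = (5/4) powr (- (real (d - 1) / 2))"
      by (subst powr_neg_half) auto
    also have "\<dots> = (4/5) powr (real (d - 1) / 2)"
      by (simp add: powr_minus_divide powr_divide)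
    also have "\<dots> \<le> (4/5) powr ((real d - 5) / 2)" using d by (intro powr_mono') (auto simp: of_nat_diff)
    finally show "(\<integral>\<^sup>+g. ?e2 g \<partial>std_gaussian d) \<le> ennreal ((4/5) powr ((real d - 5) / 2))"
      by (simp add: ennreal_leI)
    have "(\<integral>\<^sup>+u. ?e1 u * ennreal (u\<^sup>2) \<partial>normal_law 0 1) \<le> (\<integral>\<^sup>+u. ennreal 16 * ennreal (exp (- ((-7/8) * u\<^sup>2 / 2))) \<partial>normal_law 0 1)"
    proof (rule nn_integral_mono)
      fix u :: real
      \<comment> \<open>The factor u^2 is absorbed by exp(u^2/16): the total rate 3/8 + 1/16 = 7/16
        stays below the Gaussian rate 1/2. The resulting moment is 16 * sqrt 8 \<le> 48.\<close>
      have "u\<^sup>2 / 16 \<le> exp (u\<^sup>2 / 16)" using exp_ge_add_one_self[of "u\<^sup>2 / 16"] by linarith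
      hence "exp (3 * u\<^sup>2 / 8) * u\<^sup>2 \<le> exp (3 * u\<^sup>2 / 8) * (16 * exp (u\<^sup>2 / 16))"
        by (intro mult_left_mono) auto
      also have "\<dots> = 16 * exp (- ((-7/8) * u\<^sup>2 / 2))" by (simp flip: exp_add)
      finally show "?e1 u * ennreal (u\<^sup>2) \<le> ennreal 16 * ennreal (exp (- ((-7/8) * u\<^sup>2 / 2)))"
        by (subst (1 2) ennreal_mult[symmetric]) (auto intro: ennreal_leI)
    qed
    also have "\<dots> = ennreal 16 * ennreal (1 / sqrt (1 + (-7/8)))"
      using nn_integral_exp_neg_square_normal[of "-7/8"] by (subst nn_integral_cmult) auto
    also have "\<dots> = ennreal (16 * (1 / sqrt (1 + (-7/8))))" by (rule ennreal_mult[symmetric]) auto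
    also have "\<dots> \<le> ennreal (16 * (1 / sqrt ((1/3)\<^sup>2)))"
      by (intro ennreal_leI mult_left_mono divide_left_mono real_sqrt_le_mono mult_pos_pos) (auto simp: power2_eq_square)
    also have "\<dots> = ennreal 48" by simp
    finally show "(\<integral>\<^sup>+u. ?e1 u * ennreal (u\<^sup>2) \<partial>normal_law 0 1) \<le> ennreal 48" .
  qed (use nn_integral_proj_sq_inv_laplace[OF w d] in auto)
  also have "\<dots> = ennreal ((2 + 48 * (2/5)) * (4/5) powr ((real d - 5) / 2))"
    by (simp add: ennreal_mult[symmetric] ennreal_plus[symmetric] algebra_simps del: ennreal_plus ennreal_numeral)
  also have "\<dots> \<le> ennreal (25 * (4/5) powr ((real d - 5) / 2))"
    by (intro ennreal_leI mult_right_mono) auto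
  finally show ?thesis unfolding H_def .
qed

section \<open>Duality\<close>

lemma integrable_mult_squares:
  fixes u v :: "'a \<Rightarrow> real"
  assumes [measurable]: "u \<in> borel_measurable M" "v \<in> borel_measurable M"
    and "integrable M (\<lambda>x. (u x)\<^sup>2)" "integrable M (\<lambda>x. (v x)\<^sup>2)"
  shows "integrable M (\<lambda>x. u x * v x)"
proof (rule Bochner_Integration.integrable_bound)
  show "integrable M (\<lambda>x. (u x)\<^sup>2 + (v x)\<^sup>2)" using assms by simp
  have "\<bar>a * b\<bar> \<le> \<bar>a\<^sup>2 + b\<^sup>2\<bar>" for a b :: real
  proof -
    have "2 * (\<bar>a\<bar> * \<bar>b\<bar>) \<le> a\<^sup>2 + b\<^sup>2" using sum_squares_bound[of "\<bar>a\<bar>" "\<bar>b\<bar>"] by simp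
    moreover have "0 \<le> \<bar>a\<bar> * \<bar>b\<bar>" by simp
    ultimately show ?thesis unfolding abs_mult by linarith
  qed
  thus "AE x in M. norm (u x * v x) \<le> norm ((u x)\<^sup>2 + (v x)\<^sup>2)" by simp
qed simp

text \<open>The variance is nonnegative.\<close>

lemma (in prob_space) square_expectation_le:
  fixes g :: "'a \<Rightarrow> real"
  assumes [measurable]: "g \<in> borel_measurable M" and g2: "integrable M (\<lambda>x. (g x)\<^sup>2)"
  shows "(\<integral>x. g x \<partial>M)\<^sup>2 \<le> (\<integral>x. (g x)\<^sup>2 \<partial>M)"
proof -
  have g: "integrable M g" using integrable_mult_squares[of g M "\<lambda>_. 1"] g2 by simp
  define m where "m = (\<integral>x. g x \<partial>M)"
  have "0 \<le> (\<integral>x. (g x - m)\<^sup>2 \<partial>M)" by (intro integral_nonneg_AE) auto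
  also have "\<dots> = (\<integral>x. (g x)\<^sup>2 - 2 * m * g x + m\<^sup>2 \<partial>M)"
    by (intro Bochner_Integration.integral_cong) (auto simp: power2_eq_square algebra_simps)
  also have "\<dots> = (\<integral>x. (g x)\<^sup>2 \<partial>M) - 2 * m * m + m\<^sup>2"
    using g g2 by (simp add: m_def prob_space)
  finally show ?thesis by (simp add: m_def power2_eq_square)
qed

text \<open>
  With \<open>Y x = E\<^sub>\<omega> \<psi>(\<omega>) k(\<omega>, x)\<close>, the left-hand side is \<open>E f Y\<close>, hence at most the square root of
  \<open>E Y\<^sup>2\<close>, which expands to a double average over \<open>\<omega>, \<omega>'\<close>.
\<close>

lemma duality_bound:
  fixes k :: "'a \<Rightarrow> 'b \<Rightarrow> real" and \<psi> :: "'a \<Rightarrow> real" and f :: "'b \<Rightarrow> real"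
  assumes W: "prob_space W" and X: "prob_space X"
    and k[measurable]: "(\<lambda>(\<omega>, x). k \<omega> x) \<in> borel_measurable (W \<Otimes>\<^sub>M X)"
    and [measurable]: "\<psi> \<in> borel_measurable W" "f \<in> borel_measurable X"
    and \<psi>: "\<And>\<omega>. \<bar>\<psi> \<omega>\<bar> \<le> 1" and f: "\<And>x. x \<in> space X \<Longrightarrow> \<bar>f x\<bar> \<le> 1"
    and k2: "integrable (W \<Otimes>\<^sub>M X) (\<lambda>(\<omega>, x). (k \<omega> x)\<^sup>2)"
    and J: "(\<integral>\<^sup>+\<omega>. \<integral>\<^sup>+\<omega>'. ennreal \<bar>\<integral>x. k \<omega> x * k \<omega>' x \<partial>X\<bar> \<partial>W \<partial>W) \<le> ennreal J" "J \<ge> 0"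
  shows "\<bar>\<integral>\<omega>. \<psi> \<omega> * (\<integral>x. f x * k \<omega> x \<partial>X) \<partial>W\<bar> \<le> sqrt J"
proof -
  interpret W: prob_space W by fact
  interpret X: prob_space X by fact
  interpret P: pair_prob_space W X ..
  define Y where "Y x = (\<integral>\<omega>. \<psi> \<omega> * k \<omega> x \<partial>W)" for x
  have [measurable]: "Y \<in> borel_measurable X" unfolding Y_def by measurable
  have k2': "integrable (W \<Otimes>\<^sub>M X) (\<lambda>z. (k (fst z) (snd z))\<^sup>2)" using k2 by (simp add: split_beta')
  have s\<psi>: "(\<psi> \<omega> * c)\<^sup>2 \<le> c\<^sup>2" for \<omega> c
    using \<psi>[of \<omega>] by (simp add: power_mult_distrib mult_left_le_one_le power_le_one abs_square_le_1)
  have pk2: "integrable (W \<Otimes>\<^sub>M X) (\<lambda>z. (\<psi> (fst z) * k (fst z) (snd z))\<^sup>2)"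
    by (rule Bochner_Integration.integrable_bound[OF k2']) (use s\<psi> in auto)
  have f2: "integrable (W \<Otimes>\<^sub>M X) (\<lambda>z. (f (snd z))\<^sup>2)"
    using f by (intro P.P.integrable_const_bound[where B = 1]) (auto simp: space_pair_measure abs_square_le_1)
  have slice: "AE x in X. integrable W (\<lambda>\<omega>. (k \<omega> x)\<^sup>2)"
    using P.AE_integrable_snd[OF k2] by simp
  have slice': "AE \<omega> in W. integrable X (\<lambda>x. (k \<omega> x)\<^sup>2)"
    using P.AE_integrable_fst'[OF k2'] by simp
  have ik2: "integrable X (\<lambda>x. \<integral>\<omega>. (k \<omega> x)\<^sup>2 \<partial>W)" by (rule P.integrable_snd[OF k2])
  have Y2: "integrable X (\<lambda>x. (Y x)\<^sup>2)"
  proof (rule Bochner_Integration.integrable_bound[OF ik2])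
    show "AE x in X. norm ((Y x)\<^sup>2) \<le> norm (\<integral>\<omega>. (k \<omega> x)\<^sup>2 \<partial>W)"
      using slice AE_space
    proof eventually_elim
      case (elim x)
      hence [measurable]: "x \<in> space X" by simp
      have i: "integrable W (\<lambda>\<omega>. (\<psi> \<omega> * k \<omega> x)\<^sup>2)"
        by (rule Bochner_Integration.integrable_bound[OF elim(1)]) (use s\<psi> in auto)
      have "(Y x)\<^sup>2 \<le> (\<integral>\<omega>. (\<psi> \<omega> * k \<omega> x)\<^sup>2 \<partial>W)"
        unfolding Y_def by (rule W.square_expectation_le[OF _ i]) measurable
      also have "\<dots> \<le> (\<integral>\<omega>. (k \<omega> x)\<^sup>2 \<partial>W)"
        using i elim s\<psi> by (intro integral_mono) auto
      finally show ?case by simp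
    qed
  qed measurable
  have Y2': "integrable (W \<Otimes>\<^sub>M X) (\<lambda>z. (Y (snd z))\<^sup>2)"
  proof -
    have "integrable (W \<Otimes>\<^sub>M X) (\<lambda>(\<omega>, x). (Y x)\<^sup>2)"
      using Y2 by (intro P.Fubini_integrable) (auto simp: W.prob_space)
    thus ?thesis by (simp add: split_beta')
  qed
  have 1: "(\<integral>\<omega>. \<psi> \<omega> * (\<integral>x. f x * k \<omega> x \<partial>X) \<partial>W) = (\<integral>x. f x * Y x \<partial>X)"
  proof -
    have "integrable (W \<Otimes>\<^sub>M X) (\<lambda>z. (\<psi> (fst z) * k (fst z) (snd z)) * f (snd z))"
      by (rule integrable_mult_squares[OF _ _ pk2 f2]) measurable
    hence "(\<integral>x. \<integral>\<omega>. \<psi> \<omega> * k \<omega> x * f x \<partial>W \<partial>X) = (\<integral>\<omega>. \<integral>x. \<psi> \<omega> * k \<omega> x * f x \<partial>X \<partial>W)"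
      by (intro P.Fubini_integral) (simp add: split_beta')
    moreover have "(\<integral>\<omega>. \<psi> \<omega> * k \<omega> x * f x \<partial>W) = f x * Y x" for x
      unfolding Y_def integral_mult_left_zero by (rule mult.commute)
    moreover have "(\<integral>x. \<psi> \<omega> * k \<omega> x * f x \<partial>X) = \<psi> \<omega> * (\<integral>x. f x * k \<omega> x \<partial>X)" for \<omega>
      unfolding mult.assoc integral_mult_right_zero by (simp only: mult.commute)
    ultimately show ?thesis by (simp only:)
  qed
  have fY: "(f x * Y x)\<^sup>2 \<le> (Y x)\<^sup>2" if "x \<in> space X" for x
    using f[OF that] by (simp add: power_mult_distrib mult_left_le_one_le power_le_one abs_square_le_1)
  have ifY: "integrable X (\<lambda>x. (f x * Y x)\<^sup>2)"
    by (rule Bochner_Integration.integrable_bound[OF Y2]) (use fY in auto)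
  have 2: "(\<integral>x. f x * Y x \<partial>X)\<^sup>2 \<le> (\<integral>x. (Y x)\<^sup>2 \<partial>X)"
  proof -
    have "(\<integral>x. f x * Y x \<partial>X)\<^sup>2 \<le> (\<integral>x. (f x * Y x)\<^sup>2 \<partial>X)"
      by (rule X.square_expectation_le[OF _ ifY]) measurable
    also have "\<dots> \<le> (\<integral>x. (Y x)\<^sup>2 \<partial>X)" using ifY Y2 fY by (intro integral_mono) auto
    finally show ?thesis .
  qed
  have 3: "(\<integral>x. (Y x)\<^sup>2 \<partial>X) = (\<integral>\<omega>. \<psi> \<omega> * (\<integral>x. k \<omega> x * Y x \<partial>X) \<partial>W)"
  proof -
    have "integrable (W \<Otimes>\<^sub>M X) (\<lambda>z. (\<psi> (fst z) * k (fst z) (snd z)) * Y (snd z))"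
      by (rule integrable_mult_squares[OF _ _ pk2 Y2']) measurable
    hence "(\<integral>x. \<integral>\<omega>. \<psi> \<omega> * k \<omega> x * Y x \<partial>W \<partial>X) = (\<integral>\<omega>. \<integral>x. \<psi> \<omega> * k \<omega> x * Y x \<partial>X \<partial>W)"
      by (intro P.Fubini_integral) (simp add: split_beta')
    moreover have "(\<integral>\<omega>. \<psi> \<omega> * k \<omega> x * Y x \<partial>W) = (Y x)\<^sup>2" for x
      by (simp add: power2_eq_square) (simp add: Y_def)
    ultimately show ?thesis by (simp add: mult.assoc)
  qed
  \<comment> \<open>Only almost every \<omega> has a square-integrable slice, and this is what the
    exchange of the integrals over x and \<omega>' requires.\<close>
  have 4: "AE \<omega> in W. (\<integral>x. k \<omega> x * Y x \<partial>X) = (\<integral>\<omega>'. \<psi> \<omega>' * (\<integral>x. k \<omega> x * k \<omega>' x \<partial>X) \<partial>W)"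
    using slice' AE_space
  proof eventually_elim
    case (elim \<omega>)
    hence [measurable]: "\<omega> \<in> space W" by simp
    have kk: "integrable (W \<Otimes>\<^sub>M X) (\<lambda>z. (k \<omega> (snd z))\<^sup>2)"
    proof -
      have "integrable (W \<Otimes>\<^sub>M X) (\<lambda>(\<omega>', x). (k \<omega> x)\<^sup>2)"
        using elim by (intro P.Fubini_integrable) (auto simp: W.prob_space)
      thus ?thesis by (simp add: split_beta')
    qed
    have "integrable (W \<Otimes>\<^sub>M X) (\<lambda>z. (\<psi> (fst z) * k (fst z) (snd z)) * k \<omega> (snd z))"
      by (rule integrable_mult_squares[OF _ _ pk2 kk]) measurable
    hence "(\<integral>x. \<integral>\<omega>'. \<psi> \<omega>' * k \<omega>' x * k \<omega> x \<partial>W \<partial>X) = (\<integral>\<omega>'. \<integral>x. \<psi> \<omega>' * k \<omega>' x * k \<omega> x \<partial>X \<partial>W)"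
      by (intro P.Fubini_integral) (simp add: split_beta')
    moreover have "(\<integral>\<omega>'. \<psi> \<omega>' * k \<omega>' x * k \<omega> x \<partial>W) = k \<omega> x * Y x" for x
      unfolding Y_def integral_mult_left_zero by (rule mult.commute)
    moreover have "(\<integral>x. \<psi> \<omega>' * k \<omega>' x * k \<omega> x \<partial>X) = \<psi> \<omega>' * (\<integral>x. k \<omega> x * k \<omega>' x \<partial>X)" for \<omega>'
      unfolding mult.assoc integral_mult_right_zero by (simp only: mult.commute)
    ultimately show ?case by (simp only:)
  qed
  have "ennreal (\<integral>x. (Y x)\<^sup>2 \<partial>X) \<le> ennreal \<bar>\<integral>\<omega>. \<psi> \<omega> * (\<integral>x. k \<omega> x * Y x \<partial>X) \<partial>W\<bar>"
    unfolding 3 by (intro ennreal_leI) simp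
  \<comment> \<open>If the integrand is not integrable, the integral on the left is 0 by convention
    and the bound is trivial.\<close>
  also have "\<dots> \<le> (\<integral>\<^sup>+\<omega>. ennreal \<bar>\<psi> \<omega> * (\<integral>x. k \<omega> x * Y x \<partial>X)\<bar> \<partial>W)"
    using integral_norm_bound_ennreal[of W "\<lambda>\<omega>. \<psi> \<omega> * (\<integral>x. k \<omega> x * Y x \<partial>X)"]
    by (cases "integrable W (\<lambda>\<omega>. \<psi> \<omega> * (\<integral>x. k \<omega> x * Y x \<partial>X))") (auto simp: not_integrable_integral_eq)
  also have "\<dots> \<le> (\<integral>\<^sup>+\<omega>. \<integral>\<^sup>+\<omega>'. ennreal \<bar>\<integral>x. k \<omega> x * k \<omega>' x \<partial>X\<bar> \<partial>W \<partial>W)"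
  proof (rule nn_integral_mono_AE)
    show "AE \<omega> in W. ennreal \<bar>\<psi> \<omega> * (\<integral>x. k \<omega> x * Y x \<partial>X)\<bar> \<le> (\<integral>\<^sup>+\<omega>'. ennreal \<bar>\<integral>x. k \<omega> x * k \<omega>' x \<partial>X\<bar> \<partial>W)"
      using 4
    proof eventually_elim
      case (elim \<omega>)
      let ?g = "\<lambda>\<omega>'. \<psi> \<omega>' * (\<integral>x. k \<omega> x * k \<omega>' x \<partial>X)"
      have b: "\<bar>\<psi> \<omega> * c\<bar> \<le> \<bar>c\<bar>" for \<omega> c using \<psi>[of \<omega>] by (simp add: abs_mult mult_left_le_one_le)
      have "ennreal \<bar>\<psi> \<omega> * (\<integral>x. k \<omega> x * Y x \<partial>X)\<bar> \<le> ennreal \<bar>\<integral>\<omega>'. ?g \<omega>' \<partial>W\<bar>"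
        unfolding elim by (intro ennreal_leI b)
      also have "\<dots> \<le> (\<integral>\<^sup>+\<omega>'. ennreal \<bar>?g \<omega>'\<bar> \<partial>W)"
        using integral_norm_bound_ennreal[of W ?g]
        by (cases "integrable W ?g") (auto simp: not_integrable_integral_eq)
      also have "\<dots> \<le> (\<integral>\<^sup>+\<omega>'. ennreal \<bar>\<integral>x. k \<omega> x * k \<omega>' x \<partial>X\<bar> \<partial>W)"
        by (intro nn_integral_mono ennreal_leI b)
      finally show ?case .
    qed
  qed
  also note J(1)
  finally have "(\<integral>x. (Y x)\<^sup>2 \<partial>X) \<le> J" using J(2) by (simp add: ennreal_le_iff)
  with 2 have "(\<integral>x. f x * Y x \<partial>X)\<^sup>2 \<le> J" by linarith
  thus ?thesis unfolding 1 by (metis real_sqrt_abs real_sqrt_le_iff)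
qed

section \<open>Smoothed densities and their correlations\<close>

abbreviation Diff :: "real measure \<Rightarrow> real measure \<Rightarrow> (real \<Rightarrow> real) \<Rightarrow> real" where
  "Diff A B h \<equiv> (\<integral>t. h t \<partial>A) - (\<integral>t. h t \<partial>B)"

text \<open>The quadratic form of the kernel at the signed measure A - B, written as an iterated
  difference of integrals.\<close>

definition corr_kernel :: "real measure \<Rightarrow> real measure \<Rightarrow> real \<Rightarrow> real" where
  "corr_kernel A B b = Diff A B (\<lambda>t. Diff A B (\<lambda>t'. mehler b t t'))"

text \<open>The exponent is u^2/2 minus a square. In contrast to \<open>mehler_le\<close> the bound
  does not involve t, so for fixed u the kernel is integrable in t against every probability
  measure.\<close>

lemma mehler_le_exp:
  assumes "b\<^sup>2 < 1" shows "mehler b u t \<le> exp (u\<^sup>2 / 2) / sqrt (1 - b\<^sup>2)"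
proof -
  have "- (b\<^sup>2 * u\<^sup>2 + b\<^sup>2 * t\<^sup>2 - 2 * b * u * t) = u\<^sup>2 * (1 - b\<^sup>2) - (b * t - u)\<^sup>2"
    by (simp add: power2_eq_square algebra_simps)
  also have "\<dots> \<le> u\<^sup>2 * (1 - b\<^sup>2)" by simp
  also have "\<dots> = u\<^sup>2 / 2 * (2 * (1 - b\<^sup>2))" by simp
  finally have "- (b\<^sup>2 * u\<^sup>2 + b\<^sup>2 * t\<^sup>2 - 2 * b * u * t) / (2 * (1 - b\<^sup>2)) \<le> u\<^sup>2 / 2"
    using assms by (subst pos_divide_le_eq) auto
  thus ?thesis unfolding mehler_def using assms by (intro divide_right_mono) auto
qed

lemma integrable_mehler:
  assumes "prob_space A" and [measurable_cong]: "sets A = sets borel" and b: "b\<^sup>2 < 1"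
  shows "integrable A (\<lambda>t. mehler b u t)"
proof -
  interpret prob_space A by fact
  show ?thesis using mehler_le_exp[OF b, of u] mehler_nonneg[OF b, of u]
    by (intro integrable_const_bound[where B = "exp (u\<^sup>2 / 2) / sqrt (1 - b\<^sup>2)"]) auto
qed

lemma ennreal_integral_mehler:
  assumes "prob_space A" and "sets A = sets borel" and b: "b\<^sup>2 < 1"
  shows "(\<integral>\<^sup>+t. ennreal (mehler b u t) \<partial>A) = ennreal (\<integral>t. mehler b u t \<partial>A)"
  using integrable_mehler[OF assms] mehler_nonneg[OF b] by (intro nn_integral_eq_integral) auto

lemma integral_mehler_nonneg: "b\<^sup>2 < 1 \<Longrightarrow> 0 \<le> (\<integral>t. mehler b u t \<partial>A)"
  by (intro integral_nonneg_AE) (auto simp: mehler_nonneg)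

text \<open>The bound \<open>mehler_le\<close> factorises over t and t', so each variable
  contributes one exponential moment; b enters only through the singular factor.\<close>

lemma mehler_double_integral:
  assumes A: "prob_space A" "sets A = sets borel" and B: "prob_space B" "sets B = sets borel"
    and GA: "(\<integral>\<^sup>+t. ennreal (exp (t\<^sup>2 / 4)) \<partial>A) \<le> ennreal G" and GB: "(\<integral>\<^sup>+t. ennreal (exp (t\<^sup>2 / 4)) \<partial>B) \<le> ennreal G"
    and G: "G \<ge> 0" and b: "b\<^sup>2 < 1"
  shows "integrable A (\<lambda>t. \<integral>t'. mehler b t t' \<partial>B)"
    "(\<integral>\<^sup>+t. \<integral>\<^sup>+t'. ennreal (mehler b t t') \<partial>B \<partial>A) = ennreal (\<integral>t. \<integral>t'. mehler b t t' \<partial>B \<partial>A)"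
    "(\<integral>t. \<integral>t'. mehler b t t' \<partial>B \<partial>A) \<le> G\<^sup>2 / sqrt (1 - b\<^sup>2)"
proof -
  interpret A: prob_space A by fact
  interpret B: prob_space B by fact
  have [measurable_cong]: "sets A = sets borel" "sets B = sets borel" by fact+
  have "(\<integral>\<^sup>+t. \<integral>\<^sup>+t'. ennreal (mehler b t t') \<partial>B \<partial>A)
    \<le> (\<integral>\<^sup>+t. \<integral>\<^sup>+t'. ennreal (1 / sqrt (1 - b\<^sup>2)) * (ennreal (exp (t\<^sup>2 / 4)) * ennreal (exp (t'\<^sup>2 / 4))) \<partial>B \<partial>A)"
    using mehler_le[OF b] b by (intro nn_integral_mono) (auto simp: ennreal_mult[symmetric] intro!: ennreal_leI)
  also have "\<dots> = ennreal (1 / sqrt (1 - b\<^sup>2)) * ((\<integral>\<^sup>+t. ennreal (exp (t\<^sup>2 / 4)) \<partial>A) * (\<integral>\<^sup>+t. ennreal (exp (t\<^sup>2 / 4)) \<partial>B))"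
    by (simp add: nn_integral_cmult nn_integral_multc)
  also have "\<dots> \<le> ennreal (1 / sqrt (1 - b\<^sup>2)) * (ennreal G * ennreal G)"
    using GA GB by (intro mult_left_mono mult_mono) auto
  also have "\<dots> = ennreal (G\<^sup>2 / sqrt (1 - b\<^sup>2))"
    using G b by (simp add: ennreal_mult[symmetric] power2_eq_square)
  finally have le: "(\<integral>\<^sup>+t. \<integral>\<^sup>+t'. ennreal (mehler b t t') \<partial>B \<partial>A) \<le> ennreal (G\<^sup>2 / sqrt (1 - b\<^sup>2))" .
  have eq: "(\<integral>\<^sup>+t. \<integral>\<^sup>+t'. ennreal (mehler b t t') \<partial>B \<partial>A) = (\<integral>\<^sup>+t. ennreal (\<integral>t'. mehler b t t' \<partial>B) \<partial>A)"
    by (simp add: ennreal_integral_mehler[OF B b])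
  show int: "integrable A (\<lambda>t. \<integral>t'. mehler b t t' \<partial>B)"
  proof (rule integrableI_nonneg)
    show "(\<integral>\<^sup>+t. ennreal (\<integral>t'. mehler b t t' \<partial>B) \<partial>A) < \<infinity>"
      using le unfolding eq by (rule le_less_trans) simp
  qed (auto simp: integral_mehler_nonneg[OF b])
  show eq2: "(\<integral>\<^sup>+t. \<integral>\<^sup>+t'. ennreal (mehler b t t') \<partial>B \<partial>A) = ennreal (\<integral>t. \<integral>t'. mehler b t t' \<partial>B \<partial>A)"
    unfolding eq by (rule nn_integral_eq_integral[OF int]) (auto simp: integral_mehler_nonneg[OF b])
  show "(\<integral>t. \<integral>t'. mehler b t t' \<partial>B \<partial>A) \<le> G\<^sup>2 / sqrt (1 - b\<^sup>2)"
    using le b unfolding eq2 by (subst (asm) ennreal_le_iff) auto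
qed

text \<open>The averages over t are the densities, relative to the standard Gaussian, of the
  smoothed laws with hidden directions v and w. Their inner product is computed by Tonelli and
  \<open>nn_integral_mehler_mehler\<close>.\<close>

lemma mehler_pair_integral:
  assumes A: "prob_space A" "sets A = sets borel" and B: "prob_space B" "sets B = sets borel"
    and GA: "(\<integral>\<^sup>+t. ennreal (exp (t\<^sup>2 / 4)) \<partial>A) \<le> ennreal G" and GB: "(\<integral>\<^sup>+t. ennreal (exp (t\<^sup>2 / 4)) \<partial>B) \<le> ennreal G"
    and G: "G \<ge> 0" and a: "a\<^sup>2 < 1"
    and v: "v \<in> space (Rd d)" "dot d v v = 1" and w: "w \<in> space (Rd d)" "dot d w w = 1"
  shows "integrable (std_gaussian d) (\<lambda>x. (\<integral>t. mehler a (dot d v x) t \<partial>A) * (\<integral>t. mehler a (dot d w x) t \<partial>B))"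
    "(\<integral>x. (\<integral>t. mehler a (dot d v x) t \<partial>A) * (\<integral>t. mehler a (dot d w x) t \<partial>B) \<partial>std_gaussian d)
      = (\<integral>t. \<integral>t'. mehler (a\<^sup>2 * dot d v w) t t' \<partial>B \<partial>A)"
proof -
  interpret A: prob_space A by fact
  interpret B: prob_space B by fact
  interpret X: prob_space "std_gaussian d" by (rule prob_space_std_gaussian)
  interpret PA: pair_sigma_finite "std_gaussian d" A ..
  interpret PB: pair_sigma_finite "std_gaussian d" B ..
  have [measurable_cong]: "sets A = sets borel" "sets B = sets borel" by fact+
  have [measurable]: "v \<in> space (Rd d)" "w \<in> space (Rd d)" by fact+
  have b: "(a\<^sup>2 * dot d v w)\<^sup>2 < 1" by (rule scaled_dot_square_less_1[OF v(2) w(2) a])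
  let ?F = "\<lambda>x. (\<integral>t. mehler a (dot d v x) t \<partial>A) * (\<integral>t. mehler a (dot d w x) t \<partial>B)"
  have nn: "0 \<le> ?F x" for x by (intro mult_nonneg_nonneg integral_mehler_nonneg a)
  have "(\<integral>\<^sup>+x. ennreal (?F x) \<partial>std_gaussian d)
    = (\<integral>\<^sup>+x. (\<integral>\<^sup>+t. ennreal (mehler a (dot d v x) t) \<partial>A) * (\<integral>\<^sup>+t'. ennreal (mehler a (dot d w x) t') \<partial>B) \<partial>std_gaussian d)"
    by (simp add: ennreal_integral_mehler[OF A a] ennreal_integral_mehler[OF B a] ennreal_mult' integral_mehler_nonneg[OF a])
  also have "\<dots> = (\<integral>\<^sup>+x. \<integral>\<^sup>+t. ennreal (mehler a (dot d v x) t) * (\<integral>\<^sup>+t'. ennreal (mehler a (dot d w x) t') \<partial>B) \<partial>A \<partial>std_gaussian d)"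
    by (intro nn_integral_cong nn_integral_multc[symmetric]) measurable
  also have "\<dots> = (\<integral>\<^sup>+t. \<integral>\<^sup>+x. ennreal (mehler a (dot d v x) t) * (\<integral>\<^sup>+t'. ennreal (mehler a (dot d w x) t') \<partial>B) \<partial>std_gaussian d \<partial>A)"
    by (rule PA.Fubini'[symmetric]) measurable
  also have "\<dots> = (\<integral>\<^sup>+t. \<integral>\<^sup>+x. \<integral>\<^sup>+t'. ennreal (mehler a (dot d v x) t) * ennreal (mehler a (dot d w x) t') \<partial>B \<partial>std_gaussian d \<partial>A)"
    by (intro nn_integral_cong nn_integral_cmult[symmetric]) measurable
  also have "\<dots> = (\<integral>\<^sup>+t. \<integral>\<^sup>+t'. \<integral>\<^sup>+x. ennreal (mehler a (dot d v x) t) * ennreal (mehler a (dot d w x) t') \<partial>std_gaussian d \<partial>B \<partial>A)"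
    by (rule nn_integral_cong, rule PB.Fubini'[symmetric]) measurable
  also have "\<dots> = (\<integral>\<^sup>+t. \<integral>\<^sup>+t'. ennreal (mehler (a\<^sup>2 * dot d v w) t t') \<partial>B \<partial>A)"
    by (simp only: nn_integral_mehler_mehler[OF v w a])
  also have "\<dots> = ennreal (\<integral>t. \<integral>t'. mehler (a\<^sup>2 * dot d v w) t t' \<partial>B \<partial>A)"
    by (rule mehler_double_integral(2)[OF A B GA GB G b])
  finally have eq: "(\<integral>\<^sup>+x. ennreal (?F x) \<partial>std_gaussian d) = ennreal (\<integral>t. \<integral>t'. mehler (a\<^sup>2 * dot d v w) t t' \<partial>B \<partial>A)" .
  show int: "integrable (std_gaussian d) ?F"
    by (rule integrableI_nonneg) (use nn in \<open>auto simp: eq\<close>)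
  have "(\<integral>x. ?F x \<partial>std_gaussian d) = enn2real (\<integral>\<^sup>+x. ennreal (?F x) \<partial>std_gaussian d)"
    using nn by (intro integral_eq_nn_integral) auto
  thus "(\<integral>x. ?F x \<partial>std_gaussian d) = (\<integral>t. \<integral>t'. mehler (a\<^sup>2 * dot d v w) t t' \<partial>B \<partial>A)"
    unfolding eq using integral_mehler_nonneg[OF b] by (simp add: integral_nonneg_AE)
qed

text \<open>The conditional mean of f given that the hidden coordinate equals t; its integral over t
  with respect to H is the mean of f under \<open>hidden_dir d v H\<close>.\<close>

definition dirE :: "nat \<Rightarrow> ((nat \<Rightarrow> real) \<Rightarrow> real) \<Rightarrow> (nat \<Rightarrow> real) \<Rightarrow> real \<Rightarrow> real" where
  "dirE d f v t = (\<integral>g. f (place d v t g) \<partial>std_gaussian d)"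

text \<open>The mean in direction \<open>v\<close> after one Ornstein--Uhlenbeck step of the hidden coordinate.\<close>

definition smE :: "nat \<Rightarrow> ((nat \<Rightarrow> real) \<Rightarrow> real) \<Rightarrow> real \<Rightarrow> (nat \<Rightarrow> real) \<Rightarrow> real \<Rightarrow> real" where
  "smE d f a v t = (\<integral>z. dirE d f v (a * t + sqrt (1 - a\<^sup>2) * z) \<partial>normal_law 0 1)"

lemma dirE_measurable [measurable (raw)]:
  assumes [measurable]: "f \<in> borel_measurable (Rd d)" "v \<in> M \<rightarrow>\<^sub>M Rd d" "t \<in> borel_measurable M"
  shows "(\<lambda>x. dirE d f (v x) (t x)) \<in> borel_measurable M"
proof -
  interpret sigma_finite_measure "std_gaussian d" by (intro prob_space_imp_sigma_finite prob_space_std_gaussian)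
  show ?thesis unfolding dirE_def by measurable
qed

lemma smE_measurable [measurable (raw)]:
  assumes [measurable]: "f \<in> borel_measurable (Rd d)" "v \<in> M \<rightarrow>\<^sub>M Rd d" "t \<in> borel_measurable M"
  shows "(\<lambda>x. smE d f a (v x) (t x)) \<in> borel_measurable M"
proof -
  interpret sigma_finite_measure "normal_law 0 1" by (intro prob_space_imp_sigma_finite prob_space_normal_law) auto
  show ?thesis unfolding smE_def by measurable
qed

lemma (in prob_space) expectation_in_unit:
  assumes [measurable]: "g \<in> borel_measurable M" and g: "\<And>x. x \<in> space M \<Longrightarrow> 0 \<le> g x \<and> g x \<le> (1::real)"
  shows "0 \<le> expectation g" "expectation g \<le> 1"
proof -
  have "integrable M g" using g by (intro integrable_const_bound[where B = 1]) auto
  hence "expectation g \<le> expectation (\<lambda>_. 1)" using g by (intro integral_mono) auto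
  thus "expectation g \<le> 1" by (simp add: prob_space)
  show "0 \<le> expectation g" using g by (intro integral_nonneg_AE) auto
qed

lemma (in prob_space) ennreal_expectation_unit:
  assumes [measurable]: "g \<in> borel_measurable M" and g: "\<And>x. x \<in> space M \<Longrightarrow> 0 \<le> g x \<and> g x \<le> (1::real)"
  shows "(\<integral>\<^sup>+x. ennreal (g x) \<partial>M) = ennreal (expectation g)"
  using g by (intro nn_integral_eq_integral integrable_const_bound[where B = 1]) auto

context
  fixes d :: nat and f :: "(nat \<Rightarrow> real) \<Rightarrow> real"
  assumes f[measurable]: "f \<in> borel_measurable (Rd d)"
    and f01: "\<And>x. x \<in> space (Rd d) \<Longrightarrow> 0 \<le> f x \<and> f x \<le> 1"
begin

lemma dirE_unit: assumes "v \<in> space (Rd d)" shows "0 \<le> dirE d f v t \<and> dirE d f v t \<le> 1"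
proof -
  interpret prob_space "std_gaussian d" by (rule prob_space_std_gaussian)
  have [measurable]: "v \<in> space (Rd d)" by fact
  show ?thesis unfolding dirE_def using f01 by (auto intro!: expectation_in_unit)
qed

lemma smE_unit: assumes "v \<in> space (Rd d)" shows "0 \<le> smE d f a v t \<and> smE d f a v t \<le> 1"
proof -
  interpret prob_space "normal_law 0 1" by (rule prob_space_normal_law) simp
  have [measurable]: "v \<in> space (Rd d)" by fact
  show ?thesis unfolding smE_def using dirE_unit[OF assms] by (auto intro!: expectation_in_unit)
qed

text \<open>\<open>nn_integral_std_gaussian_mehler\<close> with the normal law of mean at and
  variance 1 - a^2 rewritten as an affine image of the standard one.\<close>

lemma integral_mehler_smE:
  assumes v: "v \<in> space (Rd d)" "dot d v v = 1" and a: "0 < a" "a < 1"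
  shows "(\<integral>x. mehler a (dot d v x) t * f x \<partial>std_gaussian d) = smE d f a v t"
    "(\<integral>\<^sup>+x. ennreal (mehler a (dot d v x) t * f x) \<partial>std_gaussian d) = ennreal (smE d f a v t)"
proof -
  interpret X: prob_space "std_gaussian d" by (rule prob_space_std_gaussian)
  interpret N: prob_space "normal_law 0 1" by (rule prob_space_normal_law) simp
  have [measurable]: "v \<in> space (Rd d)" by fact
  have a2: "a\<^sup>2 < 1" using a by (simp add: power_less_one_iff)
  have d: "(\<integral>\<^sup>+g. ennreal (f (place d v u g)) \<partial>std_gaussian d) = ennreal (dirE d f v u)" for u
    unfolding dirE_def using f01 by (intro X.ennreal_expectation_unit) auto
  have "(\<integral>\<^sup>+x. ennreal (mehler a (dot d v x) t * f x) \<partial>std_gaussian d)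
    = (\<integral>\<^sup>+x. ennreal (mehler a (dot d v x) t) * ennreal (f x) \<partial>std_gaussian d)"
    using f01 mehler_nonneg[OF a2] by (intro nn_integral_cong) (auto simp: ennreal_mult)
  also have "\<dots> = (\<integral>\<^sup>+u. \<integral>\<^sup>+g. ennreal (f (place d v u g)) \<partial>std_gaussian d \<partial>normal_law (a * t) (sqrt (1 - a\<^sup>2)))"
    by (rule nn_integral_std_gaussian_mehler[OF v a2]) measurable
  also have "\<dots> = (\<integral>\<^sup>+u. ennreal (dirE d f v u) \<partial>normal_law (a * t) (sqrt (1 - a\<^sup>2)))"
    by (simp add: d)
  also have "\<dots> = (\<integral>\<^sup>+z. ennreal (dirE d f v (sqrt (1 - a\<^sup>2) * z + a * t)) \<partial>normal_law 0 1)"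
    using nn_integral_normal_law_affine[of 1 "sqrt (1 - a\<^sup>2)" "\<lambda>u. ennreal (dirE d f v u)" 0 "a * t"] a2 by simp
  also have "\<dots> = (\<integral>\<^sup>+z. ennreal (dirE d f v (a * t + sqrt (1 - a\<^sup>2) * z)) \<partial>normal_law 0 1)"
    by (simp add: add.commute)
  also have "\<dots> = ennreal (smE d f a v t)"
    unfolding smE_def using dirE_unit[OF v(1)] by (intro N.ennreal_expectation_unit) auto
  finally show *: "(\<integral>\<^sup>+x. ennreal (mehler a (dot d v x) t * f x) \<partial>std_gaussian d) = ennreal (smE d f a v t)" .
  have "(\<integral>x. mehler a (dot d v x) t * f x \<partial>std_gaussian d) = enn2real (\<integral>\<^sup>+x. ennreal (mehler a (dot d v x) t * f x) \<partial>std_gaussian d)"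
    using f01 mehler_nonneg[OF a2] by (intro integral_eq_nn_integral) auto
  thus "(\<integral>x. mehler a (dot d v x) t * f x \<partial>std_gaussian d) = smE d f a v t"
    unfolding * using smE_unit[OF v(1)] by simp
qed

lemma integral_kernel_smE:
  assumes v: "v \<in> space (Rd d)" "dot d v v = 1" and a: "0 < a" "a < 1"
    and A: "prob_space A" "sets A = sets borel"
  shows "integrable (std_gaussian d) (\<lambda>x. f x * (\<integral>t. mehler a (dot d v x) t \<partial>A))"
    "(\<integral>x. f x * (\<integral>t. mehler a (dot d v x) t \<partial>A) \<partial>std_gaussian d) = (\<integral>t. smE d f a v t \<partial>A)"
proof -
  interpret X: prob_space "std_gaussian d" by (rule prob_space_std_gaussian)
  interpret A: prob_space A by fact
  interpret P: pair_sigma_finite "std_gaussian d" A ..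
  have [measurable_cong]: "sets A = sets borel" by fact
  have [measurable]: "v \<in> space (Rd d)" by fact
  have a2: "a\<^sup>2 < 1" using a by (simp add: power_less_one_iff)
  have nn: "0 \<le> f x * (\<integral>t. mehler a (dot d v x) t \<partial>A)" if "x \<in> space (Rd d)" for x
    using f01[OF that] integral_mehler_nonneg[OF a2] by auto
  have "(\<integral>\<^sup>+x. ennreal (f x * (\<integral>t. mehler a (dot d v x) t \<partial>A)) \<partial>std_gaussian d)
      = (\<integral>\<^sup>+x. \<integral>\<^sup>+t. ennreal (mehler a (dot d v x) t * f x) \<partial>A \<partial>std_gaussian d)"
  proof (rule nn_integral_cong)
    fix x assume "x \<in> space (std_gaussian d)"
    hence fx: "f x \<ge> 0" using f01 by simp
    hence "ennreal (f x * (\<integral>t. mehler a (dot d v x) t \<partial>A)) = ennreal (f x) * (\<integral>\<^sup>+t. ennreal (mehler a (dot d v x) t) \<partial>A)"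
      by (simp add: ennreal_integral_mehler[OF A a2] ennreal_mult' integral_mehler_nonneg[OF a2])
    also have "\<dots> = (\<integral>\<^sup>+t. ennreal (f x) * ennreal (mehler a (dot d v x) t) \<partial>A)"
      by (rule nn_integral_cmult[symmetric]) measurable
    also have "\<dots> = (\<integral>\<^sup>+t. ennreal (mehler a (dot d v x) t * f x) \<partial>A)"
      using fx mehler_nonneg[OF a2] by (intro nn_integral_cong) (simp add: ennreal_mult mult.commute)
    finally show "ennreal (f x * (\<integral>t. mehler a (dot d v x) t \<partial>A)) = (\<integral>\<^sup>+t. ennreal (mehler a (dot d v x) t * f x) \<partial>A)" .
  qed
  also have "\<dots> = (\<integral>\<^sup>+t. \<integral>\<^sup>+x. ennreal (mehler a (dot d v x) t * f x) \<partial>std_gaussian d \<partial>A)"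
    by (rule P.Fubini'[symmetric]) measurable
  also have "\<dots> = (\<integral>\<^sup>+t. ennreal (smE d f a v t) \<partial>A)"
    by (simp only: integral_mehler_smE(2)[OF v a])
  also have "\<dots> = ennreal (\<integral>t. smE d f a v t \<partial>A)"
    using smE_unit[OF v(1)] by (intro A.ennreal_expectation_unit) auto
  finally have eq: "(\<integral>\<^sup>+x. ennreal (f x * (\<integral>t. mehler a (dot d v x) t \<partial>A)) \<partial>std_gaussian d) = ennreal (\<integral>t. smE d f a v t \<partial>A)" .
  show "integrable (std_gaussian d) (\<lambda>x. f x * (\<integral>t. mehler a (dot d v x) t \<partial>A))"
    by (rule integrableI_nonneg) (use nn in \<open>auto simp: eq\<close>)
  have "(\<integral>x. f x * (\<integral>t. mehler a (dot d v x) t \<partial>A) \<partial>std_gaussian d)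
      = enn2real (\<integral>\<^sup>+x. ennreal (f x * (\<integral>t. mehler a (dot d v x) t \<partial>A)) \<partial>std_gaussian d)"
    using nn by (intro integral_eq_nn_integral) auto
  thus "(\<integral>x. f x * (\<integral>t. mehler a (dot d v x) t \<partial>A) \<partial>std_gaussian d) = (\<integral>t. smE d f a v t \<partial>A)"
    unfolding eq using smE_unit[OF v(1)] by (simp add: integral_nonneg_AE)
qed

text \<open>The duality bound for the difference h of the two smoothed densities in direction v, as
  a function of v and x; its inner products over x are values of \<open>corr_kernel\<close>.\<close>

lemma smoothed_bound:
  assumes d: "d \<ge> 1" and A: "prob_space A" "sets A = sets borel" and B: "prob_space B" "sets B = sets borel"
    and GA: "(\<integral>\<^sup>+t. ennreal (exp (t\<^sup>2 / 4)) \<partial>A) \<le> ennreal G" and GB: "(\<integral>\<^sup>+t. ennreal (exp (t\<^sup>2 / 4)) \<partial>B) \<le> ennreal G"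
    and G: "G \<ge> 0" and a: "0 < a" "a < 1"
    and [measurable]: "\<psi> \<in> borel_measurable (Rd d)" and \<psi>: "\<And>v. \<bar>\<psi> v\<bar> \<le> 1"
    and J: "(\<integral>\<^sup>+v. \<integral>\<^sup>+w. ennreal \<bar>corr_kernel A B (a\<^sup>2 * dot d v w)\<bar> \<partial>unif_sphere d \<partial>unif_sphere d) \<le> ennreal J" "J \<ge> 0"
  shows "\<bar>\<integral>v. \<psi> v * Diff A B (smE d f a v) \<partial>unif_sphere d\<bar> \<le> sqrt J"
proof -
  interpret S: prob_space "unif_sphere d" by (rule prob_space_unif_sphere)
  interpret X: prob_space "std_gaussian d" by (rule prob_space_std_gaussian)
  interpret A: prob_space A by fact
  interpret B: prob_space B by fact
  interpret P: pair_prob_space "unif_sphere d" "std_gaussian d" ..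
  have [measurable_cong]: "sets A = sets borel" "sets B = sets borel" by fact+
  have a2: "a\<^sup>2 < 1" using a by (simp add: power_less_one_iff)
  define m where "m C v x = (\<integral>t. mehler a (dot d v x) t \<partial>C)" for C v x
  define h where "h v x = m A v x - m B v x" for v x
  have [measurable]: "(\<lambda>z. m A (fst z) (snd z)) \<in> borel_measurable (Rd d \<Otimes>\<^sub>M Rd d)"
    "(\<lambda>z. m B (fst z) (snd z)) \<in> borel_measurable (Rd d \<Otimes>\<^sub>M Rd d)" unfolding m_def by measurable
  have hm[measurable]: "(\<lambda>(v, x). h v x) \<in> borel_measurable (Rd d \<Otimes>\<^sub>M Rd d)"
    unfolding h_def split_beta' by measurable
  have unit: "AE v in unif_sphere d. v \<in> space (Rd d) \<and> dot d v v = 1"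
    using AE_unif_sphere_unit[OF d] AE_space by eventually_elim simp
  have prod: "integrable (std_gaussian d) (\<lambda>x. h v x * h w x)"
      "(\<integral>x. h v x * h w x \<partial>std_gaussian d) = corr_kernel A B (a\<^sup>2 * dot d v w)"
    if v: "v \<in> space (Rd d)" "dot d v v = 1" and w: "w \<in> space (Rd d)" "dot d w w = 1" for v w
  proof -
    have b: "(a\<^sup>2 * dot d v w)\<^sup>2 < 1" by (rule scaled_dot_square_less_1[OF v(2) w(2) a2])
    note AA = mehler_pair_integral[OF A A GA GA G a2 v w, folded m_def]
    note AB = mehler_pair_integral[OF A B GA GB G a2 v w, folded m_def]
    note BA = mehler_pair_integral[OF B A GB GA G a2 v w, folded m_def]
    note BB = mehler_pair_integral[OF B B GB GB G a2 v w, folded m_def]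
    have eq: "h v x * h w x = m A v x * m A w x - m A v x * m B w x - (m B v x * m A w x - m B v x * m B w x)" for x
      by (simp add: h_def algebra_simps)
    show "integrable (std_gaussian d) (\<lambda>x. h v x * h w x)"
      unfolding eq using AA AB BA BB by (intro Bochner_Integration.integrable_diff)
    show "(\<integral>x. h v x * h w x \<partial>std_gaussian d) = corr_kernel A B (a\<^sup>2 * dot d v w)"
      unfolding eq corr_kernel_def
      using AA AB BA BB mehler_double_integral(1)[OF A A GA GA G b] mehler_double_integral(1)[OF A B GA GB G b]
        mehler_double_integral(1)[OF B A GB GA G b] mehler_double_integral(1)[OF B B GB GB G b]
      by (simp add: Bochner_Integration.integral_diff)
  qed
  \<comment> \<open>On the diagonal v = w the kernel parameter is a^2 < 1, so the squared norm of h
    is the same finite constant for almost every v. This is where the smoothing is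
    indispensable.\<close>
  have h2: "integrable (unif_sphere d \<Otimes>\<^sub>M std_gaussian d) (\<lambda>(v, x). (h v x)\<^sup>2)"
  proof (rule integrableI_nonneg)
    have "(\<integral>\<^sup>+z. ennreal (case z of (v, x) \<Rightarrow> (h v x)\<^sup>2) \<partial>(unif_sphere d \<Otimes>\<^sub>M std_gaussian d))
       = (\<integral>\<^sup>+v. \<integral>\<^sup>+x. ennreal ((h v x)\<^sup>2) \<partial>std_gaussian d \<partial>unif_sphere d)"
      by (subst X.nn_integral_fst[symmetric]) auto
    also have "\<dots> \<le> (\<integral>\<^sup>+v. ennreal \<bar>corr_kernel A B (a\<^sup>2)\<bar> \<partial>unif_sphere d)"
    proof (rule nn_integral_mono_AE)
      show "AE v in unif_sphere d. (\<integral>\<^sup>+x. ennreal ((h v x)\<^sup>2) \<partial>std_gaussian d) \<le> ennreal \<bar>corr_kernel A B (a\<^sup>2)\<bar>"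
        using unit
      proof eventually_elim
        case (elim v)
        have "(\<integral>\<^sup>+x. ennreal ((h v x)\<^sup>2) \<partial>std_gaussian d) = ennreal (\<integral>x. (h v x)\<^sup>2 \<partial>std_gaussian d)"
          using prod(1)[of v v] elim by (intro nn_integral_eq_integral) (auto simp: power2_eq_square)
        also have "\<dots> \<le> ennreal \<bar>corr_kernel A B (a\<^sup>2)\<bar>"
          using prod(2)[of v v] elim by (intro ennreal_leI) (auto simp: power2_eq_square)
        finally show ?case .
      qed
    qed
    also have "\<dots> < \<infinity>" by (simp add: S.emeasure_space_1[simplified])
    finally show "(\<integral>\<^sup>+z. ennreal (case z of (v, x) \<Rightarrow> (h v x)\<^sup>2) \<partial>(unif_sphere d \<Otimes>\<^sub>M std_gaussian d)) < \<infinity>" .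
  qed auto
  have "(\<integral>\<^sup>+v. \<integral>\<^sup>+w. ennreal \<bar>\<integral>x. h v x * h w x \<partial>std_gaussian d\<bar> \<partial>unif_sphere d \<partial>unif_sphere d)
      = (\<integral>\<^sup>+v. \<integral>\<^sup>+w. ennreal \<bar>corr_kernel A B (a\<^sup>2 * dot d v w)\<bar> \<partial>unif_sphere d \<partial>unif_sphere d)"
  proof (rule nn_integral_cong_AE, use unit in eventually_elim)
    case (elim v)
    show ?case
      by (rule nn_integral_cong_AE, use unit in eventually_elim) (use elim prod(2) in auto)
  qed
  hence J': "(\<integral>\<^sup>+v. \<integral>\<^sup>+w. ennreal \<bar>\<integral>x. h v x * h w x \<partial>std_gaussian d\<bar> \<partial>unif_sphere d \<partial>unif_sphere d) \<le> ennreal J"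
    using J(1) by simp
  have "\<bar>\<integral>v. \<psi> v * (\<integral>x. f x * h v x \<partial>std_gaussian d) \<partial>unif_sphere d\<bar> \<le> sqrt J"
    using f01 by (intro duality_bound[OF prob_space_unif_sphere prob_space_std_gaussian _ _ _ \<psi> _ h2 J' J(2)]) (auto simp: abs_le_iff intro: order_trans[of _ 0])
  also have "(\<integral>v. \<psi> v * (\<integral>x. f x * h v x \<partial>std_gaussian d) \<partial>unif_sphere d)
    = (\<integral>v. \<psi> v * Diff A B (smE d f a v) \<partial>unif_sphere d)"
  proof (rule integral_cong_AE)
    show "AE v in unif_sphere d. \<psi> v * (\<integral>x. f x * h v x \<partial>std_gaussian d) = \<psi> v * Diff A B (smE d f a v)"
      using unit
    proof eventually_elim
      case (elim v)
      note iA = integral_kernel_smE[of v a A, OF _ _ a A, folded m_def]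
      note iB = integral_kernel_smE[of v a B, OF _ _ a B, folded m_def]
      show ?case using elim iA iB by (simp add: h_def right_diff_distrib)
    qed
  qed measurable
  finally show ?thesis .
qed

end

section \<open>Approximation by continuous functions\<close>

text \<open>Continuity is stated through sequences converging in each coordinate below d, the form
  in which dominated convergence applies it to points of the extensional product.\<close>

definition cts :: "nat \<Rightarrow> ((nat \<Rightarrow> real) \<Rightarrow> real) \<Rightarrow> bool" where
  "cts d g \<longleftrightarrow> g \<in> borel_measurable (Rd d) \<and> (\<forall>x\<in>space (Rd d). 0 \<le> g x \<and> g x \<le> 1) \<and>
    (\<forall>X x. (\<forall>n. X n \<in> space (Rd d)) \<longrightarrow> x \<in> space (Rd d) \<longrightarrow> (\<forall>i<d. (\<lambda>n. X n i) \<longlonglongrightarrow> x i)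
      \<longrightarrow> (\<lambda>n. g (X n)) \<longlonglongrightarrow> g x)"

text \<open>Both measures are measured at once, so that a single approximant serves for A and for
  B.\<close>

definition L1_err :: "'a measure \<Rightarrow> 'a measure \<Rightarrow> ('a \<Rightarrow> real) \<Rightarrow> ('a \<Rightarrow> real) \<Rightarrow> ennreal" where
  "L1_err N1 N2 f g = (\<integral>\<^sup>+x. ennreal \<bar>f x - g x\<bar> \<partial>N1) + (\<integral>\<^sup>+x. ennreal \<bar>f x - g x\<bar> \<partial>N2)"

locale two_measures =
  fixes d :: nat and N1 N2 :: "(nat \<Rightarrow> real) measure"
  assumes N1: "prob_space N1" "sets N1 = sets (Rd d)" and N2: "prob_space N2" "sets N2 = sets (Rd d)"
begin

lemma sets_cong [measurable_cong]: "sets N1 = sets (Rd d)" "sets N2 = sets (Rd d)"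
  using N1 N2 by auto

lemma spaces: "space N1 = space (Rd d)" "space N2 = space (Rd d)"
  using sets_eq_imp_space_eq N1 N2 by auto

definition unit_valued :: "((nat \<Rightarrow> real) \<Rightarrow> real) \<Rightarrow> bool" where
  "unit_valued f \<longleftrightarrow> f \<in> borel_measurable (Rd d) \<and> (\<forall>x\<in>space (Rd d). 0 \<le> f x \<and> f x \<le> 1)"

definition approx :: "((nat \<Rightarrow> real) \<Rightarrow> real) \<Rightarrow> bool" where
  "approx f \<longleftrightarrow> (\<forall>\<epsilon>>0. \<exists>g. cts d g \<and> L1_err N1 N2 f g \<le> ennreal \<epsilon>)"

lemma cts_unit: "cts d g \<Longrightarrow> unit_valued g"
  by (simp add: cts_def unit_valued_def)

lemma L1_err_mono2:
  assumes [measurable]: "f1 \<in> borel_measurable (Rd d)" "g1 \<in> borel_measurable (Rd d)"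
      "f2 \<in> borel_measurable (Rd d)" "g2 \<in> borel_measurable (Rd d)"
    and le: "\<And>x. x \<in> space (Rd d) \<Longrightarrow> \<bar>f x - g x\<bar> \<le> \<bar>f1 x - g1 x\<bar> + \<bar>f2 x - g2 x\<bar>"
  shows "L1_err N1 N2 f g \<le> L1_err N1 N2 f1 g1 + L1_err N1 N2 f2 g2"
proof -
  have "(\<integral>\<^sup>+x. ennreal \<bar>f x - g x\<bar> \<partial>N) \<le> (\<integral>\<^sup>+x. ennreal \<bar>f1 x - g1 x\<bar> \<partial>N) + (\<integral>\<^sup>+x. ennreal \<bar>f2 x - g2 x\<bar> \<partial>N)"
    if [measurable_cong]: "sets N = sets (Rd d)" for N
  proof -
    have "(\<integral>\<^sup>+x. ennreal \<bar>f x - g x\<bar> \<partial>N) \<le> (\<integral>\<^sup>+x. ennreal \<bar>f1 x - g1 x\<bar> + ennreal \<bar>f2 x - g2 x\<bar> \<partial>N)"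
      using le sets_eq_imp_space_eq[OF that]
      by (intro nn_integral_mono) (auto simp: ennreal_plus[symmetric] simp del: ennreal_plus intro!: ennreal_leI)
    thus ?thesis by (subst (asm) nn_integral_add) auto
  qed
  from this[OF N1(2)] this[OF N2(2)] show ?thesis
    unfolding L1_err_def by (metis (no_types, lifting) add_mono add.assoc add.left_commute)
qed

lemma approx_cts: "cts d g \<Longrightarrow> approx g"
  unfolding approx_def L1_err_def by (intro allI impI exI[of _ g]) auto

text \<open>By dominated convergence some F n is close to f in both measures; an approximant of that
  F n then also approximates f.\<close>

lemma approx_lim:
  assumes fn: "\<And>n. unit_valued (F n)" "\<And>n. approx (F n)" and f: "unit_valued f"
    and lim: "\<And>x. x \<in> space (Rd d) \<Longrightarrow> (\<lambda>n. F n x) \<longlonglongrightarrow> f x"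
  shows "approx f"
  unfolding approx_def
proof (intro allI impI)
  fix \<epsilon> :: real assume \<epsilon>: "\<epsilon> > 0"
  have [measurable]: "F n \<in> borel_measurable (Rd d)" "f \<in> borel_measurable (Rd d)" for n
    using fn f by (auto simp: unit_valued_def)
  have lim0: "(\<lambda>n. \<integral>\<^sup>+x. ennreal \<bar>f x - F n x\<bar> \<partial>N) \<longlonglongrightarrow> 0"
    if N: "prob_space N" and [measurable_cong]: "sets N = sets (Rd d)" for N
  proof -
    interpret prob_space N by fact
    have sp: "space N = space (Rd d)" using that sets_eq_imp_space_eq by auto
    have "(\<lambda>n. \<integral>\<^sup>+x. ennreal \<bar>f x - F n x\<bar> \<partial>N) \<longlonglongrightarrow> (\<integral>\<^sup>+x. 0 \<partial>N)"
    proof (rule nn_integral_dominated_convergence[where w = "\<lambda>_. 1"])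
      show "AE x in N. ennreal \<bar>f x - F n x\<bar> \<le> 1" for n
      proof (rule AE_I2)
        fix x assume "x \<in> space N"
        hence "\<bar>f x - F n x\<bar> \<le> 1" using fn(1)[of n] f unfolding sp unit_valued_def by (smt (verit))
        thus "ennreal \<bar>f x - F n x\<bar> \<le> 1" by (metis ennreal_1 ennreal_leI)
      qed
      show "AE x in N. (\<lambda>n. ennreal \<bar>f x - F n x\<bar>) \<longlonglongrightarrow> 0"
      proof (rule AE_I2)
        fix x assume "x \<in> space N"
        hence "(\<lambda>n. \<bar>f x - F n x\<bar>) \<longlonglongrightarrow> \<bar>f x - f x\<bar>" using lim sp by (intro tendsto_intros) auto
        thus "(\<lambda>n. ennreal \<bar>f x - F n x\<bar>) \<longlonglongrightarrow> 0"
          using tendsto_ennrealI by fastforce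
      qed
    qed (auto simp: emeasure_space_1)
    thus ?thesis by simp
  qed
  have "(\<lambda>n. L1_err N1 N2 f (F n)) \<longlonglongrightarrow> 0 + 0"
    unfolding L1_err_def using N1 N2 by (intro tendsto_add lim0) auto
  moreover have "(0::ennreal) + 0 < ennreal (\<epsilon> / 2)" using \<epsilon> by simp
  ultimately have "eventually (\<lambda>n. L1_err N1 N2 f (F n) < ennreal (\<epsilon> / 2)) sequentially"
    by (rule order_tendstoD(2))
  then obtain n where n: "L1_err N1 N2 f (F n) < ennreal (\<epsilon> / 2)"
    by (auto simp: eventually_sequentially)
  obtain g where g: "cts d g" "L1_err N1 N2 (F n) g \<le> ennreal (\<epsilon> / 2)"
    using fn(2)[of n] \<epsilon> unfolding approx_def by (meson half_gt_zero)
  have [measurable]: "g \<in> borel_measurable (Rd d)" using g by (auto simp: cts_def)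
  have "L1_err N1 N2 f g \<le> L1_err N1 N2 f (F n) + L1_err N1 N2 (F n) g"
    by (rule L1_err_mono2) auto
  also have "\<dots> \<le> ennreal (\<epsilon> / 2) + ennreal (\<epsilon> / 2)" using n g by (intro add_mono) auto
  also have "\<dots> = ennreal \<epsilon>" using \<epsilon> by (simp flip: ennreal_plus)
  finally show "\<exists>g. cts d g \<and> L1_err N1 N2 f g \<le> ennreal \<epsilon>" using g by blast
qed

lemma approx_compl:
  assumes f: "unit_valued f" "approx f" shows "approx (\<lambda>x. 1 - f x)"
  unfolding approx_def
proof (intro allI impI)
  fix \<epsilon> :: real assume "\<epsilon> > 0"
  then obtain g where g: "cts d g" "L1_err N1 N2 f g \<le> ennreal \<epsilon>" using f by (auto simp: approx_def)
  have "cts d (\<lambda>x. 1 - g x)" using g(1) unfolding cts_def by (auto intro!: tendsto_intros)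
  moreover have "L1_err N1 N2 (\<lambda>x. 1 - f x) (\<lambda>x. 1 - g x) = L1_err N1 N2 f g"
    unfolding L1_err_def by (simp add: abs_minus_commute)
  ultimately show "\<exists>g. cts d g \<and> L1_err N1 N2 (\<lambda>x. 1 - f x) g \<le> ennreal \<epsilon>" using g by metis
qed

text \<open>A map that is 1-Lipschitz in each argument adds the errors. It serves for the maximum,
  which gives unions of sets, and for convex combinations, which give step functions.\<close>

lemma approx_binop:
  assumes f: "unit_valued f" "approx f" and h: "unit_valued h" "approx h"
    and cts: "\<And>g k. cts d g \<Longrightarrow> cts d k \<Longrightarrow> cts d (\<lambda>x. F (g x) (k x))"
    and lip: "\<And>a b a' b'. \<bar>F a b - F a' b'\<bar> \<le> \<bar>a - a'\<bar> + \<bar>b - b'\<bar>"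
  shows "approx (\<lambda>x. F (f x) (h x))"
  unfolding approx_def
proof (intro allI impI)
  fix \<epsilon> :: real assume \<epsilon>: "\<epsilon> > 0"
  obtain g where g: "cts d g" "L1_err N1 N2 f g \<le> ennreal (\<epsilon> / 2)"
    using f \<epsilon> unfolding approx_def by (meson half_gt_zero)
  obtain k where k: "cts d k" "L1_err N1 N2 h k \<le> ennreal (\<epsilon> / 2)"
    using h \<epsilon> unfolding approx_def by (meson half_gt_zero)
  have "L1_err N1 N2 (\<lambda>x. F (f x) (h x)) (\<lambda>x. F (g x) (k x)) \<le> L1_err N1 N2 f g + L1_err N1 N2 h k"
    using f h g k lip by (intro L1_err_mono2) (auto simp: cts_def unit_valued_def)
  also have "\<dots> \<le> ennreal (\<epsilon> / 2) + ennreal (\<epsilon> / 2)" using g k by (intro add_mono)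
  also have "\<dots> = ennreal \<epsilon>" using \<epsilon> by (simp flip: ennreal_plus)
  finally show "\<exists>g. cts d g \<and> L1_err N1 N2 (\<lambda>x. F (f x) (h x)) g \<le> ennreal \<epsilon>"
    using cts[OF g(1) k(1)] by (intro exI[of _ "\<lambda>x. F (g x) (k x)"]) auto
qed

lemma approx_max:
  assumes "unit_valued f" "approx f" "unit_valued h" "approx h"
  shows "approx (\<lambda>x. max (f x) (h x))"
  by (rule approx_binop[OF assms]) (auto simp: cts_def le_max_iff_disj intro!: tendsto_max)

lemma unit_valued_convex:
  assumes "unit_valued f" "unit_valued h" "0 \<le> c" "c \<le> 1"
  shows "unit_valued (\<lambda>x. (1 - c) * f x + c * h x)"
proof -
  have "(1 - c) * f x + c * h x \<le> 1" if "x \<in> space (Rd d)" for x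
    using assms that by (intro convex_bound_le) (auto simp: unit_valued_def)
  thus ?thesis using assms by (auto simp: unit_valued_def)
qed

lemma approx_convex:
  assumes "unit_valued f" "approx f" "unit_valued h" "approx h" and c: "0 \<le> c" "c \<le> 1"
  shows "approx (\<lambda>x. (1 - c) * f x + c * h x)"
proof (rule approx_binop[OF assms(1-4)])
  fix g k assume g: "cts d g" and k: "cts d k"
  show "cts d (\<lambda>x. (1 - c) * g x + c * k x)"
    using g k unit_valued_convex[OF cts_unit[OF g] cts_unit[OF k] c]
    unfolding cts_def unit_valued_def by (auto intro!: tendsto_intros)
next
  fix a b a' b' :: real
  have "\<bar>(1 - c) * a + c * b - ((1 - c) * a' + c * b')\<bar> = \<bar>(1 - c) * (a - a') + c * (b - b')\<bar>"
    by (simp add: algebra_simps)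
  also have "\<dots> \<le> \<bar>(1 - c) * (a - a')\<bar> + \<bar>c * (b - b')\<bar>" by (rule abs_triangle_ineq)
  also have "\<dots> \<le> \<bar>a - a'\<bar> + \<bar>b - b'\<bar>"
    using c by (intro add_mono) (auto simp: abs_mult mult_left_le_one_le)
  finally show "\<bar>(1 - c) * a + c * b - ((1 - c) * a' + c * b')\<bar> \<le> \<bar>a - a'\<bar> + \<bar>b - b'\<bar>" .
qed

definition approx_set :: "(nat \<Rightarrow> real) set \<Rightarrow> bool" where
  "approx_set A \<longleftrightarrow> A \<in> sets (Rd d) \<and> approx (indicator A)"

lemma unit_indicator: "A \<in> sets (Rd d) \<Longrightarrow> unit_valued (indicator A)"
  by (auto simp: unit_valued_def indicator_def)

lemma approx_cong: "(\<And>x. x \<in> space (Rd d) \<Longrightarrow> f x = g x) \<Longrightarrow> approx f \<Longrightarrow> approx g"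
proof -
  assume eq: "\<And>x. x \<in> space (Rd d) \<Longrightarrow> f x = g x"
  hence "L1_err N1 N2 f h = L1_err N1 N2 g h" for h
    unfolding L1_err_def by (intro arg_cong2[where f = "(+)"] nn_integral_cong) (auto simp: spaces)
  thus "approx f \<Longrightarrow> approx g" by (simp add: approx_def)
qed

lemma approx_set_compl: assumes "approx_set A" shows "approx_set (space (Rd d) - A)"
proof -
  have "approx (\<lambda>x. 1 - indicator A x)" using assms by (intro approx_compl) (auto simp: approx_set_def unit_indicator)
  hence "approx (indicator (space (Rd d) - A))" by (rule approx_cong[rotated]) (auto simp: indicator_def)
  thus ?thesis using assms by (auto simp: approx_set_def)
qed

text \<open>Finite unions are maxima of indicators, and a countable union is the limit of its
  partial unions.\<close>

lemma approx_set_Union: assumes "\<And>n::nat. approx_set (A n)" shows "approx_set (\<Union>n. A n)"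
proof -
  have A: "A n \<in> sets (Rd d)" for n using assms by (auto simp: approx_set_def)
  have fin: "approx_set (\<Union>i\<le>n. A i)" for n
  proof (induction n)
    case 0
    thus ?case using assms[of 0] by simp
  next
    case (Suc n)
    have "approx (\<lambda>x. max (indicator (\<Union>i\<le>n. A i) x) (indicator (A (Suc n)) x))"
      using Suc assms[of "Suc n"] by (intro approx_max) (auto simp: approx_set_def unit_indicator)
    moreover have "(\<lambda>x. max (indicator (\<Union>i\<le>n. A i) x) (indicator (A (Suc n)) x)) = (indicator (\<Union>i\<le>Suc n. A i) :: _ \<Rightarrow> real)"
      by (auto simp: indicator_def atMost_Suc fun_eq_iff)
    ultimately show ?case using A by (auto simp: approx_set_def)
  qed
  have "approx (indicator (\<Union>n. A n))"
  proof (rule approx_lim[where F = "\<lambda>n. indicator (\<Union>i\<le>n. A i)"])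
    show "(\<lambda>n. indicator (\<Union>i\<le>n. A i) x) \<longlonglongrightarrow> (indicator (\<Union>n. A n) x :: real)" for x
    proof (cases "\<exists>k. x \<in> A k")
      case True
      then obtain k where "x \<in> A k" by blast
      hence "eventually (\<lambda>n. (indicator (\<Union>i\<le>n. A i) x :: real) = indicator (\<Union>n. A n) x) sequentially"
        by (intro eventually_sequentiallyI[of k]) (auto simp: indicator_def)
      thus ?thesis by (rule tendsto_eventually)
    qed (auto simp: indicator_def)
  qed (use fin A in \<open>auto simp: approx_set_def intro!: unit_indicator\<close>)
  thus ?thesis using A by (auto simp: approx_set_def)
qed

text \<open>The indicator is the limit of ramps that fall from 1 to 0 with slope -n to the right of
  a.\<close>

lemma approx_set_halfspace: assumes i: "i < d" shows "approx_set {x \<in> space (Rd d). x i \<le> a}"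
proof -
  let ?A = "{x \<in> space (Rd d). x i \<le> a}"
  have comp: "(\<lambda>x. x i) \<in> borel_measurable (Rd d)"
    using i by (intro measurable_component_singleton) auto
  have A: "?A \<in> sets (Rd d)" using comp by (intro borel_measurable_le) auto
  define F where "F n x = max 0 (min 1 (1 - real n * (x i - a)))" for n and x :: "nat \<Rightarrow> real"
  have c: "cts d (F n)" for n
    unfolding cts_def F_def using i comp
    by (auto intro!: tendsto_intros borel_measurable_max borel_measurable_min borel_measurable_diff borel_measurable_times)
  have "approx (indicator ?A)"
  proof (rule approx_lim[where F = F])
    fix x assume x: "x \<in> space (Rd d)"
    show "(\<lambda>n. F n x) \<longlonglongrightarrow> indicator ?A x"
    proof (cases "x i \<le> a")
      case True
      hence "F n x = 1" for n unfolding F_def by (auto simp: mult_nonneg_nonpos)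
      thus ?thesis using True x by simp
    next
      case False
      have "eventually (\<lambda>n. F n x = 0) sequentially"
      proof -
        obtain N where N: "real N > 1 / (x i - a)" using reals_Archimedean2 by blast
        have "F n x = 0" if "n \<ge> N" for n
        proof -
          have "1 / (x i - a) \<le> real n" using N that by linarith
          thus ?thesis using False unfolding F_def by (simp add: field_simps)
        qed
        thus ?thesis by (auto simp: eventually_sequentially)
      qed
      thus ?thesis using False by (simp add: tendsto_eventually)
    qed
  qed (use c A in \<open>auto intro: cts_unit approx_cts unit_indicator\<close>)
  thus ?thesis using A by (simp add: approx_set_def)
qed

text \<open>The approximable sets are closed under complements and countable unions, so generators
  suffice: half-lines for the Borel sets of one coordinate, then such coordinate sets for the
  product.\<close>

lemma approx_set_sets: assumes "A \<in> sets (Rd d)" shows "approx_set A"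
proof -
  have emp: "approx_set {}"
  proof -
    have "cts d (\<lambda>_. 0)" by (simp add: cts_def)
    hence "approx (\<lambda>_. 0)" by (rule approx_cts)
    moreover have "(indicator {} :: (nat \<Rightarrow> real) \<Rightarrow> real) = (\<lambda>_. 0)" by auto
    ultimately show ?thesis by (simp add: approx_set_def)
  qed
  have coord: "approx_set {x \<in> space (Rd d). x i \<in> B}" if i: "i < d" and B: "B \<in> sets borel" for i and B :: "real set"
  proof -
    have "B \<in> sigma_sets UNIV (range atMost)" using B by (simp add: borel_eq_atMost)
    thus ?thesis
    proof induction
      case (Basic B)
      then obtain a where "B = {..a}" by auto
      thus ?case using approx_set_halfspace[OF i, of a] by simp
    next
      case Empty
      thus ?case using emp by simp
    next
      case (Compl B)
      have "{x \<in> space (Rd d). x i \<in> UNIV - B} = space (Rd d) - {x \<in> space (Rd d). x i \<in> B}" by auto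
      thus ?case using approx_set_compl[OF Compl.IH] by simp
    next
      case (Union B)
      have "{x \<in> space (Rd d). x i \<in> (\<Union>n. B n)} = (\<Union>n. {x \<in> space (Rd d). x i \<in> B n})" by auto
      thus ?case using approx_set_Union[OF Union.IH] by simp
    qed
  qed
  have "A \<in> sigma_sets (space (Rd d)) {{f\<in>space (Rd d). f i \<in> B} | i B. i \<in> {..<d} \<and> B \<in> sets borel}"
    using assms sets_PiM_single[of "{..<d}" "\<lambda>_. borel :: real measure"] by (simp add: space_Rd)
  thus ?thesis
  proof induction
    case (Basic A)
    thus ?case using coord by auto
  next
    case Empty
    thus ?case by (rule emp)
  next
    case (Compl A)
    thus ?case using approx_set_compl by simp
  next
    case (Union A)
    thus ?case using approx_set_Union by simp
  qed
qed

text \<open>A layer-cake argument: f is the uniform limit of averages of indicators of its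
  superlevel sets.\<close>

lemma approx_unit_valued:
  assumes f: "unit_valued f" shows "approx f"
proof -
  have [measurable]: "f \<in> borel_measurable (Rd d)" using f by (simp add: unit_valued_def)
  define A where "A m k = {x \<in> space (Rd d). real (Suc k) \<le> real (Suc m) * f x}" for m k :: nat
  have A: "A m k \<in> sets (Rd d)" for m k unfolding A_def by measurable
  define G where "G m n x = (\<Sum>k<n. indicator (A m k) x) / real n" for m n and x :: "nat \<Rightarrow> real"
  have G: "unit_valued (G m n) \<and> approx (G m n)" if "n \<ge> 1" for m n
    using that
  proof (induction n rule: nat_induct_at_least)
    case base
    have "G m 1 = indicator (A m 0)" by (auto simp: G_def fun_eq_iff)
    thus ?case using approx_set_sets[OF A, of m 0] unit_indicator[OF A] by (auto simp: approx_set_def)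
  next
    case (Suc n)
    let ?c = "1 / real (Suc n)"
    \<comment> \<open>The average of n + 1 indicators is the convex combination of the previous
      average and the new indicator; in this way all partial averages keep values in the unit
      interval.\<close>
    have eq: "G m (Suc n) = (\<lambda>x. (1 - ?c) * G m n x + ?c * indicator (A m n) x)"
    proof -
      have "1 - ?c = real n / real (Suc n)" by (simp add: field_simps)
      thus ?thesis using Suc(1) by (simp add: G_def fun_eq_iff add_divide_distrib)
    qed
    have "approx (G m (Suc n))" unfolding eq
      using Suc approx_set_sets[OF A, of m n] unit_indicator[OF A] by (intro approx_convex) (auto simp: approx_set_def)
    moreover have "unit_valued (G m (Suc n))" unfolding eq
      using Suc(2) unit_indicator[OF A] by (intro unit_valued_convex) auto
    ultimately show ?case by blast
  qed
  show ?thesis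
  proof (rule approx_lim[where F = "\<lambda>m. G m (Suc m)"])
    fix x assume x: "x \<in> space (Rd d)"
    hence fx: "0 \<le> f x" "f x \<le> 1" using f by (auto simp: unit_valued_def)
    \<comment> \<open>At x the levels reached are exactly those below q, so the average is f x
      rounded down to a multiple of 1/(m + 1).\<close>
    have b: "\<bar>G m (Suc m) x - f x\<bar> \<le> 1 / real (Suc m)" for m
    proof -
      define q where "q = nat \<lfloor>real (Suc m) * f x\<rfloor>"
      have y: "0 \<le> real (Suc m) * f x" "real (Suc m) * f x \<le> real (Suc m)"
        using fx by (auto simp: mult_left_le)
      have qm: "q \<le> Suc m" unfolding q_def using y by linarith
      have "x \<in> A m k \<longleftrightarrow> k < q" for k
      proof
        assume "x \<in> A m k"
        hence "real (Suc k) \<le> real (Suc m) * f x" by (simp add: A_def)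
        hence "Suc k \<le> q" unfolding q_def by (rule le_nat_floor)
        thus "k < q" by simp
      next
        assume "k < q"
        hence "real (Suc k) \<le> real q" by simp
        also have "\<dots> \<le> real (Suc m) * f x" unfolding q_def using y by (intro of_nat_floor)
        finally show "x \<in> A m k" using x by (simp add: A_def)
      qed
      hence "(\<Sum>k<Suc m. indicator (A m k) x) = (\<Sum>k<Suc m. if k < q then 1 else 0 :: real)"
        by (intro sum.cong) (auto simp: indicator_def)
      also have "\<dots> = (\<Sum>k\<in>{k\<in>{..<Suc m}. k < q}. 1)" by (subst sum.inter_filter) auto
      also have "{k\<in>{..<Suc m}. k < q} = {..<q}" using qm by auto
      finally have "G m (Suc m) x = real q / real (Suc m)" by (simp add: G_def)
      hence "G m (Suc m) x - f x = (real q - real (Suc m) * f x) / real (Suc m)"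
        by (simp add: diff_divide_distrib)
      moreover have "\<bar>real q - real (Suc m) * f x\<bar> \<le> 1" unfolding q_def using y by linarith
      ultimately show ?thesis by (simp add: divide_right_mono)
    qed
    have "(\<lambda>m. G m (Suc m) x - f x) \<longlonglongrightarrow> 0"
      by (rule Lim_null_comparison[OF _ LIMSEQ_inverse_real_of_nat]) (use b in \<open>simp add: inverse_eq_divide\<close>)
    thus "(\<lambda>m. G m (Suc m) x) \<longlonglongrightarrow> f x" by (simp add: LIM_zero_iff)
  qed (use G f in auto)
qed

end

section \<open>Removing the smoothing and the continuity assumption\<close>

lemma ctsD:
  assumes "cts d f" "\<And>n. X n \<in> space (Rd d)" "x \<in> space (Rd d)" "\<And>i. i < d \<Longrightarrow> (\<lambda>n. X n i) \<longlonglongrightarrow> x i"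
  shows "(\<lambda>n. f (X n)) \<longlonglongrightarrow> f x"
  using assms by (simp add: cts_def)

lemma dirE_tendsto:
  assumes f: "cts d f" and v: "v \<in> space (Rd d)" and T: "T \<longlonglongrightarrow> t"
  shows "(\<lambda>n. dirE d f v (T n)) \<longlonglongrightarrow> dirE d f v t"
proof -
  have [measurable]: "f \<in> borel_measurable (Rd d)" "v \<in> space (Rd d)" using f v by (auto simp: cts_def)
  interpret prob_space "std_gaussian d" by (rule prob_space_std_gaussian)
  show ?thesis unfolding dirE_def
  proof (rule integral_dominated_convergence[where w = "\<lambda>_. 1"])
    show "AE g in std_gaussian d. (\<lambda>n. f (place d v (T n) g)) \<longlonglongrightarrow> f (place d v t g)"
    proof (rule AE_I2)
      fix g
      show "(\<lambda>n. f (place d v (T n) g)) \<longlonglongrightarrow> f (place d v t g)"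
        using T by (intro ctsD[OF f]) (auto simp: place_apply intro!: tendsto_intros)
    qed
    show "AE g in std_gaussian d. norm (f (place d v (T n) g)) \<le> 1" for n
      using f by (intro AE_I2) (auto simp: cts_def)
  qed auto
qed

lemma smE_tendsto:
  assumes f: "cts d f" and v: "v \<in> space (Rd d)" and a: "a \<longlonglongrightarrow> 1"
  shows "(\<lambda>n. smE d f (a n) v t) \<longlonglongrightarrow> dirE d f v t"
proof -
  have [measurable]: "f \<in> borel_measurable (Rd d)" "v \<in> space (Rd d)" using f v by (auto simp: cts_def)
  have f01: "x \<in> space (Rd d) \<Longrightarrow> 0 \<le> f x \<and> f x \<le> 1" for x using f by (auto simp: cts_def)
  interpret prob_space "normal_law 0 1" by (rule prob_space_normal_law) simp
  have "(\<lambda>n. smE d f (a n) v t) \<longlonglongrightarrow> (\<integral>z. dirE d f v t \<partial>normal_law 0 1)"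
    unfolding smE_def
  proof (rule integral_dominated_convergence[where w = "\<lambda>_. 1"])
    show "AE z in normal_law 0 1. (\<lambda>n. dirE d f v (a n * t + sqrt (1 - (a n)\<^sup>2) * z)) \<longlonglongrightarrow> dirE d f v t"
    proof (intro AE_I2 dirE_tendsto[OF f v])
      fix z
      have "(\<lambda>n. a n * t + sqrt (1 - (a n)\<^sup>2) * z) \<longlonglongrightarrow> 1 * t + sqrt (1 - 1\<^sup>2) * z"
        by (intro tendsto_intros a)
      thus "(\<lambda>n. a n * t + sqrt (1 - (a n)\<^sup>2) * z) \<longlonglongrightarrow> t" by simp
    qed
    show "AE z in normal_law 0 1. norm (dirE d f v (a n * t + sqrt (1 - (a n)\<^sup>2) * z)) \<le> 1" for n
      using dirE_unit[OF _ f01 v] by (intro AE_I2) auto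
  qed auto
  thus ?thesis by (simp add: prob_space[simplified])
qed

text \<open>The bound J is required to be uniform in a, because a tends to 1 afterwards.\<close>

locale direction_problem =
  fixes d :: nat and A B :: "real measure" and G J :: real
  assumes d: "d \<ge> 1" and A: "prob_space A" "sets A = sets borel" and B: "prob_space B" "sets B = sets borel"
    and GA: "(\<integral>\<^sup>+t. ennreal (exp (t\<^sup>2 / 4)) \<partial>A) \<le> ennreal G" and GB: "(\<integral>\<^sup>+t. ennreal (exp (t\<^sup>2 / 4)) \<partial>B) \<le> ennreal G"
    and G: "G \<ge> 0" and J0: "J \<ge> 0"
    and J: "\<And>a. 0 < a \<Longrightarrow> a < 1 \<Longrightarrow>
      (\<integral>\<^sup>+v. \<integral>\<^sup>+w. ennreal \<bar>corr_kernel A B (a\<^sup>2 * dot d v w)\<bar> \<partial>unif_sphere d \<partial>unif_sphere d) \<le> ennreal J"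
begin

sublocale S: prob_space "unif_sphere d" by (rule prob_space_unif_sphere)
sublocale X: prob_space "std_gaussian d" by (rule prob_space_std_gaussian)
sublocale A: prob_space A by (rule A(1))
sublocale B: prob_space B by (rule B(1))

lemma sets_AB [measurable_cong]: "sets A = sets borel" "sets B = sets borel"
  using A B by auto

lemma Diff_unit:
  assumes "h \<in> borel_measurable borel" "\<And>t. 0 \<le> h t \<and> h t \<le> 1"
  shows "\<bar>Diff A B h\<bar> \<le> 1"
proof -
  have "0 \<le> (\<integral>t. h t \<partial>A)" "(\<integral>t. h t \<partial>A) \<le> 1" "0 \<le> (\<integral>t. h t \<partial>B)" "(\<integral>t. h t \<partial>B) \<le> 1"
    using assms sets_AB by (auto intro!: A.expectation_in_unit B.expectation_in_unit)
  thus ?thesis by linarith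
qed

text \<open>Continuity of \<open>f\<close> is what allows \<open>a \<longlongrightarrow> 1\<close> here, as \<open>A\<close> may have atoms.\<close>

lemma bound_cts:
  assumes f: "cts d f"
    and [measurable]: "\<psi> \<in> borel_measurable (Rd d)" and \<psi>: "\<And>v. \<bar>\<psi> v\<bar> \<le> 1"
  shows "\<bar>\<integral>v. \<psi> v * Diff A B (dirE d f v) \<partial>unif_sphere d\<bar> \<le> sqrt J"
proof -
  have [measurable]: "f \<in> borel_measurable (Rd d)" using f by (auto simp: cts_def)
  have f01: "x \<in> space (Rd d) \<Longrightarrow> 0 \<le> f x \<and> f x \<le> 1" for x using f by (auto simp: cts_def)
  define a where "a n = 1 - 1 / (real n + 2)" for n
  have a01: "0 < a n" "a n < 1" for n by (auto simp: a_def field_simps)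
  have a1: "a \<longlonglongrightarrow> 1" unfolding a_def by real_asymp
  have sm: "(\<lambda>n. \<integral>t. smE d f (a n) v t \<partial>C) \<longlonglongrightarrow> (\<integral>t. dirE d f v t \<partial>C)"
    if v: "v \<in> space (Rd d)" and C: "prob_space C" and [measurable_cong]: "sets C = sets borel" for v C
  proof -
    interpret C: prob_space C by fact
    have [measurable]: "v \<in> space (Rd d)" by fact
    show ?thesis
    proof (rule integral_dominated_convergence[where w = "\<lambda>_. 1"])
      show "AE t in C. norm (smE d f (a n) v t) \<le> 1" for n
        using smE_unit[OF _ f01 v] by (intro AE_I2) auto
    qed (auto intro!: smE_tendsto[OF f v a1])
  qed
  have bd: "\<bar>Diff A B (smE d f (a n) v)\<bar> \<le> 1" if v: "v \<in> space (Rd d)" for v n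
    using v by (intro Diff_unit smE_unit[OF _ f01 v]) auto
  have "(\<lambda>n. \<integral>v. \<psi> v * Diff A B (smE d f (a n) v) \<partial>unif_sphere d) \<longlonglongrightarrow> (\<integral>v. \<psi> v * Diff A B (dirE d f v) \<partial>unif_sphere d)"
  proof (rule integral_dominated_convergence[where w = "\<lambda>_. 1"])
    show "AE v in unif_sphere d. norm (\<psi> v * Diff A B (smE d f (a n) v)) \<le> 1" for n
    proof (rule AE_I2)
      fix v assume "v \<in> space (unif_sphere d)"
      hence "\<bar>\<psi> v\<bar> * \<bar>Diff A B (smE d f (a n) v)\<bar> \<le> 1 * 1"
        using bd \<psi> by (intro mult_mono) auto
      thus "norm (\<psi> v * Diff A B (smE d f (a n) v)) \<le> 1" by (simp add: abs_mult)
    qed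
    show "AE v in unif_sphere d. (\<lambda>n. \<psi> v * Diff A B (smE d f (a n) v)) \<longlonglongrightarrow> \<psi> v * Diff A B (dirE d f v)"
      using A B by (intro AE_I2 tendsto_intros sm) auto
  qed auto
  hence "(\<lambda>n. \<bar>\<integral>v. \<psi> v * Diff A B (smE d f (a n) v) \<partial>unif_sphere d\<bar>) \<longlonglongrightarrow> \<bar>\<integral>v. \<psi> v * Diff A B (dirE d f v) \<partial>unif_sphere d\<bar>"
    by (rule tendsto_rabs)
  moreover have "\<bar>\<integral>v. \<psi> v * Diff A B (smE d f (a n) v) \<partial>unif_sphere d\<bar> \<le> sqrt J" for n
    by (rule smoothed_bound[OF _ f01 d A B GA GB G a01 _ \<psi> J J0]) (use a01 in auto)
  ultimately show ?thesis by (intro LIMSEQ_le_const2) auto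
qed

text \<open>The law of the sample when the direction is random as well. An L1 error under this
  mixture bounds the error averaged over v, so one continuous approximant serves all
  directions.\<close>

definition mix :: "real measure \<Rightarrow> (nat \<Rightarrow> real) measure" where
  "mix C = distr (unif_sphere d \<Otimes>\<^sub>M (C \<Otimes>\<^sub>M std_gaussian d)) (Rd d) (\<lambda>(v, t, g). place d v t g)"

lemma mix:
  assumes C: "prob_space C" "sets C = sets borel"
  shows "prob_space (mix C)" "sets (mix C) = sets (Rd d)"
    "\<And>h. h \<in> borel_measurable (Rd d) \<Longrightarrow> (\<integral>\<^sup>+x. h x \<partial>mix C) = (\<integral>\<^sup>+v. \<integral>\<^sup>+t. \<integral>\<^sup>+g. h (place d v t g) \<partial>std_gaussian d \<partial>C \<partial>unif_sphere d)"
proof -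
  interpret C: prob_space C by fact
  have [measurable_cong]: "sets C = sets borel" by fact
  interpret CX: pair_prob_space C "std_gaussian d" ..
  interpret P: pair_prob_space "unif_sphere d" "C \<Otimes>\<^sub>M std_gaussian d" ..
  have m[measurable]: "(\<lambda>(v, t, g). place d v t g) \<in> unif_sphere d \<Otimes>\<^sub>M (C \<Otimes>\<^sub>M std_gaussian d) \<rightarrow>\<^sub>M Rd d"
    unfolding split_beta' by measurable
  show "prob_space (mix C)" unfolding mix_def by (rule P.prob_space_distr) measurable
  show "sets (mix C) = sets (Rd d)" by (simp add: mix_def)
  fix h :: "(nat \<Rightarrow> real) \<Rightarrow> ennreal" assume [measurable]: "h \<in> borel_measurable (Rd d)"
  show "(\<integral>\<^sup>+x. h x \<partial>mix C) = (\<integral>\<^sup>+v. \<integral>\<^sup>+t. \<integral>\<^sup>+g. h (place d v t g) \<partial>std_gaussian d \<partial>C \<partial>unif_sphere d)"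
  proof -
    have "(\<integral>\<^sup>+x. h x \<partial>mix C) = (\<integral>\<^sup>+z. h (place d (fst z) (fst (snd z)) (snd (snd z))) \<partial>(unif_sphere d \<Otimes>\<^sub>M (C \<Otimes>\<^sub>M std_gaussian d)))"
      unfolding mix_def by (subst nn_integral_distr) (auto simp: split_beta')
    also have "\<dots> = (\<integral>\<^sup>+v. \<integral>\<^sup>+y. h (place d v (fst y) (snd y)) \<partial>(C \<Otimes>\<^sub>M std_gaussian d) \<partial>unif_sphere d)"
      by (subst CX.P.nn_integral_fst[symmetric]) auto
    also have "\<dots> = (\<integral>\<^sup>+v. \<integral>\<^sup>+t. \<integral>\<^sup>+g. h (place d v t g) \<partial>std_gaussian d \<partial>C \<partial>unif_sphere d)"
    proof (rule nn_integral_cong)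
      fix v assume "v \<in> space (unif_sphere d)"
      hence [measurable]: "v \<in> space (Rd d)" by simp
      show "(\<integral>\<^sup>+y. h (place d v (fst y) (snd y)) \<partial>(C \<Otimes>\<^sub>M std_gaussian d)) = (\<integral>\<^sup>+t. \<integral>\<^sup>+g. h (place d v t g) \<partial>std_gaussian d \<partial>C)"
        by (subst X.nn_integral_fst[symmetric]) auto
    qed
    finally show ?thesis .
  qed
qed

lemma dirE_diff_le:
  assumes [measurable]: "f \<in> borel_measurable (Rd d)" "g \<in> borel_measurable (Rd d)"
    and f: "\<And>x. x \<in> space (Rd d) \<Longrightarrow> 0 \<le> f x \<and> f x \<le> 1" and g: "\<And>x. x \<in> space (Rd d) \<Longrightarrow> 0 \<le> g x \<and> g x \<le> 1"
    and C: "prob_space C" "sets C = sets borel" and v: "v \<in> space (Rd d)"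
  shows "ennreal \<bar>(\<integral>t. dirE d f v t \<partial>C) - (\<integral>t. dirE d g v t \<partial>C)\<bar>
    \<le> (\<integral>\<^sup>+t. \<integral>\<^sup>+y. ennreal \<bar>f (place d v t y) - g (place d v t y)\<bar> \<partial>std_gaussian d \<partial>C)"
proof -
  interpret C: prob_space C by fact
  have [measurable_cong]: "sets C = sets borel" by fact
  have [measurable]: "v \<in> space (Rd d)" by fact
  have i: "integrable C (dirE d f v)" "integrable C (dirE d g v)"
    using dirE_unit[OF _ f v] dirE_unit[OF _ g v]
    by (auto intro!: C.integrable_const_bound[where B = 1])
  have "ennreal \<bar>(\<integral>t. dirE d f v t \<partial>C) - (\<integral>t. dirE d g v t \<partial>C)\<bar> = ennreal \<bar>\<integral>t. dirE d f v t - dirE d g v t \<partial>C\<bar>"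
    using i by simp
  also have "\<dots> \<le> (\<integral>\<^sup>+t. ennreal \<bar>dirE d f v t - dirE d g v t\<bar> \<partial>C)"
    using integral_norm_bound_ennreal[of C "\<lambda>t. dirE d f v t - dirE d g v t"] i by simp
  also have "\<dots> \<le> (\<integral>\<^sup>+t. \<integral>\<^sup>+y. ennreal \<bar>f (place d v t y) - g (place d v t y)\<bar> \<partial>std_gaussian d \<partial>C)"
  proof (rule nn_integral_mono)
    fix t
    have i: "integrable (std_gaussian d) (\<lambda>y. f (place d v t y))" "integrable (std_gaussian d) (\<lambda>y. g (place d v t y))"
      using f g by (auto intro!: X.integrable_const_bound[where B = 1])
    have "ennreal \<bar>dirE d f v t - dirE d g v t\<bar> = ennreal \<bar>\<integral>y. f (place d v t y) - g (place d v t y) \<partial>std_gaussian d\<bar>"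
      using i by (simp add: dirE_def)
    also have "\<dots> \<le> (\<integral>\<^sup>+y. ennreal \<bar>f (place d v t y) - g (place d v t y)\<bar> \<partial>std_gaussian d)"
      using integral_norm_bound_ennreal[of "std_gaussian d" "\<lambda>y. f (place d v t y) - g (place d v t y)"] i by simp
    finally show "ennreal \<bar>dirE d f v t - dirE d g v t\<bar> \<le> (\<integral>\<^sup>+y. ennreal \<bar>f (place d v t y) - g (place d v t y)\<bar> \<partial>std_gaussian d)" .
  qed
  finally show ?thesis .
qed

text \<open>The mean absolute deviation is the pairing of the deviation with its own sign. Replacing
  f by a continuous function in this pairing costs at most \<epsilon>, while the bound for
  continuous functions is independent of \<epsilon>.\<close>

lemma expectation_Diff_le:
  assumes [measurable]: "f \<in> borel_measurable (Rd d)"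
    and f: "\<And>x. x \<in> space (Rd d) \<Longrightarrow> 0 \<le> f x \<and> f x \<le> 1"
  shows "(\<integral>\<^sup>+v. ennreal \<bar>Diff A B (dirE d f v)\<bar> \<partial>unif_sphere d) \<le> ennreal (sqrt J)"
proof -
  interpret M: two_measures d "mix A" "mix B"
    by (intro two_measures.intro mix(1,2) A B)
  have bd: "\<bar>Diff A B (dirE d h v)\<bar> \<le> 1" if v: "v \<in> space (Rd d)" and [measurable]: "h \<in> borel_measurable (Rd d)"
      and h: "\<And>x. x \<in> space (Rd d) \<Longrightarrow> 0 \<le> h x \<and> h x \<le> 1" for v h
    using v by (intro Diff_unit dirE_unit[OF _ h v]) auto
  \<comment> \<open>The sign is taken for f and kept when f is replaced by the approximant g;
    \<open>bound_cts\<close> holds for any bounded weight.\<close>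
  define \<psi> where "\<psi> v = sgn (Diff A B (dirE d f v))" for v
  have [measurable]: "\<psi> \<in> borel_measurable (Rd d)" unfolding \<psi>_def by measurable
  have \<psi>: "\<bar>\<psi> v\<bar> \<le> 1" for v by (auto simp: \<psi>_def sgn_if)
  have int: "integrable (unif_sphere d) (\<lambda>v. \<psi> v * Diff A B (dirE d h v))"
    if [measurable]: "h \<in> borel_measurable (Rd d)" and h: "\<And>x. x \<in> space (Rd d) \<Longrightarrow> 0 \<le> h x \<and> h x \<le> 1" for h
  proof (rule S.integrable_const_bound[where B = 1])
    show "AE v in unif_sphere d. norm (\<psi> v * Diff A B (dirE d h v)) \<le> 1"
    proof (rule AE_I2)
      fix v assume "v \<in> space (unif_sphere d)"
      hence "\<bar>\<psi> v\<bar> * \<bar>Diff A B (dirE d h v)\<bar> \<le> 1 * 1" using bd[OF _ _ h] \<psi> by (intro mult_mono) auto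
      thus "norm (\<psi> v * Diff A B (dirE d h v)) \<le> 1" by (simp add: abs_mult)
    qed
  qed measurable
  have "(\<integral>v. \<psi> v * Diff A B (dirE d f v) \<partial>unif_sphere d) \<le> sqrt J + \<epsilon>" if \<epsilon>: "\<epsilon> > 0" for \<epsilon>
  proof -
    have "M.approx f" by (rule M.approx_unit_valued) (use f in \<open>auto simp: M.unit_valued_def\<close>)
    then obtain g where g: "cts d g" "L1_err (mix A) (mix B) f g \<le> ennreal \<epsilon>"
      using \<epsilon> by (auto simp: M.approx_def)
    have gm[measurable]: "g \<in> borel_measurable (Rd d)" using g by (auto simp: cts_def)
    have g01: "x \<in> space (Rd d) \<Longrightarrow> 0 \<le> g x \<and> g x \<le> 1" for x using g by (auto simp: cts_def)
    let ?D = "\<lambda>v. \<psi> v * Diff A B (dirE d f v) - \<psi> v * Diff A B (dirE d g v)"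
    have "ennreal \<bar>\<integral>v. ?D v \<partial>unif_sphere d\<bar> \<le> (\<integral>\<^sup>+v. ennreal \<bar>?D v\<bar> \<partial>unif_sphere d)"
      using integral_norm_bound_ennreal[of "unif_sphere d" ?D] int[OF _ f] int[OF _ g01] by simp
    also have "\<dots> \<le> (\<integral>\<^sup>+v. (\<integral>\<^sup>+t. \<integral>\<^sup>+y. ennreal \<bar>f (place d v t y) - g (place d v t y)\<bar> \<partial>std_gaussian d \<partial>A)
        + (\<integral>\<^sup>+t. \<integral>\<^sup>+y. ennreal \<bar>f (place d v t y) - g (place d v t y)\<bar> \<partial>std_gaussian d \<partial>B) \<partial>unif_sphere d)"
    proof (rule nn_integral_mono)
      fix v assume "v \<in> space (unif_sphere d)"
      hence v: "v \<in> space (Rd d)" by simp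
      let ?a = "(\<integral>t. dirE d f v t \<partial>A) - (\<integral>t. dirE d g v t \<partial>A)" and ?b = "(\<integral>t. dirE d f v t \<partial>B) - (\<integral>t. dirE d g v t \<partial>B)"
      have "?D v = \<psi> v * (?a - ?b)" by (simp add: algebra_simps)
      hence "\<bar>?D v\<bar> = \<bar>\<psi> v\<bar> * \<bar>?a - ?b\<bar>" by (simp only: abs_mult)
      also have "\<dots> \<le> 1 * (\<bar>?a\<bar> + \<bar>?b\<bar>)"
        by (rule mult_mono[OF \<psi> abs_triangle_ineq4]) simp_all
      finally have "\<bar>?D v\<bar> \<le> \<bar>?a\<bar> + \<bar>?b\<bar>" by (simp only: mult_1_left)
      hence "ennreal \<bar>?D v\<bar> \<le> ennreal \<bar>?a\<bar> + ennreal \<bar>?b\<bar>" by (metis ennreal_leI ennreal_plus abs_ge_zero)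
      also have "\<dots> \<le> (\<integral>\<^sup>+t. \<integral>\<^sup>+y. ennreal \<bar>f (place d v t y) - g (place d v t y)\<bar> \<partial>std_gaussian d \<partial>A)
        + (\<integral>\<^sup>+t. \<integral>\<^sup>+y. ennreal \<bar>f (place d v t y) - g (place d v t y)\<bar> \<partial>std_gaussian d \<partial>B)"
        by (intro add_mono dirE_diff_le f g01 A B v) auto
      finally show "ennreal \<bar>?D v\<bar> \<le> \<dots>" .
    qed
    also have "\<dots> = L1_err (mix A) (mix B) f g"
      unfolding L1_err_def by (simp add: mix(3)[OF A] mix(3)[OF B] nn_integral_add)
    also have "\<dots> \<le> ennreal \<epsilon>" by fact
    finally have "\<bar>\<integral>v. ?D v \<partial>unif_sphere d\<bar> \<le> \<epsilon>" using \<epsilon> by (simp add: ennreal_le_iff)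
    moreover have "(\<integral>v. ?D v \<partial>unif_sphere d) = (\<integral>v. \<psi> v * Diff A B (dirE d f v) \<partial>unif_sphere d) - (\<integral>v. \<psi> v * Diff A B (dirE d g v) \<partial>unif_sphere d)"
      using int[OF _ f] int[OF _ g01] by (intro Bochner_Integration.integral_diff) auto
    moreover have "\<bar>\<integral>v. \<psi> v * Diff A B (dirE d g v) \<partial>unif_sphere d\<bar> \<le> sqrt J"
      by (rule bound_cts[OF g(1) _ \<psi>]) measurable
    ultimately show ?thesis by linarith
  qed
  hence le: "(\<integral>v. \<psi> v * Diff A B (dirE d f v) \<partial>unif_sphere d) \<le> sqrt J" by (rule field_le_epsilon)
  have eq: "\<psi> v * Diff A B (dirE d f v) = \<bar>Diff A B (dirE d f v)\<bar>" for v
    by (simp add: \<psi>_def abs_sgn mult.commute)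
  have "(\<integral>\<^sup>+v. ennreal \<bar>Diff A B (dirE d f v)\<bar> \<partial>unif_sphere d) = ennreal (\<integral>v. \<bar>Diff A B (dirE d f v)\<bar> \<partial>unif_sphere d)"
    using int[OF assms] unfolding eq by (intro nn_integral_eq_integral) auto
  also have "\<dots> \<le> ennreal (sqrt J)" using le unfolding eq by (rule ennreal_leI)
  finally show ?thesis .
qed

end

section \<open>Discrete Gaussians\<close>

text \<open>The normaliser in \<open>DG\<close> is an \<open>infsum\<close>, whereas the lattice
  estimates concern \<open>ennreal\<close> sums; this identifies the two when the sum is
  finite.\<close>

lemma infsum_int_nonneg:
  fixes f :: "int \<Rightarrow> real"
  assumes nn: "\<And>i. f i \<ge> 0" and fin: "sum_int (\<lambda>i. ennreal (f i)) < \<infinity>"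
  shows "infsum f UNIV = enn2real (sum_int (\<lambda>i. ennreal (f i)))"
proof -
  have "integrable (count_space UNIV) f" using nn fin by (intro integrableI_nonneg) auto
  hence abs: "Infinite_Set_Sum.abs_summable_on f UNIV" by (simp add: Infinite_Set_Sum.abs_summable_on_def)
  have "infsum f UNIV = infsetsum f UNIV" by (rule infsetsum_infsum[OF abs, symmetric])
  also have "\<dots> = enn2real (sum_int (\<lambda>i. ennreal (f i)))"
    by (rule infsetsum_conv_nn_integral) (use nn fin in auto)
  finally show ?thesis .
qed

lemma normal_density_lattice:
  assumes "s > 0"
  shows "normal_density \<mu> \<sigma> (\<theta> + s * of_int i) = normal_density 0 (\<sigma> / s) ((\<theta> - \<mu>) / s + of_int i) / s"
proof -
  have "(\<theta> + s * of_int i - \<mu>)\<^sup>2 / (2 * \<sigma>\<^sup>2) = ((\<theta> - \<mu>) / s + of_int i - 0)\<^sup>2 / (2 * (\<sigma> / s)\<^sup>2)"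
  proof -
    have "\<theta> + s * of_int i - \<mu> = s * ((\<theta> - \<mu>) / s + of_int i - 0)" using assms by (simp add: field_simps)
    thus ?thesis using assms by (simp add: power_mult_distrib power_divide)
  qed
  moreover have "sqrt (2 * pi * \<sigma>\<^sup>2) = sqrt (2 * pi * (\<sigma> / s)\<^sup>2) * s"
    using assms by (simp add: real_sqrt_mult real_sqrt_divide power_divide)
  ultimately show ?thesis unfolding normal_density_def by simp
qed

lemma rtheta_pos:
  assumes s: "s > 0" shows "rtheta s x > 0"
proof -
  have "ennreal (normal_density 0 s (x + of_int 0)) \<le> theta s x"
    unfolding theta_def by (rule nn_integral_ge_point) simp
  moreover have "normal_density 0 s (x + of_int 0) > 0" by (rule normal_density_pos[OF s])
  ultimately have "theta s x \<noteq> 0" by (metis ennreal_eq_0_iff le_zero_eq linorder_not_le)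
  thus ?thesis using theta_eq_rtheta[OF s, of x] rtheta_nonneg[of s x] by (metis ennreal_0 less_eq_real_def)
qed

lemma sum_int_normal_density:
  assumes "\<sigma> > 0" "s > 0"
  shows "sum_int (\<lambda>i. ennreal (normal_density \<mu> \<sigma> (\<theta> + s * of_int i))) = ennreal (rtheta (\<sigma> / s) ((\<theta> - \<mu>) / s) / s)"
proof -
  have "sum_int (\<lambda>i. ennreal (normal_density \<mu> \<sigma> (\<theta> + s * of_int i)))
    = sum_int (\<lambda>i. ennreal (1 / s) * ennreal (normal_density 0 (\<sigma> / s) ((\<theta> - \<mu>) / s + of_int i)))"
    unfolding normal_density_lattice[OF assms(2)] using assms
    by (intro nn_integral_cong) (simp add: ennreal_mult[symmetric])
  also have "\<dots> = ennreal (1 / s) * theta (\<sigma> / s) ((\<theta> - \<mu>) / s)"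
    unfolding theta_def by (rule nn_integral_cmult) simp
  also have "\<dots> = ennreal (rtheta (\<sigma> / s) ((\<theta> - \<mu>) / s) / s)"
    using assms rtheta_nonneg by (simp add: theta_eq_rtheta ennreal_mult[symmetric])
  finally show ?thesis .
qed

lemma infsum_normal_density:
  assumes "\<sigma> > 0" "s > 0"
  shows "(\<Sum>\<^sub>\<infinity>j::int. normal_density \<mu> \<sigma> (\<theta> + s * of_int j)) = rtheta (\<sigma> / s) ((\<theta> - \<mu>) / s) / s"
  using sum_int_normal_density[OF assms] rtheta_nonneg assms by (subst infsum_int_nonneg) auto

lemma sets_DG [simp, measurable_cong]: "sets (DG \<mu> \<sigma> \<theta> s) = sets borel"
  by (simp add: DG_def)

lemma nn_integral_DG:
  assumes "\<sigma> > 0" "s > 0" and [measurable]: "g \<in> borel_measurable borel"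
  shows "(\<integral>\<^sup>+t. g t \<partial>DG \<mu> \<sigma> \<theta> s) = sum_int (\<lambda>i. ennreal (normal_density \<mu> \<sigma> (\<theta> + s * of_int i) * s / rtheta (\<sigma> / s) ((\<theta> - \<mu>) / s)) * g (\<theta> + s * of_int i))"
  unfolding DG_def using assms
  by (subst nn_integral_distr) (auto simp: nn_integral_density infsum_normal_density)

text \<open>The lattice counterpart of \<open>nn_integral_normal_law_tilt\<close>. The value there
  is N, so the whole effect of discreteness is the ratio of two wrapped densities, each close to
  1.\<close>

lemma nn_integral_DG_tilt:
  assumes eq: "\<And>t. g t * normal_density \<mu> \<sigma> t = N * normal_density m k t"
    and pos: "\<sigma> > 0" "s > 0" "k > 0" "N \<ge> 0" "\<And>t. g t \<ge> 0"
    and [measurable]: "g \<in> borel_measurable borel"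
  shows "(\<integral>\<^sup>+t. ennreal (g t) \<partial>DG \<mu> \<sigma> \<theta> s) = ennreal (N * (rtheta (k / s) ((\<theta> - m) / s) / rtheta (\<sigma> / s) ((\<theta> - \<mu>) / s)))"
proof -
  let ?z = "rtheta (\<sigma> / s) ((\<theta> - \<mu>) / s)"
  have z: "?z > 0" using pos by (intro rtheta_pos) auto
  have "(\<integral>\<^sup>+t. ennreal (g t) \<partial>DG \<mu> \<sigma> \<theta> s)
    = sum_int (\<lambda>i. ennreal (N * s / ?z) * ennreal (normal_density m k (\<theta> + s * of_int i)))"
  proof (subst nn_integral_DG[OF pos(1,2)], measurable, rule nn_integral_cong)
    fix i :: int
    let ?t = "\<theta> + s * of_int i"
    have "normal_density \<mu> \<sigma> ?t * s / ?z * g ?t = (g ?t * normal_density \<mu> \<sigma> ?t) * s / ?z" by simp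
    also have "\<dots> = N * s / ?z * normal_density m k ?t" unfolding eq by simp
    finally show "ennreal (normal_density \<mu> \<sigma> ?t * s / ?z) * ennreal (g ?t) = ennreal (N * s / ?z) * ennreal (normal_density m k ?t)"
      using pos z by (simp add: ennreal_mult[symmetric])
  qed
  also have "\<dots> = ennreal (N * s / ?z) * ennreal (rtheta (k / s) ((\<theta> - m) / s) / s)"
    using pos by (simp add: nn_integral_cmult sum_int_normal_density)
  also have "\<dots> = ennreal (N * s / ?z * (rtheta (k / s) ((\<theta> - m) / s) / s))"
    using pos z rtheta_nonneg by (intro ennreal_mult[symmetric]) auto
  also have "N * s / ?z * (rtheta (k / s) ((\<theta> - m) / s) / s) = N * (rtheta (k / s) ((\<theta> - m) / s) / ?z)"
    using pos by simp
  finally show ?thesis .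
qed

lemma prob_space_DG:
  assumes "\<sigma> > 0" "s > 0" shows "prob_space (DG \<mu> \<sigma> \<theta> s)"
proof
  have "rtheta (\<sigma> / s) ((\<theta> - \<mu>) / s) > 0" using assms by (intro rtheta_pos) auto
  hence "(\<integral>\<^sup>+t. ennreal 1 \<partial>DG \<mu> \<sigma> \<theta> s) = 1"
    using assms by (subst nn_integral_DG_tilt[where N = 1 and m = \<mu> and k = \<sigma>]) auto
  thus "emeasure (DG \<mu> \<sigma> \<theta> s) (space (DG \<mu> \<sigma> \<theta> s)) = 1" by simp
qed

text \<open>A variance of at least 1/2 makes the rescaled exponent (k/s)^2/32 at least 1/(64 s^2),
  so both wrapped densities are within \<delta> of 1. As \<delta> \<le> 1/2, the denominator is at
  least 1/2 and the relative error is at most 2 \<delta>/(1/2).\<close>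

lemma rtheta_ratio:
  assumes \<sigma>: "\<sigma>\<^sup>2 \<ge> 1/2" "\<sigma> > 0" and k: "k\<^sup>2 \<ge> 1/2" "k > 0" and s: "0 < s" "s \<le> 1/1000"
  shows "\<bar>rtheta (k / s) x / rtheta (\<sigma> / s) y - 1\<bar> \<le> 4 * exp (- (1 / (64 * s\<^sup>2)))"
    and "rtheta (k / s) x / rtheta (\<sigma> / s) y \<le> 3"
proof -
  define \<delta> where "\<delta> = exp (- (1 / (64 * s\<^sup>2)))"
  have rtheta: "\<bar>rtheta (k / s) x - 1\<bar> \<le> \<delta>" if k: "k\<^sup>2 \<ge> 1/2" "k > 0" for k x
  proof -
    have "(1/2)\<^sup>2 \<le> k\<^sup>2" using k by (simp add: power2_eq_square)
    hence "1/2 \<le> k" using k by (simp add: power2_le_iff_abs_le)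
    hence "4 * s \<le> k" using s by simp
    hence "4 \<le> k / s" using s by (simp add: field_simps)
    hence "\<bar>rtheta (k / s) x - 1\<bar> \<le> exp (- ((k / s)\<^sup>2 / 32))" by (rule rtheta_exp_bound)
    also have "\<dots> \<le> \<delta>"
    proof -
      have "1 / (64 * s\<^sup>2) = (1/2) / s\<^sup>2 / 32" by simp
      also have "\<dots> \<le> k\<^sup>2 / s\<^sup>2 / 32" using k by (intro divide_right_mono) auto
      finally show ?thesis by (simp add: \<delta>_def power_divide)
    qed
    finally show ?thesis .
  qed
  have \<delta>: "\<delta> \<le> 1/2"
  proof -
    have "s\<^sup>2 \<le> (1/1000)\<^sup>2" using s by (intro power_mono) auto
    hence "64 * s\<^sup>2 \<le> 1" by (simp add: power2_eq_square)
    hence "1 \<le> 1 / (64 * s\<^sup>2)" using s by (simp add: field_simps)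
    hence "\<delta> \<le> exp (-1)" by (simp add: \<delta>_def)
    moreover have "exp (-1) \<le> 1 / (2::real)"
      unfolding exp_minus inverse_eq_divide using exp_ge_add_one_self[of "1::real"] by (intro divide_left_mono) auto
    ultimately show ?thesis by linarith
  qed
  have a: "\<bar>rtheta (k / s) x - 1\<bar> \<le> \<delta>" and b: "\<bar>rtheta (\<sigma> / s) y - 1\<bar> \<le> \<delta>" using rtheta k \<sigma> by auto
  have b2: "rtheta (\<sigma> / s) y \<ge> 1/2" using b \<delta> by linarith
  have "rtheta (k / s) x / rtheta (\<sigma> / s) y - 1 = (rtheta (k / s) x - rtheta (\<sigma> / s) y) / rtheta (\<sigma> / s) y"
    using b2 by (simp add: diff_divide_distrib)
  hence "\<bar>rtheta (k / s) x / rtheta (\<sigma> / s) y - 1\<bar> = \<bar>rtheta (k / s) x - rtheta (\<sigma> / s) y\<bar> / rtheta (\<sigma> / s) y"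
    using b2 by (simp add: abs_divide)
  also have "\<dots> \<le> (2 * \<delta>) / (1/2)" using a b b2 \<delta>_def by (intro frac_le) auto
  finally show "\<bar>rtheta (k / s) x / rtheta (\<sigma> / s) y - 1\<bar> \<le> 4 * exp (- (1 / (64 * s\<^sup>2)))" by (simp add: \<delta>_def)
  hence "rtheta (k / s) x / rtheta (\<sigma> / s) y \<le> 1 + 4 * \<delta>" unfolding \<delta>_def by linarith
  thus "rtheta (k / s) x / rtheta (\<sigma> / s) y \<le> 3" using \<delta> by linarith
qed

text \<open>For |b| \<le> 1/2 the kernel adds precision at most (1/4)/(3/4) = 1/3 to a precision of
  at most 4/3, so the tilted density still has variance at least 1/2, as \<open>rtheta_ratio\<close>
  demands.\<close>

lemma mehler_tilt:
  assumes b: "\<bar>b\<bar> \<le> 1/2" and \<sigma>: "\<sigma>\<^sup>2 \<ge> 3/4" "\<sigma> > 0"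
  obtains N m k where "\<And>t'. mehler b t t' * normal_density \<mu> \<sigma> t' = N * normal_density m k t'"
    "N \<ge> 0" "k\<^sup>2 \<ge> 1/2" "k > 0"
proof -
  have b2: "b\<^sup>2 \<le> 1/4" using power_mono[of "\<bar>b\<bar>" "1/2" 2] b by (simp add: power2_eq_square)
  define A where "A = 1 - b\<^sup>2"
  define p where "p = b\<^sup>2 / (2 * A)"
  define q where "q = b * t / A"
  define c where "c = exp (- (b\<^sup>2 * t\<^sup>2) / (2 * A)) / sqrt A"
  define w where "w = 1 / \<sigma>\<^sup>2 + 2 * p"
  have A: "A \<ge> 3/4" using b2 by (simp add: A_def)
  have p0: "p \<ge> 0" using A by (simp add: p_def)
  have w0: "w > 0" unfolding w_def using \<sigma> p0 by (intro add_pos_nonneg) auto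
  have "1 / \<sigma>\<^sup>2 \<le> 1 / (3/4)" using \<sigma> by (intro divide_left_mono) auto
  moreover have "2 * p \<le> (1/4) / (3/4)"
  proof -
    have "2 * p = b\<^sup>2 / A" by (simp add: p_def)
    also have "\<dots> \<le> (1/4) / (3/4)" using A b2 by (intro frac_le) auto
    finally show ?thesis .
  qed
  ultimately have w2: "w \<le> 2" by (simp add: w_def)
  have meh: "mehler b t t' = c * exp (- p * t'\<^sup>2 + q * t')" for t'
  proof -
    have "- (b\<^sup>2 * t\<^sup>2 + b\<^sup>2 * t'\<^sup>2 - 2 * b * t * t') / (2 * A) = - (b\<^sup>2 * t\<^sup>2) / (2 * A) + (- (b\<^sup>2 / (2 * A)) * t'\<^sup>2 + b * t / A * t')"
      using A by (simp add: field_simps)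
    thus ?thesis unfolding mehler_def c_def p_def q_def A_def[symmetric] by (simp add: exp_add[symmetric])
  qed
  show ?thesis
  proof (rule that)
    let ?N = "exp ((\<mu> / \<sigma>\<^sup>2 + q)\<^sup>2 / (2 * w) - \<mu>\<^sup>2 / (2 * \<sigma>\<^sup>2)) / (\<sigma> * sqrt w)"
    show "mehler b t t' * normal_density \<mu> \<sigma> t' = (c * ?N) * normal_density ((\<mu> / \<sigma>\<^sup>2 + q) / w) (1 / sqrt w) t'" for t'
      unfolding meh mult.assoc tilt_normal_density[OF \<sigma>(2) w_def w0] ..
    show "0 \<le> c * ?N" using A \<sigma> w0 by (simp add: c_def)
    show "1/2 \<le> (1 / sqrt w)\<^sup>2" using w0 w2 by (simp add: power_divide field_simps)
    show "1 / sqrt w > 0" using w0 by simp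
  qed
qed

text \<open>The lower bound on \<sigma>^2 comes from \<rho> \<le> 1/2. The spacing s stands for
  s/\<rho> in the conditional laws and for s itself in the label noise.\<close>

locale lattice_gaussian =
  fixes \<mu> \<sigma> \<theta> s :: real
  assumes \<sigma>: "\<sigma>\<^sup>2 \<ge> 3/4" "0 < \<sigma>" "\<sigma> \<le> 1" and s: "0 < s" "s \<le> 1/1000"
begin

abbreviation "A \<equiv> DG \<mu> \<sigma> \<theta> s"
abbreviation "B \<equiv> normal_law \<mu> \<sigma>"
definition "\<delta> = exp (- (1 / (64 * s\<^sup>2)))"
text \<open>The 6 is the product of the 2 in \<open>exp_square_tilt\<close> and the bound 3 on the
  ratio in \<open>rtheta_ratio\<close>.\<close>

definition "G = 6 * exp (\<mu>\<^sup>2 / 2)"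

lemma G_pos: "G \<ge> 0" by (simp add: G_def)

lemma A: "prob_space A" "sets A = sets borel" using \<sigma> s by (simp_all add: prob_space_DG)

lemma B: "prob_space B" "sets B = sets borel" using \<sigma> by (simp_all add: prob_space_normal_law)

lemma exp_moments:
  "(\<integral>\<^sup>+t. ennreal (exp (t\<^sup>2 / 4)) \<partial>A) \<le> ennreal G" "(\<integral>\<^sup>+t. ennreal (exp (t\<^sup>2 / 4)) \<partial>B) \<le> ennreal G"
proof -
  obtain N m k where N: "\<And>t. exp (t\<^sup>2 / 4) * normal_density \<mu> \<sigma> t = N * normal_density m k t"
    "k \<ge> \<sigma>" "N \<ge> 0" "N \<le> 2 * exp (\<mu>\<^sup>2 / 2)"
    using exp_square_tilt[OF \<sigma>(2,3), of \<mu>] by metis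
  have "\<sigma>\<^sup>2 \<le> k\<^sup>2" using N(2) \<sigma> by (intro power_mono) auto
  hence k: "k > 0" "k\<^sup>2 \<ge> 1/2" using N(2) \<sigma> by linarith+
  have "(\<integral>\<^sup>+t. ennreal (exp (t\<^sup>2 / 4)) \<partial>A) = ennreal (N * (rtheta (k / s) ((\<theta> - m) / s) / rtheta (\<sigma> / s) ((\<theta> - \<mu>) / s)))"
    using N k \<sigma> s by (intro nn_integral_DG_tilt[OF N(1)]) auto
  also have "\<dots> \<le> ennreal (2 * exp (\<mu>\<^sup>2 / 2) * 3)"
  proof (intro ennreal_leI mult_mono)
    show "rtheta (k / s) ((\<theta> - m) / s) / rtheta (\<sigma> / s) ((\<theta> - \<mu>) / s) \<le> 3"
      using \<sigma> k s by (intro rtheta_ratio(2)) auto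
  qed (use N rtheta_nonneg in \<open>auto intro!: divide_nonneg_nonneg\<close>)
  finally show "(\<integral>\<^sup>+t. ennreal (exp (t\<^sup>2 / 4)) \<partial>A) \<le> ennreal G" by (simp add: G_def)
  have "(\<integral>\<^sup>+t. ennreal (exp (t\<^sup>2 / 4)) \<partial>B) = ennreal N"
    using N k by (intro nn_integral_normal_law_tilt[OF N(1)]) auto
  also have "\<dots> \<le> ennreal G" using N(4) unfolding G_def by (intro ennreal_leI) (smt (verit) exp_ge_zero)
  finally show "(\<integral>\<^sup>+t. ennreal (exp (t\<^sup>2 / 4)) \<partial>B) \<le> ennreal G" .
qed

text \<open>The kernel times the normal density is a multiple N of a normal density; N is the
  integral under B, and N times a ratio of wrapped densities is the one under A. The error is
  relative, so the remaining variable can be integrated with the moment bounds for the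
  kernel.\<close>

lemma mehler_Diff_le:
  assumes b: "\<bar>b\<bar> \<le> 1/2"
  shows "\<bar>Diff A B (\<lambda>t'. mehler b t t')\<bar> \<le> 4 * \<delta> * (\<integral>t'. mehler b t t' \<partial>B)"
proof -
  have b2: "b\<^sup>2 < 1" using power_mono[of "\<bar>b\<bar>" "1/2" 2] b by (simp add: power2_eq_square)
  obtain N m k where N: "\<And>t'. mehler b t t' * normal_density \<mu> \<sigma> t' = N * normal_density m k t'"
    "N \<ge> 0" "k\<^sup>2 \<ge> 1/2" "k > 0"
    using mehler_tilt[OF b \<sigma>(1,2), of t \<mu>] by metis
  let ?r = "rtheta (k / s) ((\<theta> - m) / s) / rtheta (\<sigma> / s) ((\<theta> - \<mu>) / s)"
  have r0: "?r \<ge> 0" using rtheta_nonneg by auto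
  have "ennreal (\<integral>t'. mehler b t t' \<partial>A) = ennreal (N * ?r)"
    unfolding ennreal_integral_mehler[OF A b2, symmetric] using N \<sigma> s mehler_nonneg[OF b2]
    by (intro nn_integral_DG_tilt[OF N(1)]) auto
  hence 1: "(\<integral>t'. mehler b t t' \<partial>A) = N * ?r"
    using mult_nonneg_nonneg[OF N(2) r0] integral_mehler_nonneg[OF b2] by (subst (asm) ennreal_inj)
  have "ennreal (\<integral>t'. mehler b t t' \<partial>B) = ennreal N"
    unfolding ennreal_integral_mehler[OF B b2, symmetric] using N mehler_nonneg[OF b2]
    by (intro nn_integral_normal_law_tilt[OF N(1)]) auto
  hence 2: "(\<integral>t'. mehler b t t' \<partial>B) = N"
    using N integral_mehler_nonneg[OF b2] by (subst (asm) ennreal_inj) auto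
  have "Diff A B (\<lambda>t'. mehler b t t') = N * (?r - 1)" unfolding 1 2 by (simp add: algebra_simps)
  hence "\<bar>Diff A B (\<lambda>t'. mehler b t t')\<bar> = N * \<bar>?r - 1\<bar>" using N by (simp add: abs_mult)
  also have "\<dots> \<le> N * (4 * \<delta>)"
    unfolding \<delta>_def using N \<sigma> s by (intro mult_left_mono rtheta_ratio(1)) auto
  finally show ?thesis unfolding 2 by (simp add: mult.commute)
qed

text \<open>Cancellation is used in the inner variable only; the outer difference is split by the
  triangle inequality into its A part and its B part. For |b| \<le> 1/2 the singular factor is at
  most 2, so each part contributes 8 \<delta> G^2.\<close>

lemma corr_kernel_small:
  assumes b: "\<bar>b\<bar> \<le> 1/2" shows "\<bar>corr_kernel A B b\<bar> \<le> 16 * \<delta> * G\<^sup>2"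
proof -
  have b4: "b\<^sup>2 \<le> 1/4" using power_mono[of "\<bar>b\<bar>" "1/2" 2] b by (simp add: power2_eq_square)
  hence b2: "b\<^sup>2 < 1" by simp
  have \<delta>0: "\<delta> \<ge> 0" by (simp add: \<delta>_def)
  have le: "\<bar>\<integral>t. Diff A B (\<lambda>t'. mehler b t t') \<partial>C\<bar> \<le> 8 * \<delta> * G\<^sup>2"
    if C: "prob_space C" "sets C = sets borel" and GC: "(\<integral>\<^sup>+t. ennreal (exp (t\<^sup>2 / 4)) \<partial>C) \<le> ennreal G" for C
  proof -
    note iA = mehler_double_integral[OF C A GC exp_moments(1) G_pos b2]
    note iB = mehler_double_integral[OF C B GC exp_moments(2) G_pos b2]
    have "\<bar>\<integral>t. Diff A B (\<lambda>t'. mehler b t t') \<partial>C\<bar> \<le> (\<integral>t. \<bar>Diff A B (\<lambda>t'. mehler b t t')\<bar> \<partial>C)"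
      by (rule integral_abs_bound)
    also have "\<dots> \<le> (\<integral>t. 4 * \<delta> * (\<integral>t'. mehler b t t' \<partial>B) \<partial>C)"
      using iA(1) iB(1) by (intro integral_mono mehler_Diff_le[OF b]) auto
    also have "\<dots> = 4 * \<delta> * (\<integral>t. \<integral>t'. mehler b t t' \<partial>B \<partial>C)" by simp
    also have "\<dots> \<le> 4 * \<delta> * (G\<^sup>2 / sqrt (1 - b\<^sup>2))" using iB(3) \<delta>0 by (intro mult_left_mono) auto
    also have "\<dots> \<le> 4 * \<delta> * (G\<^sup>2 / (1/2))"
    proof (intro mult_left_mono divide_left_mono)
      have "sqrt ((1/2)\<^sup>2) \<le> sqrt (1 - b\<^sup>2)" using b4 by (intro real_sqrt_le_mono) (simp add: power2_eq_square)
      thus "1/2 \<le> sqrt (1 - b\<^sup>2)" by simp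
    qed (use b2 \<delta>0 in auto)
    finally show ?thesis by simp
  qed
  show ?thesis unfolding corr_kernel_def
    using le[OF A exp_moments(1)] le[OF B exp_moments(2)] by linarith
qed

lemma corr_kernel_le:
  assumes b2: "b\<^sup>2 < 1" shows "\<bar>corr_kernel A B b\<bar> \<le> 4 * G\<^sup>2 * (1 / sqrt (1 - b\<^sup>2))"
proof -
  note AA = mehler_double_integral[OF A A exp_moments(1) exp_moments(1) G_pos b2]
  note AB = mehler_double_integral[OF A B exp_moments(1) exp_moments(2) G_pos b2]
  note BA = mehler_double_integral[OF B A exp_moments(2) exp_moments(1) G_pos b2]
  note BB = mehler_double_integral[OF B B exp_moments(2) exp_moments(2) G_pos b2]
  have nn: "0 \<le> (\<integral>t. \<integral>t'. mehler b t t' \<partial>C \<partial>D)" for C D :: "real measure"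
    by (rule integral_nonneg_AE) (auto intro: integral_mehler_nonneg[OF b2])
  have "corr_kernel A B b = ((\<integral>t. \<integral>t'. mehler b t t' \<partial>A \<partial>A) - (\<integral>t. \<integral>t'. mehler b t t' \<partial>B \<partial>A))
     - ((\<integral>t. \<integral>t'. mehler b t t' \<partial>A \<partial>B) - (\<integral>t. \<integral>t'. mehler b t t' \<partial>B \<partial>B))"
    unfolding corr_kernel_def using AA(1) AB(1) BA(1) BB(1) by simp
  also have "\<bar>\<dots>\<bar> \<le> 4 * (G\<^sup>2 / sqrt (1 - b\<^sup>2))"
    using AA(3) AB(3) BA(3) BB(3) nn[of A A] nn[of A B] nn[of B A] nn[of B B] by linarith
  finally show ?thesis by simp
qed

text \<open>Pointwise, \<open>corr_kernel_small\<close> applies if the correlation is at most 1/2 in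
  absolute value and \<open>corr_kernel_le\<close> otherwise. The latter is averaged by
  \<open>nn_integral_correlation_tail\<close>, and 100 = 4 * 25.\<close>

lemma expectation_corr_kernel_le:
  assumes d: "d \<ge> 5" and a: "0 < a" "a < 1"
  shows "(\<integral>\<^sup>+v. \<integral>\<^sup>+w. ennreal \<bar>corr_kernel A B (a\<^sup>2 * dot d v w)\<bar> \<partial>unif_sphere d \<partial>unif_sphere d)
    \<le> ennreal (G\<^sup>2 * (16 * \<delta> + 100 * (4/5) powr ((real d - 5) / 2)))"
proof -
  interpret S: prob_space "unif_sphere d" by (rule prob_space_unif_sphere)
  have unit: "AE v in unif_sphere d. v \<in> space (Rd d) \<and> dot d v v = 1"
    using AE_unif_sphere_unit[of d] d AE_space[of "unif_sphere d"] by (auto elim: eventually_elim2)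
  have a2: "0 \<le> a\<^sup>2" "a\<^sup>2 < 1" using a by (auto simp: power_less_one_iff)
  let ?H = "\<lambda>r. if \<bar>r\<bar> > 1/2 then ennreal (1 / sqrt (1 - (a\<^sup>2 * r)\<^sup>2)) else 0"
  let ?c = "G\<^sup>2 * (16 * \<delta> + 100 * (4/5) powr ((real d - 5) / 2))"
  have \<delta>0: "\<delta> \<ge> 0" by (simp add: \<delta>_def)
  have "(\<integral>\<^sup>+v. \<integral>\<^sup>+w. ennreal \<bar>corr_kernel A B (a\<^sup>2 * dot d v w)\<bar> \<partial>unif_sphere d \<partial>unif_sphere d) \<le> (\<integral>\<^sup>+v. ennreal ?c \<partial>unif_sphere d)"
  proof (rule nn_integral_mono_AE, use unit in eventually_elim)
    case (elim v)
    hence [measurable]: "v \<in> space (Rd d)" by simp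
    have "(\<integral>\<^sup>+w. ennreal \<bar>corr_kernel A B (a\<^sup>2 * dot d v w)\<bar> \<partial>unif_sphere d)
       \<le> (\<integral>\<^sup>+w. ennreal (16 * \<delta> * G\<^sup>2) + ennreal (4 * G\<^sup>2) * ?H (dot d v w) \<partial>unif_sphere d)"
    proof (rule nn_integral_mono_AE, use unit in eventually_elim)
      case (elim w)
      show ?case
      proof (cases "\<bar>dot d v w\<bar> > 1/2")
        case True
        have lt: "(a\<^sup>2 * dot d v w)\<^sup>2 < 1"
          using elim \<open>v \<in> space (Rd d) \<and> dot d v v = 1\<close> a2 by (intro scaled_dot_square_less_1) auto
        have "ennreal \<bar>corr_kernel A B (a\<^sup>2 * dot d v w)\<bar> \<le> ennreal (4 * G\<^sup>2) * ?H (dot d v w)"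
          using True lt corr_kernel_le[OF lt] by (simp add: ennreal_mult[symmetric] ennreal_leI del: times_divide_eq_right)
        also have "\<dots> \<le> ennreal (16 * \<delta> * G\<^sup>2) + ennreal (4 * G\<^sup>2) * ?H (dot d v w)" by (simp add: add_increasing)
        finally show ?thesis .
      next
        case False
        have "\<bar>a\<^sup>2 * dot d v w\<bar> \<le> 1 * (1/2)" unfolding abs_mult using a2 False by (intro mult_mono) auto
        hence "ennreal \<bar>corr_kernel A B (a\<^sup>2 * dot d v w)\<bar> \<le> ennreal (16 * \<delta> * G\<^sup>2)"
          by (intro ennreal_leI corr_kernel_small) simp
        thus ?thesis using False by simp
      qed
    qed
    also have "\<dots> = ennreal (16 * \<delta> * G\<^sup>2) + ennreal (4 * G\<^sup>2) * (\<integral>\<^sup>+w. ?H (dot d v w) \<partial>unif_sphere d)"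
      using S.emeasure_space_1 by (simp add: nn_integral_add nn_integral_cmult)
    also have "\<dots> \<le> ennreal (16 * \<delta> * G\<^sup>2) + ennreal (4 * G\<^sup>2) * ennreal (25 * (4/5) powr ((real d - 5) / 2))"
      using elim a2 d by (intro add_left_mono mult_left_mono nn_integral_correlation_tail) auto
    also have "\<dots> = ennreal (16 * \<delta> * G\<^sup>2) + ennreal (4 * G\<^sup>2 * (25 * (4/5) powr ((real d - 5) / 2)))"
      by (subst ennreal_mult[symmetric, of "4 * G\<^sup>2"]) auto
    also have "\<dots> = ennreal (16 * \<delta> * G\<^sup>2 + 4 * G\<^sup>2 * (25 * (4/5) powr ((real d - 5) / 2)))"
      using \<delta>0 by (intro ennreal_plus[symmetric]) auto
    also have "16 * \<delta> * G\<^sup>2 + 4 * G\<^sup>2 * (25 * (4/5) powr ((real d - 5) / 2)) = ?c" by (simp add: algebra_simps)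
    finally show ?case .
  qed
  also have "\<dots> = ennreal ?c" using S.emeasure_space_1 by simp
  finally show ?thesis .
qed

lemma expectation_direction_le:
  assumes d: "d \<ge> 5" and f: "f \<in> borel_measurable (Rd d)" "\<And>x. x \<in> space (Rd d) \<Longrightarrow> 0 \<le> f x \<and> f x \<le> 1"
  shows "(\<integral>\<^sup>+v. ennreal \<bar>Diff A B (dirE d f v)\<bar> \<partial>unif_sphere d)
    \<le> ennreal (6 * sqrt (16 * \<delta> + 100 * (4/5) powr ((real d - 5) / 2)) * exp (\<mu>\<^sup>2 / 2))"
proof -
  let ?J = "G\<^sup>2 * (16 * \<delta> + 100 * (4/5) powr ((real d - 5) / 2))"
  have "direction_problem d A B G ?J"
    by (rule direction_problem.intro)
      (use d A B exp_moments G_pos expectation_corr_kernel_le[OF d] in \<open>auto simp: \<delta>_def\<close>)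
  then interpret direction_problem d A B G ?J .
  have "sqrt ?J = 6 * sqrt (16 * \<delta> + 100 * (4/5) powr ((real d - 5) / 2)) * exp (\<mu>\<^sup>2 / 2)"
    by (simp add: real_sqrt_mult G_def)
  thus ?thesis using expectation_Diff_le[OF f] by simp
qed

end

section \<open>Averaging over the label\<close>

lemma measurable_normal_law_kernel:
  assumes \<sigma>: "\<sigma> > 0" and [measurable]: "m \<in> borel_measurable M"
  shows "(\<lambda>y. normal_law (m y) \<sigma>) \<in> M \<rightarrow>\<^sub>M subprob_algebra borel"
proof (rule measurable_subprob_algebra)
  fix A :: "real set" assume [measurable]: "A \<in> sets borel"
  have "emeasure (normal_law (m y) \<sigma>) A = (\<integral>\<^sup>+t. ennreal (normal_density (m y) \<sigma> t) * indicator A t \<partial>lborel)" for y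
    unfolding normal_law_def by (rule emeasure_density) auto
  moreover have "(\<lambda>(y, t). ennreal (normal_density (m y) \<sigma> t)) \<in> borel_measurable (M \<Otimes>\<^sub>M lborel)"
    unfolding normal_density_def by measurable
  ultimately show "(\<lambda>y. emeasure (normal_law (m y) \<sigma>) A) \<in> borel_measurable M"
    by (simp add: lborel.borel_measurable_nn_integral)
qed (use \<sigma> in \<open>auto intro!: prob_space_imp_subprob_space prob_space_normal_law\<close>)

text \<open>For each Borel set the mass is a countable sum of measurable functions of y.
  Measurability of the kernel is what turns the bind in \<open>joint_law\<close> into an iterated
  integral.\<close>

lemma measurable_DG_kernel:
  assumes \<sigma>: "\<sigma> > 0" and s: "s > 0" and [measurable]: "m \<in> borel_measurable M" "\<theta> \<in> borel_measurable M"
  shows "(\<lambda>y. DG (m y) \<sigma> (\<theta> y) s) \<in> M \<rightarrow>\<^sub>M subprob_algebra borel"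
proof (rule measurable_subprob_algebra)
  fix A :: "real set" assume [measurable]: "A \<in> sets borel"
  have "emeasure (DG (m y) \<sigma> (\<theta> y) s) A = sum_int (\<lambda>i. ennreal (normal_density (m y) \<sigma> (\<theta> y + s * of_int i) * s
      / rtheta (\<sigma> / s) ((\<theta> y - m y) / s)) * indicator A (\<theta> y + s * of_int i))" for y
    using nn_integral_DG[OF \<sigma> s, of "indicator A" "m y" "\<theta> y"] by (simp add: nn_integral_indicator)
  moreover have "(\<lambda>y. sum_int (\<lambda>i. ennreal (normal_density (m y) \<sigma> (\<theta> y + s * of_int i) * s
      / rtheta (\<sigma> / s) ((\<theta> y - m y) / s)) * indicator A (\<theta> y + s * of_int i))) \<in> borel_measurable M"
    unfolding normal_density_def by (intro borel_measurable_sum_int) measurable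
  ultimately show "(\<lambda>y. emeasure (DG (m y) \<sigma> (\<theta> y) s) A) \<in> borel_measurable M"
    by simp
qed (use \<sigma> s in \<open>auto intro!: prob_space_imp_subprob_space prob_space_DG\<close>)

text \<open>The conditional mean of f given the label y, that is, its mean over x under
  \<open>hidden_dir d v (K y)\<close>.\<close>

definition condE :: "nat \<Rightarrow> ((nat \<Rightarrow> real) \<times> real \<Rightarrow> real) \<Rightarrow> (real \<Rightarrow> real measure) \<Rightarrow> (nat \<Rightarrow> real) \<Rightarrow> real \<Rightarrow> real" where
  "condE d f K v y = (\<integral>t. dirE d (\<lambda>x. f (x, y)) v t \<partial>K y)"

context
  fixes d :: nat and f :: "(nat \<Rightarrow> real) \<times> real \<Rightarrow> real" and K :: "real \<Rightarrow> real measure"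
  assumes f[measurable]: "f \<in> borel_measurable (Rd d \<Otimes>\<^sub>M borel)"
    and f01: "\<And>z. z \<in> space (Rd d \<Otimes>\<^sub>M borel) \<Longrightarrow> 0 \<le> f z \<and> f z \<le> 1"
    and K[measurable]: "K \<in> borel \<rightarrow>\<^sub>M subprob_algebra borel" and Kp: "\<And>y. prob_space (K y)"
begin

lemma sets_K: "sets (K y) = sets borel"
  using sets_kernel[OF K] by simp

lemma slice_measurable: "(\<lambda>x. f (x, y)) \<in> borel_measurable (Rd d)"
  by measurable

lemma slice_unit: "x \<in> space (Rd d) \<Longrightarrow> 0 \<le> f (x, y) \<and> f (x, y) \<le> 1"
  using f01[of "(x, y)"] by (simp add: space_pair_measure)

lemma condE_unit: assumes v: "v \<in> space (Rd d)" shows "0 \<le> condE d f K v y \<and> condE d f K v y \<le> 1"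
proof -
  interpret prob_space "K y" by (rule Kp)
  have [measurable]: "v \<in> space (Rd d)" by fact
  note sets_K[measurable_cong] slice_measurable[measurable]
  show ?thesis unfolding condE_def
    using dirE_unit[OF slice_measurable slice_unit v, of y] by (auto intro!: expectation_in_unit)
qed

lemma nn_integral_condE:
  assumes v: "v \<in> space (Rd d)"
  shows "(\<integral>\<^sup>+t. \<integral>\<^sup>+g. ennreal (f (place d v t g, y)) \<partial>std_gaussian d \<partial>K y) = ennreal (condE d f K v y)"
proof -
  interpret prob_space "K y" by (rule Kp)
  interpret X: prob_space "std_gaussian d" by (rule prob_space_std_gaussian)
  have [measurable]: "v \<in> space (Rd d)" by fact
  note sets_K[measurable_cong] slice_measurable[measurable]
  have "(\<integral>\<^sup>+g. ennreal (f (place d v t g, y)) \<partial>std_gaussian d) = ennreal (dirE d (\<lambda>x. f (x, y)) v t)" for t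
    unfolding dirE_def using slice_unit by (intro X.ennreal_expectation_unit) auto
  thus ?thesis unfolding condE_def
    using dirE_unit[OF slice_measurable slice_unit v, of y] by (simp add: ennreal_expectation_unit)
qed

text \<open>Integration against a measurable kernel is available for \<open>ennreal\<close>
  integrands; as all values lie in the unit interval, the result transfers to the real
  integral.\<close>

lemma measurable_condE:
  "(\<lambda>(v, y). condE d f K v y) \<in> borel_measurable (Rd d \<Otimes>\<^sub>M borel)"
proof -
  interpret X: prob_space "std_gaussian d" by (rule prob_space_std_gaussian)
  have m: "(\<lambda>z. \<integral>\<^sup>+t. \<integral>\<^sup>+g. ennreal (f (place d (fst z) t g, snd z)) \<partial>std_gaussian d \<partial>K (snd z)) \<in> borel_measurable (Rd d \<Otimes>\<^sub>M borel)"
    by (rule nn_integral_measurable_subprob_algebra2[where N = borel]) measurable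
  have "(\<lambda>z. enn2real (\<integral>\<^sup>+t. \<integral>\<^sup>+g. ennreal (f (place d (fst z) t g, snd z)) \<partial>std_gaussian d \<partial>K (snd z))) \<in> borel_measurable (Rd d \<Otimes>\<^sub>M borel)"
    using m by measurable
  also have "?this \<longleftrightarrow> ?thesis"
    by (rule measurable_cong) (auto simp: space_pair_measure nn_integral_condE condE_unit)
  finally show ?thesis .
qed

lemma integral_joint_law:
  assumes v: "v \<in> space (Rd d)" and R: "prob_space R" "sets R = sets borel"
  shows "(\<integral>z. f z \<partial>joint_law d v R K) = (\<integral>y. condE d f K v y \<partial>R)"
proof -
  interpret R: prob_space R by fact
  interpret X: prob_space "std_gaussian d" by (rule prob_space_std_gaussian)
  have [measurable]: "v \<in> space (Rd d)" by fact
  have [measurable_cong]: "sets R = sets borel" by fact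
  note sets_K[measurable_cong]
  have Ksp: "space (K y) = UNIV" for y using sets_eq_imp_space_eq[OF sets_K] by simp
  \<comment> \<open>The nested images in \<open>hidden_dir\<close> and \<open>joint_law\<close> are
    merged into one image of a product measure, so that measurability of L in y follows from that of
    K.\<close>
  define L where "L y = distr (K y \<Otimes>\<^sub>M std_gaussian d) (Rd d \<Otimes>\<^sub>M borel) (\<lambda>z. (place d v (fst z) (snd z), y))" for y
  have L: "distr (hidden_dir d v (K y)) (Rd d \<Otimes>\<^sub>M borel) (\<lambda>x. (x, y)) = L y" for y
  proof -
    have "hidden_dir d v (K y) = distr (K y \<Otimes>\<^sub>M std_gaussian d) (Rd d) (\<lambda>z. place d v (fst z) (snd z))"
      unfolding hidden_dir_def place_def by (simp add: split_beta')
    moreover have "(\<lambda>z. place d v (fst z) (snd z)) \<in> K y \<Otimes>\<^sub>M std_gaussian d \<rightarrow>\<^sub>M Rd d" by measurable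
    ultimately show ?thesis unfolding L_def by (simp add: distr_distr comp_def)
  qed
  have c: "(\<lambda>y. std_gaussian d) \<in> borel \<rightarrow>\<^sub>M subprob_algebra (Rd d)"
    using prob_space_imp_subprob_space[OF prob_space_std_gaussian] sets_std_gaussian
    by (intro measurable_const) (subst space_subprob_algebra, blast)
  have "(\<lambda>y. K y \<Otimes>\<^sub>M std_gaussian d) \<in> borel \<rightarrow>\<^sub>M subprob_algebra (borel \<Otimes>\<^sub>M Rd d)"
    by (rule measurable_pair_measure[OF K c])
  hence Lm: "L \<in> borel \<rightarrow>\<^sub>M subprob_algebra (Rd d \<Otimes>\<^sub>M borel)"
    unfolding L_def[abs_def] by (intro measurable_distr2) measurable
  hence Lm': "L \<in> R \<rightarrow>\<^sub>M subprob_algebra (Rd d \<Otimes>\<^sub>M borel)"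
    using measurable_cong_sets[OF R(2) refl] by blast
  have jl: "joint_law d v R K = R \<bind> L" unfolding joint_law_def L by (simp add: L_def[abs_def])
  have sj: "sets (joint_law d v R K) = sets (Rd d \<Otimes>\<^sub>M borel)"
    unfolding jl using R.not_empty by (intro sets_bind) (auto simp: L_def)
  have [measurable_cong]: "sets (joint_law d v R K) = sets (Rd d \<Otimes>\<^sub>M borel)" by fact
  have "(\<integral>\<^sup>+z. ennreal (f z) \<partial>joint_law d v R K) = (\<integral>\<^sup>+y. \<integral>\<^sup>+z. ennreal (f z) \<partial>L y \<partial>R)"
    unfolding jl by (rule nn_integral_bind[OF _ Lm']) measurable
  also have "\<dots> = (\<integral>\<^sup>+y. ennreal (condE d f K v y) \<partial>R)"
  proof (rule nn_integral_cong)
    fix y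
    interpret Ky: prob_space "K y" by (rule Kp)
    have "(\<integral>\<^sup>+z. ennreal (f z) \<partial>L y) = (\<integral>\<^sup>+z. ennreal (f (place d v (fst z) (snd z), y)) \<partial>(K y \<Otimes>\<^sub>M std_gaussian d))"
      unfolding L_def by (subst nn_integral_distr) auto
    also have "\<dots> = (\<integral>\<^sup>+t. \<integral>\<^sup>+g. ennreal (f (place d v t g, y)) \<partial>std_gaussian d \<partial>K y)"
      by (subst X.nn_integral_fst[symmetric]) auto
    finally show "(\<integral>\<^sup>+z. ennreal (f z) \<partial>L y) = ennreal (condE d f K v y)" by (simp add: nn_integral_condE[OF v])
  qed
  also have "\<dots> = ennreal (\<integral>y. condE d f K v y \<partial>R)"
  proof (rule R.ennreal_expectation_unit)
    show "(\<lambda>y. condE d f K v y) \<in> borel_measurable R"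
      using measurable_compose_Pair1[OF v measurable_condE] measurable_cong_sets[OF R(2) refl] by simp
  qed (rule condE_unit[OF v])
  finally have eq: "(\<integral>\<^sup>+z. ennreal (f z) \<partial>joint_law d v R K) = ennreal (\<integral>y. condE d f K v y \<partial>R)" .
  have "(\<integral>z. f z \<partial>joint_law d v R K) = enn2real (\<integral>\<^sup>+z. ennreal (f z) \<partial>joint_law d v R K)"
    using f01 sets_eq_imp_space_eq[OF sj] by (intro integral_eq_nn_integral) auto
  thus ?thesis unfolding eq using condE_unit[OF v] by (simp add: integral_nonneg_AE)
qed

end

lemma label_law:
  assumes \<rho>: "\<rho> > 0" and \<sigma>: "\<sigma> > 0" and s: "s > 0"
  shows "prob_space (label_law \<rho> \<sigma> s)" "sets (label_law \<rho> \<sigma> s) = sets borel"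
proof -
  interpret N: prob_space "normal_law 0 \<rho>" using \<rho> by (rule prob_space_normal_law)
  interpret E: prob_space "DG 0 \<sigma> 0 s" using \<sigma> s by (rule prob_space_DG)
  interpret pair_prob_space "normal_law 0 \<rho>" "DG 0 \<sigma> 0 s" ..
  have [measurable_cong]: "sets (DG 0 \<sigma> 0 s) = sets borel" by simp
  show "prob_space (label_law \<rho> \<sigma> s)" unfolding label_law_def convolution_def
    by (rule prob_space_distr) measurable
  show "sets (label_law \<rho> \<sigma> s) = sets borel" by (simp add: label_law_def)
qed

text \<open>The bound at label y grows like exp(\<mu>^2/2) with \<mu> = \<rho> y. For \<rho> \<le>
  1/2 the exponent is at most (x^2 + z^2)/4, where y = x + z, and the moments of the two independent
  summands are at most 2 and 6.\<close>

lemma label_law_exp_moment: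
  assumes \<rho>: "0 < \<rho>" "\<rho> \<le> 1/2" and \<sigma>: "\<sigma>\<^sup>2 \<ge> 3/4" "0 < \<sigma>" "\<sigma> \<le> 1" and s: "0 < s" "s \<le> 1/1000"
  shows "(\<integral>\<^sup>+y. ennreal (exp ((\<rho> * y)\<^sup>2 / 2)) \<partial>label_law \<rho> \<sigma> s) \<le> ennreal 12"
proof -
  interpret N: prob_space "normal_law 0 \<rho>" using \<rho> by (intro prob_space_normal_law)
  interpret E: prob_space "DG 0 \<sigma> 0 s" using \<sigma> s by (intro prob_space_DG)
  interpret lattice_gaussian 0 \<sigma> 0 s using \<sigma> s by unfold_locales
  have [measurable_cong]: "sets (DG 0 \<sigma> 0 s) = sets borel" by simp
  have "(\<integral>\<^sup>+y. ennreal (exp ((\<rho> * y)\<^sup>2 / 2)) \<partial>label_law \<rho> \<sigma> s)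
    = (\<integral>\<^sup>+x. \<integral>\<^sup>+z. ennreal (exp ((\<rho> * (x + z))\<^sup>2 / 2)) \<partial>DG 0 \<sigma> 0 s \<partial>normal_law 0 \<rho>)"
    unfolding label_law_def
    by (rule nn_integral_convolution) (auto intro: N.finite_measure_axioms E.finite_measure_axioms)
  also have "\<dots> \<le> (\<integral>\<^sup>+x. \<integral>\<^sup>+z. ennreal (exp (x\<^sup>2 / 4)) * ennreal (exp (z\<^sup>2 / 4)) \<partial>DG 0 \<sigma> 0 s \<partial>normal_law 0 \<rho>)"
  proof (intro nn_integral_mono)
    fix x z :: real
    have "\<rho>\<^sup>2 \<le> (1/2)\<^sup>2" using \<rho> by (intro power_mono) auto
    hence r: "\<rho>\<^sup>2 \<le> 1/4" by (simp add: power2_eq_square)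
    have "(\<rho> * (x + z))\<^sup>2 / 2 = \<rho>\<^sup>2 * ((x + z)\<^sup>2 / 2)" by (simp add: power_mult_distrib)
    also have "\<dots> \<le> 1/4 * (x\<^sup>2 + z\<^sup>2)"
    proof (rule mult_mono[OF r])
      show "(x + z)\<^sup>2 / 2 \<le> x\<^sup>2 + z\<^sup>2" using sum_squares_bound[of x z] by (simp add: power2_sum)
    qed auto
    finally have "exp ((\<rho> * (x + z))\<^sup>2 / 2) \<le> exp (x\<^sup>2 / 4) * exp (z\<^sup>2 / 4)" by (simp flip: exp_add)
    thus "ennreal (exp ((\<rho> * (x + z))\<^sup>2 / 2)) \<le> ennreal (exp (x\<^sup>2 / 4)) * ennreal (exp (z\<^sup>2 / 4))"
      by (simp add: ennreal_leI flip: ennreal_mult)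
  qed
  also have "\<dots> = (\<integral>\<^sup>+x. ennreal (exp (x\<^sup>2 / 4)) \<partial>normal_law 0 \<rho>) * (\<integral>\<^sup>+z. ennreal (exp (z\<^sup>2 / 4)) \<partial>DG 0 \<sigma> 0 s)"
    by (simp add: nn_integral_cmult nn_integral_multc)
  also have "\<dots> \<le> ennreal 2 * ennreal 6"
  proof (rule mult_mono)
    have r1: "\<rho> \<le> 1" using \<rho> by simp
    obtain N m k where N: "\<And>t. exp (t\<^sup>2 / 4) * normal_density 0 \<rho> t = N * normal_density m k t"
      "k \<ge> \<rho>" "N \<ge> 0" "N \<le> 2 * exp (0\<^sup>2 / 2)"
      using exp_square_tilt[OF \<rho>(1) r1, of 0] by metis
    have "(\<integral>\<^sup>+x. ennreal (exp (x\<^sup>2 / 4)) \<partial>normal_law 0 \<rho>) = ennreal N"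
      using N \<rho> by (intro nn_integral_normal_law_tilt[OF N(1)]) auto
    also have "\<dots> \<le> ennreal 2" using N(4) by (intro ennreal_leI) simp
    finally show "(\<integral>\<^sup>+x. ennreal (exp (x\<^sup>2 / 4)) \<partial>normal_law 0 \<rho>) \<le> ennreal 2" .
    show "(\<integral>\<^sup>+z. ennreal (exp (z\<^sup>2 / 4)) \<partial>DG 0 \<sigma> 0 s) \<le> ennreal 6"
      using exp_moments(1) by (simp add: G_def)
  qed auto
  also have "\<dots> = ennreal 12" by (simp flip: ennreal_mult)
  finally show ?thesis .
qed

text \<open>The average over v is moved inside the average over the label by Tonelli; at a fixed y
  the lattice estimate applies with mean \<rho> y and spacing s/\<rho>. The constant 72 is 6 times
  the label moment 12, and Markov's inequality divides by \<kappa>.\<close>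

lemma Q_T_deviation:
  assumes d: "d \<ge> 5" and \<rho>: "0 < \<rho>" "\<rho> \<le> 1/2" and \<sigma>_def: "\<sigma> = sqrt (1 - \<rho>\<^sup>2)" and s: "0 < s" "s / \<rho> \<le> 1/1000"
    and f: "f \<in> borel_measurable (Rd d \<Otimes>\<^sub>M borel)"
    and f01: "\<And>z. z \<in> space (Rd d \<Otimes>\<^sub>M borel) \<Longrightarrow> 0 \<le> f z \<and> f z \<le> 1" and \<kappa>: "\<kappa> > 0"
  shows "\<P>(v in unif_sphere d. \<bar>(\<integral>z. f z \<partial>Q_law d \<rho> \<sigma> s v) - (\<integral>z. f z \<partial>T_law d \<rho> \<sigma> s v)\<bar> \<ge> \<kappa>)
    \<le> 72 * sqrt (16 * exp (- (\<rho>\<^sup>2 / (64 * s\<^sup>2))) + 100 * (4/5) powr ((real d - 5) / 2)) / \<kappa>"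
proof -
  have "\<rho>\<^sup>2 \<le> (1/2)\<^sup>2" using \<rho> by (intro power_mono) auto
  hence r2: "\<rho>\<^sup>2 \<le> 1/4" by (simp add: power2_eq_square)
  have \<sigma>: "\<sigma>\<^sup>2 \<ge> 3/4" "0 < \<sigma>" "\<sigma> \<le> 1" using r2 by (simp_all add: \<sigma>_def)
  have s': "s \<le> 1/1000"
  proof -
    have "s \<le> \<rho> / 1000" using s \<rho> by (simp add: field_simps)
    thus ?thesis using \<rho> by simp
  qed
  define R where "R = label_law \<rho> \<sigma> s"
  have R: "prob_space R" "sets R = sets borel" unfolding R_def using label_law[OF \<rho>(1) \<sigma>(2) s(1)] by auto
  interpret R: prob_space R by fact
  interpret S: prob_space "unif_sphere d" by (rule prob_space_unif_sphere)
  interpret P: pair_prob_space "unif_sphere d" R ..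
  have [measurable_cong]: "sets R = sets borel" by fact
  define KA where "KA y = DG (\<rho> * y) \<sigma> (y / \<rho>) (s / \<rho>)" for y
  define KB where "KB y = normal_law (\<rho> * y) \<sigma>" for y
  have KA: "KA \<in> borel \<rightarrow>\<^sub>M subprob_algebra borel" "\<And>y. prob_space (KA y)"
    unfolding KA_def[abs_def] using \<sigma> s \<rho> by (auto intro!: measurable_DG_kernel prob_space_DG)
  have KB: "KB \<in> borel \<rightarrow>\<^sub>M subprob_algebra borel" "\<And>y. prob_space (KB y)"
    unfolding KB_def[abs_def] using \<sigma> by (auto intro!: measurable_normal_law_kernel prob_space_normal_law)
  note mA = measurable_condE[OF f f01 KA]
  note mB = measurable_condE[OF f f01 KB]
  let ?c = "6 * sqrt (16 * exp (- (\<rho>\<^sup>2 / (64 * s\<^sup>2))) + 100 * (4/5) powr ((real d - 5) / 2))"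
  define g where "g v = (\<integral>y. condE d f KA v y - condE d f KB v y \<partial>R)" for v
  have RR: "borel_measurable (Rd d \<Otimes>\<^sub>M R) = borel_measurable (Rd d \<Otimes>\<^sub>M borel)"
    by (intro measurable_cong_sets sets_pair_measure_cong R(2) refl)
  have [measurable]: "(\<lambda>z. condE d f KA (fst z) (snd z)) \<in> borel_measurable (Rd d \<Otimes>\<^sub>M R)"
      "(\<lambda>z. condE d f KB (fst z) (snd z)) \<in> borel_measurable (Rd d \<Otimes>\<^sub>M R)"
    unfolding RR using mA mB by (simp_all add: split_beta')
  have [measurable]: "g \<in> borel_measurable (Rd d)" unfolding g_def by measurable
  have i: "integrable R (\<lambda>y. condE d f K v y)" if v: "v \<in> space (Rd d)"
    and K: "K \<in> borel \<rightarrow>\<^sub>M subprob_algebra borel" "\<And>y. prob_space (K y)" for v K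
    using condE_unit[OF f f01 K v] measurable_compose_Pair1[OF v measurable_condE[OF f f01 K]] measurable_cong_sets[OF R(2) refl]
    by (intro R.integrable_const_bound[where B = 1]) auto
  have g: "(\<integral>z. f z \<partial>Q_law d \<rho> \<sigma> s v) - (\<integral>z. f z \<partial>T_law d \<rho> \<sigma> s v) = g v" if v: "v \<in> space (Rd d)" for v
    unfolding Q_law_def T_law_def g_def KA_def[abs_def, symmetric] KB_def[abs_def, symmetric] R_def[symmetric]
    using i[OF v KA] i[OF v KB] integral_joint_law[OF f f01 KA v R] integral_joint_law[OF f f01 KB v R] by simp
  have "(\<integral>\<^sup>+v. ennreal \<bar>g v\<bar> \<partial>unif_sphere d)
    \<le> (\<integral>\<^sup>+v. \<integral>\<^sup>+y. ennreal \<bar>condE d f KA v y - condE d f KB v y\<bar> \<partial>R \<partial>unif_sphere d)"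
  proof (rule nn_integral_mono)
    fix v assume "v \<in> space (unif_sphere d)"
    hence v: "v \<in> space (Rd d)" by simp
    show "ennreal \<bar>g v\<bar> \<le> (\<integral>\<^sup>+y. ennreal \<bar>condE d f KA v y - condE d f KB v y\<bar> \<partial>R)"
      unfolding g_def using integral_norm_bound_ennreal[of R "\<lambda>y. condE d f KA v y - condE d f KB v y"] i[OF v KA] i[OF v KB] by simp
  qed
  also have "\<dots> = (\<integral>\<^sup>+y. \<integral>\<^sup>+v. ennreal \<bar>condE d f KA v y - condE d f KB v y\<bar> \<partial>unif_sphere d \<partial>R)"
    by (rule P.Fubini'[symmetric]) measurable
  also have "\<dots> \<le> (\<integral>\<^sup>+y. ennreal ?c * ennreal (exp ((\<rho> * y)\<^sup>2 / 2)) \<partial>R)"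
  proof (rule nn_integral_mono)
    fix y
    interpret lattice_gaussian "\<rho> * y" \<sigma> "y / \<rho>" "s / \<rho>"
      using \<sigma> s \<rho> by unfold_locales auto
    have "(\<integral>\<^sup>+v. ennreal \<bar>condE d f KA v y - condE d f KB v y\<bar> \<partial>unif_sphere d)
      \<le> ennreal (6 * sqrt (16 * \<delta> + 100 * (4/5) powr ((real d - 5) / 2)) * exp ((\<rho> * y)\<^sup>2 / 2))"
      unfolding condE_def KA_def KB_def
      using slice_measurable[OF f f01 KA, of y] slice_unit[OF f f01 KA, of _ y] by (intro expectation_direction_le[OF d]) auto
    also have "\<delta> = exp (- (\<rho>\<^sup>2 / (64 * s\<^sup>2)))" by (simp add: \<delta>_def power_divide)
    finally show "(\<integral>\<^sup>+v. ennreal \<bar>condE d f KA v y - condE d f KB v y\<bar> \<partial>unif_sphere d)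
      \<le> ennreal ?c * ennreal (exp ((\<rho> * y)\<^sup>2 / 2))" by (simp add: ennreal_mult)
  qed
  also have "\<dots> = ennreal ?c * (\<integral>\<^sup>+y. ennreal (exp ((\<rho> * y)\<^sup>2 / 2)) \<partial>R)"
    by (rule nn_integral_cmult) measurable
  also have "\<dots> \<le> ennreal ?c * ennreal 12"
    unfolding R_def by (intro mult_left_mono label_law_exp_moment \<rho> \<sigma> s s') auto
  also have "\<dots> = ennreal (12 * ?c)" by (subst ennreal_mult[symmetric]) auto
  finally have le: "(\<integral>\<^sup>+v. ennreal \<bar>g v\<bar> \<partial>unif_sphere d) \<le> ennreal (12 * ?c)" .
  define E where "E = {v \<in> space (Rd d). \<bar>g v\<bar> \<ge> \<kappa>}"
  have [measurable]: "E \<in> sets (Rd d)" unfolding E_def by measurable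
  have "ennreal (\<kappa> * measure (unif_sphere d) E) = (\<integral>\<^sup>+v. ennreal \<kappa> * indicator E v \<partial>unif_sphere d)"
    using \<kappa> by (simp add: nn_integral_cmult_indicator S.emeasure_eq_measure ennreal_mult)
  also have "\<dots> \<le> (\<integral>\<^sup>+v. ennreal \<bar>g v\<bar> \<partial>unif_sphere d)"
    by (intro nn_integral_mono) (auto simp: E_def indicator_def intro!: ennreal_leI)
  also note le
  finally have "\<kappa> * measure (unif_sphere d) E \<le> 12 * ?c" by (subst (asm) ennreal_le_iff) auto
  hence "measure (unif_sphere d) E \<le> 12 * ?c / \<kappa>" using \<kappa> by (simp add: field_simps)
  moreover have "{v \<in> space (unif_sphere d). \<bar>(\<integral>z. f z \<partial>Q_law d \<rho> \<sigma> s v) - (\<integral>z. f z \<partial>T_law d \<rho> \<sigma> s v)\<bar> \<ge> \<kappa>} = E"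
    unfolding E_def using g by auto
  ultimately show ?thesis by simp
qed

section \<open>Conclusion\<close>

text \<open>Applied with L = ln (d/\<alpha>), l = ln d and x = \<rho>^2/s^2. Both error terms are at
  most a small multiple of exp(-4 L^3); the square root halves the exponent and the threshold takes
  L^3 of what is left.\<close>

lemma deviation_numeric:
  fixes L x l :: real
  assumes L: "L \<ge> 300" and x: "x \<ge> L ^ 4" and d: "4 * L ^ 3 + 20 \<le> (real d - 5) / 10"
    and l: "0 \<le> l" "l \<le> L"
  shows "72 * sqrt (16 * exp (- (x / 64)) + 100 * (4/5) powr ((real d - 5) / 2)) / exp (- (L ^ 3)) \<le> exp (- (l ^ 3))"
proof -
  have "(2::real) ^ 20 \<le> exp 1 ^ 20" using exp_ge_add_one_self[of "1::real"] by (intro power_mono) auto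
  hence e20: "1048576 \<le> exp (20::real)" by (simp flip: exp_of_nat_mult)
  have L3: "L ^ 3 \<ge> 300" using power_mono[of 300 L 3] L by simp
  have small: "exp (- y) \<le> exp (- (4 * L ^ 3)) / 1048576" if "4 * L ^ 3 + 20 \<le> y" for y
  proof -
    have "exp (- y) \<le> exp (- (4 * L ^ 3)) * exp (- 20)" using that by (simp flip: exp_add)
    also have "\<dots> = exp (- (4 * L ^ 3)) / exp 20" by (simp add: exp_minus field_simps)
    also have "\<dots> \<le> exp (- (4 * L ^ 3)) / 1048576" using e20 by (intro divide_left_mono) auto
    finally show ?thesis .
  qed
  have "4 * L ^ 3 + 20 \<le> x / 64"
  proof -
    have "L ^ 4 = L * L ^ 3" by (simp add: numeral_eq_Suc)
    moreover have "300 * L ^ 3 \<le> L * L ^ 3" using L L3 by (intro mult_right_mono) auto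
    ultimately show ?thesis using x L3 by linarith
  qed
  hence 1: "exp (- (x / 64)) \<le> exp (- (4 * L ^ 3)) / 1048576" by (rule small)
  have 2: "(4/5) powr ((real d - 5) / 2) \<le> exp (- (4 * L ^ 3)) / 1048576"
  proof -
    have "ln (4/5::real) \<le> 4/5 - 1" by (rule ln_le_minus_one) simp
    hence "(real d - 5) / 2 * ln (4/5) \<le> (real d - 5) / 2 * (4/5 - 1)"
      using d L3 by (intro mult_left_mono) auto
    also have "\<dots> = - ((real d - 5) / 10)" by simp
    finally have "(4/5) powr ((real d - 5) / 2) \<le> exp (- ((real d - 5) / 10))" by (simp add: powr_def)
    also have "\<dots> \<le> exp (- (4 * L ^ 3)) / 1048576" by (rule small[OF d])
    finally show ?thesis .
  qed
  have "16 * exp (- (x / 64)) + 100 * (4/5) powr ((real d - 5) / 2) \<le> exp (- (4 * L ^ 3)) / 72\<^sup>2"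
  proof -
    \<comment> \<open>This rests on 116 * 72^2 < 2^20 = 1048576, with 2^20 \<le> exp 20: the
      additive 20 in the exponents pays for all numerical constants.\<close>
    have "16 * a + 100 * b \<le> e / 72\<^sup>2" if "a \<le> e / 1048576" "b \<le> e / 1048576" "e \<ge> 0" for a b e :: real
      using that by simp
    from this[OF 1 2 exp_ge_zero] show ?thesis .
  qed
  also have "\<dots> = (exp (- (2 * L ^ 3)) / 72)\<^sup>2"
    by (simp add: power_divide flip: exp_double)
  finally have "sqrt (16 * exp (- (x / 64)) + 100 * (4/5) powr ((real d - 5) / 2)) \<le> exp (- (2 * L ^ 3)) / 72"
    by (intro real_le_lsqrt) auto
  hence "72 * sqrt (16 * exp (- (x / 64)) + 100 * (4/5) powr ((real d - 5) / 2)) / exp (- (L ^ 3)) \<le> exp (- (2 * L ^ 3)) / exp (- (L ^ 3))"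
    by (intro divide_right_mono) auto
  also have "\<dots> = exp (- (L ^ 3))" by (simp flip: exp_diff)
  also have "\<dots> \<le> exp (- (l ^ 3))" using power_mono[OF l(2,1), of 3] by simp
  finally show ?thesis .
qed

text \<open>The lower bound on \<alpha> makes L = ln (d/\<alpha>) at most (1 + p d) ln d, which is
  polylogarithmic, so L^3 is eventually negligible against d. The threshold D depends on p
  alone.\<close>

lemma polylog_dominated:
  assumes "polylog p"
  obtains D :: nat where "D \<ge> 5"
    "\<And>d L. d \<ge> D \<Longrightarrow> ln (real d) \<le> L \<Longrightarrow> L \<le> ln (real d) + p d * ln (real d) \<Longrightarrow>
      L \<ge> 300 \<and> 4 * L ^ 3 + 20 \<le> (real d - 5) / 10"
proof -
  obtain k where "p \<in> O(\<lambda>d. ln (real d) ^ k)" using assms by (auto simp: polylog_def)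
  then obtain B where B: "B > 0" "eventually (\<lambda>d. norm (p d) \<le> B * norm (ln (real d) ^ k)) sequentially"
    by (elim landau_o.bigE)
  define n where "n = 3 * (k + 1)"
  \<comment> \<open>Chosen so that L^3 \<le> d/80, hence 4 L^3 \<le> d/20; the other half of d/10
    covers the additive constants for d \<ge> 5000.\<close>
  define \<epsilon> where "\<epsilon> = 1 / (80 * (1 + B) ^ 3)"
  have \<epsilon>: "\<epsilon> > 0" using B by (simp add: \<epsilon>_def)
  have ln_top: "filterlim (\<lambda>d. ln (real d)) at_top sequentially"
    by (rule filterlim_compose[OF ln_at_top filterlim_real_sequentially])
  have "((\<lambda>d. ln (real d) ^ n / exp (ln (real d))) \<longlongrightarrow> 0) sequentially"
    by (rule filterlim_compose[OF tendsto_power_div_exp_0 ln_top])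
  hence "eventually (\<lambda>d. ln (real d) ^ n / exp (ln (real d)) < \<epsilon>) sequentially"
    using \<epsilon> by (rule order_tendstoD(2))
  moreover have "eventually (\<lambda>d. ln (real d) \<ge> 300) sequentially"
    using ln_top by (auto simp: filterlim_at_top)
  moreover have "eventually (\<lambda>d. d \<ge> 5000) sequentially" by (rule eventually_ge_at_top)
  ultimately have "eventually (\<lambda>d. d \<ge> 5000 \<and> ln (real d) \<ge> 300 \<and> ln (real d) ^ n / exp (ln (real d)) < \<epsilon>
      \<and> norm (p d) \<le> B * norm (ln (real d) ^ k)) sequentially"
    using B(2) by eventually_elim auto
  then obtain D where D: "\<And>d. d \<ge> D \<Longrightarrow> d \<ge> 5000 \<and> ln (real d) \<ge> 300 \<and> ln (real d) ^ n / exp (ln (real d)) < \<epsilon>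
      \<and> norm (p d) \<le> B * norm (ln (real d) ^ k)"
    by (auto simp: eventually_sequentially)
  show ?thesis
  proof (rule that[of "max D 5"])
    fix d :: nat and L :: real
    assume d: "d \<ge> max D 5" and L: "ln (real d) \<le> L" "L \<le> ln (real d) + p d * ln (real d)"
    define y where "y = ln (real d)"
    have y: "y \<ge> 300" "d \<ge> 5000" "\<bar>p d\<bar> \<le> B * y ^ k" and yn: "y ^ n / real d < \<epsilon>"
      using D[of d] d by (auto simp: y_def)
    have "p d * y \<le> B * y ^ k * y" using y by (intro mult_right_mono) auto
    hence "L \<le> y + B * y ^ (k + 1)" using L(2) by (simp add: y_def mult_ac)
    also have "\<dots> \<le> y ^ (k + 1) + B * y ^ (k + 1)" using y self_le_power[of y "k + 1"] by simp
    finally have "L \<le> (1 + B) * y ^ (k + 1)" by (simp add: algebra_simps)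
    hence "L ^ 3 \<le> ((1 + B) * y ^ (k + 1)) ^ 3" using L(1) y by (intro power_mono) (auto simp: y_def)
    also have "\<dots> = (1 + B) ^ 3 * y ^ n"
      unfolding n_def power_mult_distrib power_mult[symmetric] by (simp add: mult.commute)
    also have "\<dots> \<le> (1 + B) ^ 3 * (\<epsilon> * real d)"
      using yn y B by (intro mult_left_mono) (auto simp: field_simps)
    also have "\<dots> = real d / 80" using B by (simp add: \<epsilon>_def)
    finally have "4 * L ^ 3 \<le> real d / 20" by simp
    hence "4 * L ^ 3 + 20 \<le> (real d - 5) / 10" using y(2) by (simp add: field_simps)
    thus "L \<ge> 300 \<and> 4 * L ^ 3 + 20 \<le> (real d - 5) / 10" using L(1) y(1) by (simp add: y_def)
  qed simp
qed

theorem theorem3p5: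
  shows "\<exists>\<rho>\<^sub>0 > (0::real). \<exists>C\<^sub>0 > (0::real). \<exists>K > (0::real).
    \<forall>p. polylog p \<longrightarrow> (\<exists>c > (0::real).
      \<forall>(C::real) (d::nat) (\<rho>::real) (\<sigma>::real) (s::real) (\<alpha>::real) (f :: (nat \<Rightarrow> real) \<times> real \<Rightarrow> real).
        C \<ge> C\<^sub>0 \<and> d \<ge> 1 \<and>
        0 < \<rho> \<and> \<rho> < \<rho>\<^sub>0 \<and> \<sigma> = sqrt (1 - \<rho>\<^sup>2) \<and>
        0 < s \<and> s < 1 \<and> s / \<rho> \<le> 1 / 1000 \<and>
        0 < \<alpha> \<and> \<alpha> < 1 \<and>
        \<alpha> \<ge> c * real d powr (- p d) \<and>
        \<rho>\<^sup>2 \<ge> s\<^sup>2 * ln (real d / \<alpha>) powr C \<and>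
        f \<in> borel_measurable (Rd d \<Otimes>\<^sub>M borel) \<and>
        (\<forall>z \<in> space (Rd d \<Otimes>\<^sub>M borel). 0 \<le> f z \<and> f z \<le> 1)
        \<longrightarrow>
        \<P>(v in unif_sphere d.
            \<bar>(\<integral>z. f z \<partial>Q_law d \<rho> \<sigma> s v) - (\<integral>z. f z \<partial>T_law d \<rho> \<sigma> s v)\<bar>
              \<ge> K * (\<alpha> / real d) powr (ln (real d / \<alpha>))\<^sup>2)
          \<le> real d powr (- (ln (real d))\<^sup>2))"
\<comment> \<open>The witness 1/2 for \<open>\<rho>\<^sub>0\<close> keeps \<sigma>^2 \<ge> 3/4. The
  witness 4 for \<open>C\<^sub>0\<close> gives \<rho>^2/s^2 \<ge> L^4 with L = ln (d/\<alpha>), one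
  power more than the L^3 to be beaten. With K = 1 the threshold is exactly exp(-L^3).\<close>
proof (rule exI[of _ "1/2"], rule conjI, simp, rule exI[of _ 4], rule conjI, simp, rule exI[of _ 1], rule conjI, simp,
    intro allI impI, goal_cases)
  case (1 p)
  then obtain D :: nat where D: "D \<ge> 5"
    "\<And>d L. d \<ge> D \<Longrightarrow> ln (real d) \<le> L \<Longrightarrow> L \<le> ln (real d) + p d * ln (real d) \<Longrightarrow>
      L \<ge> 300 \<and> 4 * L ^ 3 + 20 \<le> (real d - 5) / 10"
    by (rule polylog_dominated) blast
  \<comment> \<open>With this \<open>c\<close> the hypothesis on \<open>\<alpha>\<close> is unsatisfiable for \<open>d < D\<close>, because \<open>\<alpha> < 1\<close>.\<close>
  define c where "c = 1 + (\<Sum>j<D. real j powr (p j))"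
  have c1: "c \<ge> 1" unfolding c_def by (simp add: sum_nonneg)
  show ?case
  proof (rule exI[of _ c], rule conjI, use c1 in simp, intro allI impI, elim conjE)
    fix C \<rho> \<sigma> s \<alpha> :: real and d :: nat and f :: "(nat \<Rightarrow> real) \<times> real \<Rightarrow> real"
    assume C: "4 \<le> C" and d1: "1 \<le> d" and \<rho>: "0 < \<rho>" "\<rho> < 1/2" and \<sigma>: "\<sigma> = sqrt (1 - \<rho>\<^sup>2)"
      and s: "0 < s" "s < 1" "s / \<rho> \<le> 1 / 1000" and \<alpha>: "0 < \<alpha>" "\<alpha> < 1" "c * real d powr (- p d) \<le> \<alpha>"
      and sr: "s\<^sup>2 * ln (real d / \<alpha>) powr C \<le> \<rho>\<^sup>2"
      and f: "f \<in> borel_measurable (Rd d \<Otimes>\<^sub>M borel)" "\<forall>z\<in>space (Rd d \<Otimes>\<^sub>M borel). 0 \<le> f z \<and> f z \<le> 1"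
    have dpos: "real d > 0" using d1 by simp
    have dD: "d \<ge> D"
    proof (rule ccontr)
      assume "\<not> d \<ge> D"
      hence "real d powr (p d) \<le> (\<Sum>j<D. real j powr (p j))" by (intro member_le_sum) auto
      hence "real d powr (p d) * real d powr (- p d) \<le> c * real d powr (- p d)"
        unfolding c_def by (intro mult_right_mono) auto
      moreover have "real d powr (p d) * real d powr (- p d) = 1" using dpos by (simp flip: powr_add)
      ultimately show False using \<alpha> by linarith
    qed
    define L where "L = ln (real d / \<alpha>)"
    have L_eq: "L = ln (real d) - ln \<alpha>" unfolding L_def using dpos \<alpha> by (simp add: ln_div)
    have l: "ln (real d) \<le> L" using \<alpha> by (simp add: L_eq)
    have "real d powr (- p d) \<le> c * real d powr (- p d)" using c1 mult_right_mono[of 1 c "real d powr (- p d)"] by simp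
    hence "real d powr (- p d) \<le> \<alpha>" using \<alpha>(3) by linarith
    hence "ln (real d powr (- p d)) \<le> ln \<alpha>" using dpos \<alpha> by (subst ln_le_cancel_iff) auto
    hence "- p d * ln (real d) \<le> ln \<alpha>" using dpos by (simp add: ln_powr)
    hence "L \<le> ln (real d) + p d * ln (real d)" by (simp add: L_eq)
    with D(2)[OF dD l] have L: "L \<ge> 300" "4 * L ^ 3 + 20 \<le> (real d - 5) / 10" by auto
    have x: "L ^ 4 \<le> \<rho>\<^sup>2 / s\<^sup>2"
    proof -
      have "L ^ 4 = L powr 4" using L by simp
      also have "\<dots> \<le> L powr C" using L C by (intro powr_mono) auto
      also have "\<dots> \<le> \<rho>\<^sup>2 / s\<^sup>2" using sr s by (simp add: L_def field_simps)
      finally show ?thesis .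
    qed
    have \<kappa>: "1 * (\<alpha> / real d) powr (ln (real d / \<alpha>))\<^sup>2 = exp (- (L ^ 3))"
    proof -
      have "ln (\<alpha> / real d) = - L" using dpos \<alpha> by (simp add: L_eq ln_div)
      thus ?thesis using dpos \<alpha> by (simp add: powr_def L_def[symmetric] power2_eq_square power3_eq_cube)
    qed
    have "\<P>(v in unif_sphere d. \<bar>(\<integral>z. f z \<partial>Q_law d \<rho> \<sigma> s v) - (\<integral>z. f z \<partial>T_law d \<rho> \<sigma> s v)\<bar> \<ge> exp (- (L ^ 3)))
       \<le> 72 * sqrt (16 * exp (- (\<rho>\<^sup>2 / (64 * s\<^sup>2))) + 100 * (4/5) powr ((real d - 5) / 2)) / exp (- (L ^ 3))"
      using dD D(1) \<rho> s f by (intro Q_T_deviation \<sigma>) auto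
    also have "\<rho>\<^sup>2 / (64 * s\<^sup>2) = \<rho>\<^sup>2 / s\<^sup>2 / 64" by simp
    also have "72 * sqrt (16 * exp (- (\<rho>\<^sup>2 / s\<^sup>2 / 64)) + 100 * (4/5) powr ((real d - 5) / 2)) / exp (- (L ^ 3)) \<le> exp (- (ln (real d) ^ 3))"
      using d1 by (intro deviation_numeric L x l) simp
    also have "\<dots> = real d powr (- (ln (real d))\<^sup>2)"
      using dpos by (simp add: powr_def power2_eq_square power3_eq_cube)
    finally show "\<P>(v in unif_sphere d. 1 * (\<alpha> / real d) powr (ln (real d / \<alpha>))\<^sup>2
        \<le> \<bar>(\<integral>z. f z \<partial>Q_law d \<rho> \<sigma> s v) - (\<integral>z. f z \<partial>T_law d \<rho> \<sigma> s v)\<bar>)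
      \<le> real d powr (- (ln (real d))\<^sup>2)"
      unfolding \<kappa> .
  qed
qed

end
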